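(* Let $(M^n,g_t,H_t)$ be a solution to generalized Ricci flow and let $\alpha_t$ be a one-parameter family of one-forms on $M$ solving the one-form dilaton flow $\frac{\partial}{\partial t}\alpha=\Delta_d\alpha+\frac16d|H|^2$. Then $$\square R^{H,\alpha}=2\,\Bigl|\mathrm{Rc}-\tfrac14H^2+L_{\frac12\alpha^\sharp}g\Bigr|^2+\tfrac12|d\alpha|^2+\tfrac12\bigl|d^*_gH+i_{\alpha^\sharp}H\bigr|^2 .$$
   Context: Conventions: inner products and norms of tensors and forms are full tensor contractions, e.g. $|H|^2=H_{ijk}H^{ijk}$, $|d\alpha|^2=(d\alpha)_{ij}(d\alpha)^{ij}$. $\mathrm{Rc}$, $R$ are the Ricci tensor and scalar curvature of $g$; $\Delta=\mathrm{tr}_g\nabla^2$ on functions; $\square=\frac{\partial}{\partial t}-\Delta$; $d^*_g$ is the codifferential, $(d^*_gH)_{jk}=-\nabla^iH_{ijk}$; $\Delta_d=-(dd^*_g+d^*_gd)$ is the Hodge Laplacian with the sign for which $\frac{\partial}{\partial t}-\Delta_d$ is a forward heat operator; $\mathrm{div}\,\alpha=\nabla^i\alpha_i$; $L$ is Lie derivative; $\alpha^\sharp$ is the vector field metrically dual to $\alpha$; $H^2(X,Y)=\langle i_XH,i_YH\rangle$. Generalized Ricci flow: a one-parameter family of Riemannian metrics $g_t$ and closed three-forms $H_t=H_0+db_t$ with $\frac{\partial}{\partial t}g=-2\mathrm{Rc}+\frac12H^2$, $\frac{\partial}{\partial t}b=-d^*_gH$. For a metric $g$, closed three-form $H$ and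 one-form $\alpha$ (not necessarily closed), the generalized scalar curvature is $$R^{H,\alpha}=R-\tfrac1{12}|H|^2+2\,\mathrm{div}\,\alpha-|\alpha|^2 .$$ *)

theory Defs
  imports "HOL-Analysis.Analysis"
begin

text \<open>Conventions. A smooth \<open>n\<close>-manifold is a Hausdorff, second countable space
  \<open>'m\<close> with a smooth atlas modelled on \<open>real ^ 'n\<close>. Covariant tensor fields are given
  classically, by components: \<open>T c p i j \<dots>\<close> is the component of the tensor at the point \<open>p\<close>
  in the coordinates of the chart \<open>c\<close>, meaningful for \<open>p \<in> chart_dom c\<close>, and the components
  in different charts are related by the tensor transformation law. All operations are
  given by their usual coordinate formulas, so that they act on such families chart by chart;
  scalars built from tensors are therefore also written with a chart argument.\<close>

section \<open>Smooth functions\<close>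

text \<open>The set \<open>S\<close> is either open or the product of a nondegenerate interval with an open set; on
  these the derivative within \<open>S\<close> is unique. In the second case this is smoothness up to those
  endpoints of the interval that belong to it.\<close>

primrec Ck_on :: "nat \<Rightarrow> ('a::euclidean_space \<Rightarrow> real) \<Rightarrow> 'a set \<Rightarrow> bool" where
  "Ck_on 0 f S \<longleftrightarrow> continuous_on S f"
| "Ck_on (Suc k) f S \<longleftrightarrow>
    (\<exists>f'. (\<forall>x\<in>S. (f has_derivative (\<lambda>v. \<Sum>e\<in>Basis. (v \<bullet> e) * f' e x)) (at x within S)) \<and>
          (\<forall>e\<in>Basis. Ck_on k (f' e) S))"

definition smooth_on :: "('a::euclidean_space \<Rightarrow> real) \<Rightarrow> 'a set \<Rightarrow> bool" where
  "smooth_on f S \<longleftrightarrow> (\<forall>k. Ck_on k f S)"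


section \<open>Manifolds and tensor fields\<close>

type_synonym ('m, 'n) chart = "'m set \<times> ('m \<Rightarrow> real ^ 'n)"

abbreviation chart_dom :: "('m, 'n) chart \<Rightarrow> 'm set" where
  "chart_dom c \<equiv> fst c"

abbreviation chart_map :: "('m, 'n) chart \<Rightarrow> 'm \<Rightarrow> real ^ 'n" where
  "chart_map c \<equiv> snd c"

abbreviation chart_inv :: "('m, 'n) chart \<Rightarrow> real ^ 'n \<Rightarrow> 'm" where
  "chart_inv c \<equiv> inv_into (chart_dom c) (chart_map c)"

definition smooth_atlas ::
  "('m::{t2_space, second_countable_topology}, 'n::finite) chart set \<Rightarrow> bool" where
  "smooth_atlas A \<longleftrightarrow>
    (\<Union>c\<in>A. chart_dom c) = UNIV \<and>
    (\<forall>c\<in>A. open (chart_dom c) \<and> open (chart_map c ` chart_dom c) \<and>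
       homeomorphism (chart_dom c) (chart_map c ` chart_dom c) (chart_map c) (chart_inv c)) \<and>
    (\<forall>c\<in>A. \<forall>c'\<in>A. \<forall>k. smooth_on (\<lambda>x. chart_map c' (chart_inv c x) $ k)
       (chart_map c ` (chart_dom c \<inter> chart_dom c')))"

text \<open>Coordinate derivative \<open>\<partial>f/\<partial>x\<^sup>i\<close> at \<open>p\<close> in the chart \<open>c\<close>.\<close>

definition pd :: "('m, 'n::finite) chart \<Rightarrow> 'n \<Rightarrow> ('m \<Rightarrow> real) \<Rightarrow> 'm \<Rightarrow> real" where
  "pd c i f p = frechet_derivative (\<lambda>x. f (chart_inv c x)) (at (chart_map c p)) (axis i 1)"

type_synonym ('m, 'n) field0 = "('m, 'n) chart \<Rightarrow> 'm \<Rightarrow> real"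
type_synonym ('m, 'n) field1 = "('m, 'n) chart \<Rightarrow> 'm \<Rightarrow> 'n \<Rightarrow> real"
type_synonym ('m, 'n) field2 = "('m, 'n) chart \<Rightarrow> 'm \<Rightarrow> 'n \<Rightarrow> 'n \<Rightarrow> real"
type_synonym ('m, 'n) field3 = "('m, 'n) chart \<Rightarrow> 'm \<Rightarrow> 'n \<Rightarrow> 'n \<Rightarrow> 'n \<Rightarrow> real"
type_synonym ('m, 'n) field4 = "('m, 'n) chart \<Rightarrow> 'm \<Rightarrow> 'n \<Rightarrow> 'n \<Rightarrow> 'n \<Rightarrow> 'n \<Rightarrow> real"

text \<open>The entry \<open>\<partial>x\<^sup>k/\<partial>y\<^sup>i\<close> of the Jacobian, \<open>x\<close> and \<open>y\<close> being the coordinates of \<open>c\<close> and \<open>c'\<close>.\<close>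

definition jac :: "('m, 'n::finite) chart \<Rightarrow> ('m, 'n) chart \<Rightarrow> 'm \<Rightarrow> 'n \<Rightarrow> 'n \<Rightarrow> real" where
  "jac c c' p k i = pd c' i (\<lambda>q. chart_map c q $ k) p"

definition chart_smooth :: "('m, 'n::finite) chart \<Rightarrow> ('m \<Rightarrow> real) \<Rightarrow> bool" where
  "chart_smooth c f \<longleftrightarrow> smooth_on (\<lambda>x. f (chart_inv c x)) (chart_map c ` chart_dom c)"

definition tensor1 :: "('m, 'n::finite) chart set \<Rightarrow> ('m, 'n) field1 \<Rightarrow> bool" where
  "tensor1 A T \<longleftrightarrow>
    (\<forall>c\<in>A. \<forall>i. chart_smooth c (\<lambda>p. T c p i)) \<and>
    (\<forall>c\<in>A. \<forall>c'\<in>A. \<forall>p\<in>chart_dom c \<inter> chart_dom c'. \<forall>i.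
       T c' p i = (\<Sum>a\<in>UNIV. jac c c' p a i * T c p a))"

definition tensor2 :: "('m, 'n::finite) chart set \<Rightarrow> ('m, 'n) field2 \<Rightarrow> bool" where
  "tensor2 A T \<longleftrightarrow>
    (\<forall>c\<in>A. \<forall>i j. chart_smooth c (\<lambda>p. T c p i j)) \<and>
    (\<forall>c\<in>A. \<forall>c'\<in>A. \<forall>p\<in>chart_dom c \<inter> chart_dom c'. \<forall>i j.
       T c' p i j = (\<Sum>a\<in>UNIV. \<Sum>b\<in>UNIV. jac c c' p a i * jac c c' p b j * T c p a b))"

definition tensor3 :: "('m, 'n::finite) chart set \<Rightarrow> ('m, 'n) field3 \<Rightarrow> bool" where
  "tensor3 A T \<longleftrightarrow>
    (\<forall>c\<in>A. \<forall>i j k. chart_smooth c (\<lambda>p. T c p i j k)) \<and>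
    (\<forall>c\<in>A. \<forall>c'\<in>A. \<forall>p\<in>chart_dom c \<inter> chart_dom c'. \<forall>i j k.
       T c' p i j k = (\<Sum>a\<in>UNIV. \<Sum>b\<in>UNIV. \<Sum>d\<in>UNIV.
         jac c c' p a i * jac c c' p b j * jac c c' p d k * T c p a b d))"

definition riemannian_metric :: "('m, 'n::finite) chart set \<Rightarrow> ('m, 'n) field2 \<Rightarrow> bool" where
  "riemannian_metric A g \<longleftrightarrow> tensor2 A g \<and>
    (\<forall>c\<in>A. \<forall>p\<in>chart_dom c.
       (\<forall>i j. g c p i j = g c p j i) \<and>
       (\<forall>v::'n \<Rightarrow> real. v \<noteq> (\<lambda>i. 0) \<longrightarrow> (\<Sum>i\<in>UNIV. \<Sum>j\<in>UNIV. g c p i j * v i * v j) > 0))"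

abbreviation one_form :: "('m, 'n::finite) chart set \<Rightarrow> ('m, 'n) field1 \<Rightarrow> bool" where
  "one_form A \<alpha> \<equiv> tensor1 A \<alpha>"

definition two_form :: "('m, 'n::finite) chart set \<Rightarrow> ('m, 'n) field2 \<Rightarrow> bool" where
  "two_form A b \<longleftrightarrow> tensor2 A b \<and>
    (\<forall>c\<in>A. \<forall>p\<in>chart_dom c. \<forall>i j. b c p i j = - b c p j i)"

definition three_form :: "('m, 'n::finite) chart set \<Rightarrow> ('m, 'n) field3 \<Rightarrow> bool" where
  "three_form A H \<longleftrightarrow> tensor3 A H \<and>
    (\<forall>c\<in>A. \<forall>p\<in>chart_dom c. \<forall>i j k.
       H c p i j k = - H c p j i k \<and> H c p i j k = - H c p i k j)"


section \<open>Exterior derivative\<close>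

definition ext_d0 :: "('m, 'n::finite) field0 \<Rightarrow> ('m, 'n) field1" where
  "ext_d0 f c p i = pd c i (f c) p"

definition ext_d1 :: "('m, 'n::finite) field1 \<Rightarrow> ('m, 'n) field2" where
  "ext_d1 \<alpha> c p i j = pd c i (\<lambda>q. \<alpha> c q j) p - pd c j (\<lambda>q. \<alpha> c q i) p"

definition ext_d2 :: "('m, 'n::finite) field2 \<Rightarrow> ('m, 'n) field3" where
  "ext_d2 b c p i j k =
    pd c i (\<lambda>q. b c q j k) p - pd c j (\<lambda>q. b c q i k) p + pd c k (\<lambda>q. b c q i j) p"

definition ext_d3 :: "('m, 'n::finite) field3 \<Rightarrow> ('m, 'n) field4" where
  "ext_d3 H c p i j k l =
    pd c i (\<lambda>q. H c q j k l) p - pd c j (\<lambda>q. H c q i k l) p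
    + pd c k (\<lambda>q. H c q i j l) p - pd c l (\<lambda>q. H c q i j k) p"

definition closed3 :: "('m, 'n::finite) chart set \<Rightarrow> ('m, 'n) field3 \<Rightarrow> bool" where
  "closed3 A H \<longleftrightarrow> (\<forall>c\<in>A. \<forall>p\<in>chart_dom c. \<forall>i j k l. ext_d3 H c p i j k l = 0)"


section \<open>Riemannian geometry\<close>

definition ginv :: "('m, 'n::finite) field2 \<Rightarrow> ('m, 'n) field2" where
  "ginv g c p i j = matrix_inv (\<chi> k l. g c p k l) $ i $ j"

text \<open>\<open>christoffel g c p k i j\<close> is \<open>\<Gamma>\<^sup>k\<^sub>i\<^sub>j\<close>.\<close>

definition christoffel :: "('m, 'n::finite) field2 \<Rightarrow> ('m, 'n) field3" where
  "christoffel g c p k i j = (1/2) * (\<Sum>l\<in>UNIV. ginv g c p k l *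
    (pd c i (\<lambda>q. g c q j l) p + pd c j (\<lambda>q. g c q i l) p - pd c l (\<lambda>q. g c q i j) p))"

text \<open>\<open>riem g c p l k i j\<close> is the \<open>l\<close>-th component of \<open>R(\<partial>\<^sub>i, \<partial>\<^sub>j)\<partial>\<^sub>k\<close>, where
  \<open>R(X, Y) = \<nabla>\<^sub>X \<nabla>\<^sub>Y - \<nabla>\<^sub>Y \<nabla>\<^sub>X - \<nabla>\<^bsub>[X, Y]\<^esub>\<close>.\<close>

definition riem :: "('m, 'n::finite) field2 \<Rightarrow> ('m, 'n) field4" where
  "riem g c p l k i j =
    pd c i (\<lambda>q. christoffel g c q l j k) p - pd c j (\<lambda>q. christoffel g c q l i k) p
    + (\<Sum>m\<in>UNIV. christoffel g c p l i m * christoffel g c p m j k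
                - christoffel g c p l j m * christoffel g c p m i k)"

definition Rc :: "('m, 'n::finite) field2 \<Rightarrow> ('m, 'n) field2" where
  "Rc g c p j k = (\<Sum>i\<in>UNIV. riem g c p i k i j)"

definition scal :: "('m, 'n::finite) field2 \<Rightarrow> ('m, 'n) field0" where
  "scal g c p = (\<Sum>i\<in>UNIV. \<Sum>j\<in>UNIV. ginv g c p i j * Rc g c p i j)"

text \<open>Covariant derivatives; the first index is that of the derivative.\<close>

definition nabla1 :: "('m, 'n::finite) field2 \<Rightarrow> ('m, 'n) field1 \<Rightarrow> ('m, 'n) field2" where
  "nabla1 g \<alpha> c p i j =
    pd c i (\<lambda>q. \<alpha> c q j) p - (\<Sum>m\<in>UNIV. christoffel g c p m i j * \<alpha> c p m)"

definition nabla2 :: "('m, 'n::finite) field2 \<Rightarrow> ('m, 'n) field2 \<Rightarrow> ('m, 'n) field3" where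
  "nabla2 g T c p i j k =
    pd c i (\<lambda>q. T c q j k) p
    - (\<Sum>m\<in>UNIV. christoffel g c p m i j * T c p m k)
    - (\<Sum>m\<in>UNIV. christoffel g c p m i k * T c p j m)"

definition nabla3 :: "('m, 'n::finite) field2 \<Rightarrow> ('m, 'n) field3 \<Rightarrow> ('m, 'n) field4" where
  "nabla3 g T c p i j k l =
    pd c i (\<lambda>q. T c q j k l) p
    - (\<Sum>m\<in>UNIV. christoffel g c p m i j * T c p m k l)
    - (\<Sum>m\<in>UNIV. christoffel g c p m i k * T c p j m l)
    - (\<Sum>m\<in>UNIV. christoffel g c p m i l * T c p j k m)"

definition divergence :: "('m, 'n::finite) field2 \<Rightarrow> ('m, 'n) field1 \<Rightarrow> ('m, 'n) field0" where
  "divergence g \<alpha> c p = (\<Sum>i\<in>UNIV. \<Sum>j\<in>UNIV. ginv g c p i j * nabla1 g \<alpha> c p i j)"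

text \<open>\<open>\<nabla>\<^sup>2 f = \<nabla> (df)\<close> and \<open>\<Delta> f\<close> is its trace.\<close>

definition hessian :: "('m, 'n::finite) field2 \<Rightarrow> ('m, 'n) field0 \<Rightarrow> ('m, 'n) field2" where
  "hessian g f = nabla1 g (ext_d0 f)"

definition laplacian :: "('m, 'n::finite) field2 \<Rightarrow> ('m, 'n) field0 \<Rightarrow> ('m, 'n) field0" where
  "laplacian g f c p = (\<Sum>i\<in>UNIV. \<Sum>j\<in>UNIV. ginv g c p i j * hessian g f c p i j)"

definition codiff1 :: "('m, 'n::finite) field2 \<Rightarrow> ('m, 'n) field1 \<Rightarrow> ('m, 'n) field0" where
  "codiff1 g \<alpha> c p = - (\<Sum>i\<in>UNIV. \<Sum>j\<in>UNIV. ginv g c p i j * nabla1 g \<alpha> c p i j)"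

definition codiff2 :: "('m, 'n::finite) field2 \<Rightarrow> ('m, 'n) field2 \<Rightarrow> ('m, 'n) field1" where
  "codiff2 g b c p k = - (\<Sum>i\<in>UNIV. \<Sum>j\<in>UNIV. ginv g c p i j * nabla2 g b c p i j k)"

definition codiff3 :: "('m, 'n::finite) field2 \<Rightarrow> ('m, 'n) field3 \<Rightarrow> ('m, 'n) field2" where
  "codiff3 g H c p k l = - (\<Sum>i\<in>UNIV. \<Sum>j\<in>UNIV. ginv g c p i j * nabla3 g H c p i j k l)"

text \<open>\<open>\<Delta>\<^sub>d = -(d d\<^sup>* + d\<^sup>* d)\<close> on one-forms.\<close>

definition hodge_laplacian1 :: "('m, 'n::finite) field2 \<Rightarrow> ('m, 'n) field1 \<Rightarrow> ('m, 'n) field1" where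
  "hodge_laplacian1 g \<alpha> c p i =
    - (ext_d0 (codiff1 g \<alpha>) c p i + codiff2 g (ext_d1 \<alpha>) c p i)"

text \<open>Inner products are full contractions.\<close>

definition inner1 :: "('m, 'n::finite) field2 \<Rightarrow> ('m, 'n) field1 \<Rightarrow> ('m, 'n) field1 \<Rightarrow> ('m, 'n) field0" where
  "inner1 g S T c p = (\<Sum>i\<in>UNIV. \<Sum>a\<in>UNIV. ginv g c p i a * S c p i * T c p a)"

definition inner2 :: "('m, 'n::finite) field2 \<Rightarrow> ('m, 'n) field2 \<Rightarrow> ('m, 'n) field2 \<Rightarrow> ('m, 'n) field0" where
  "inner2 g S T c p = (\<Sum>i\<in>UNIV. \<Sum>j\<in>UNIV. \<Sum>a\<in>UNIV. \<Sum>b\<in>UNIV.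
    ginv g c p i a * ginv g c p j b * S c p i j * T c p a b)"

definition inner3 :: "('m, 'n::finite) field2 \<Rightarrow> ('m, 'n) field3 \<Rightarrow> ('m, 'n) field3 \<Rightarrow> ('m, 'n) field0" where
  "inner3 g S T c p = (\<Sum>i\<in>UNIV. \<Sum>j\<in>UNIV. \<Sum>k\<in>UNIV. \<Sum>a\<in>UNIV. \<Sum>b\<in>UNIV. \<Sum>d\<in>UNIV.
    ginv g c p i a * ginv g c p j b * ginv g c p k d * S c p i j k * T c p a b d)"

abbreviation normsq1 :: "('m, 'n::finite) field2 \<Rightarrow> ('m, 'n) field1 \<Rightarrow> ('m, 'n) field0" where
  "normsq1 g T \<equiv> inner1 g T T"

abbreviation normsq2 :: "('m, 'n::finite) field2 \<Rightarrow> ('m, 'n) field2 \<Rightarrow> ('m, 'n) field0" where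
  "normsq2 g T \<equiv> inner2 g T T"

abbreviation normsq3 :: "('m, 'n::finite) field2 \<Rightarrow> ('m, 'n) field3 \<Rightarrow> ('m, 'n) field0" where
  "normsq3 g T \<equiv> inner3 g T T"

text \<open>\<open>H\<^sup>2(\<partial>\<^sub>i, \<partial>\<^sub>j)\<close>; the components of the two-form \<open>i\<^bsub>\<partial>\<^sub>i\<^esub>H\<close> are \<open>H c p i\<close>.\<close>

definition Hsq :: "('m, 'n::finite) field2 \<Rightarrow> ('m, 'n) field3 \<Rightarrow> ('m, 'n) field2" where
  "Hsq g H c p i j = inner2 g (\<lambda>c p. H c p i) (\<lambda>c p. H c p j) c p"

text \<open>Components of vector fields, too, have type \<open>field1\<close>.\<close>

definition sharp :: "('m, 'n::finite) field2 \<Rightarrow> ('m, 'n) field1 \<Rightarrow> ('m, 'n) field1" where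
  "sharp g \<alpha> c p i = (\<Sum>j\<in>UNIV. ginv g c p i j * \<alpha> c p j)"

definition interior3 :: "('m, 'n::finite) field1 \<Rightarrow> ('m, 'n) field3 \<Rightarrow> ('m, 'n) field2" where
  "interior3 X H c p j k = (\<Sum>i\<in>UNIV. X c p i * H c p i j k)"

definition lie2 :: "('m, 'n::finite) field1 \<Rightarrow> ('m, 'n) field2 \<Rightarrow> ('m, 'n) field2" where
  "lie2 X T c p i j = (\<Sum>k\<in>UNIV. X c p k * pd c k (\<lambda>q. T c q i j) p
    + T c p k j * pd c i (\<lambda>q. X c q k) p + T c p i k * pd c j (\<lambda>q. X c q k) p)"

definition gen_scal ::
  "('m, 'n::finite) field2 \<Rightarrow> ('m, 'n) field3 \<Rightarrow> ('m, 'n) field1 \<Rightarrow> ('m, 'n) field0" where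
  "gen_scal g H \<alpha> c p =
    scal g c p - (1/12) * normsq3 g H c p + 2 * divergence g \<alpha> c p - normsq1 g \<alpha> c p"


section \<open>One-parameter families and flows\<close>

definition time_interval :: "real set \<Rightarrow> bool" where
  "time_interval I \<longleftrightarrow> is_interval I \<and> interior I \<noteq> {}"

definition family_smooth ::
  "real set \<Rightarrow> ('m, 'n::finite) chart \<Rightarrow> (real \<Rightarrow> 'm \<Rightarrow> real) \<Rightarrow> bool" where
  "family_smooth I c u \<longleftrightarrow>
    smooth_on (\<lambda>(t, x). u t (chart_inv c x)) (I \<times> chart_map c ` chart_dom c)"

definition one_form_family ::
  "('m, 'n::finite) chart set \<Rightarrow> real set \<Rightarrow> (real \<Rightarrow> ('m, 'n) field1) \<Rightarrow> bool" where
  "one_form_family A I \<alpha> \<longleftrightarrow>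
    (\<forall>t\<in>I. one_form A (\<alpha> t)) \<and> (\<forall>c\<in>A. \<forall>i. family_smooth I c (\<lambda>t p. \<alpha> t c p i))"

definition two_form_family ::
  "('m, 'n::finite) chart set \<Rightarrow> real set \<Rightarrow> (real \<Rightarrow> ('m, 'n) field2) \<Rightarrow> bool" where
  "two_form_family A I b \<longleftrightarrow>
    (\<forall>t\<in>I. two_form A (b t)) \<and> (\<forall>c\<in>A. \<forall>i j. family_smooth I c (\<lambda>t p. b t c p i j))"

definition metric_family ::
  "('m, 'n::finite) chart set \<Rightarrow> real set \<Rightarrow> (real \<Rightarrow> ('m, 'n) field2) \<Rightarrow> bool" where
  "metric_family A I g \<longleftrightarrow>
    (\<forall>t\<in>I. riemannian_metric A (g t)) \<and>
    (\<forall>c\<in>A. \<forall>i j. family_smooth I c (\<lambda>t p. g t c p i j))"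

text \<open>The closed three-form \<open>H\<^sub>0\<close> is a fixed background; neither \<open>0 \<in> I\<close> nor \<open>b 0 = 0\<close> is required.\<close>

definition generalized_Ricci_flow ::
  "('m, 'n::finite) chart set \<Rightarrow> real set \<Rightarrow> (real \<Rightarrow> ('m, 'n) field2) \<Rightarrow>
    (real \<Rightarrow> ('m, 'n) field3) \<Rightarrow> bool" where
  "generalized_Ricci_flow A I g H \<longleftrightarrow>
    metric_family A I g \<and>
    (\<forall>t\<in>I. three_form A (H t) \<and> closed3 A (H t)) \<and>
    (\<exists>H0 b. three_form A H0 \<and> closed3 A H0 \<and> two_form_family A I b \<and>
      (\<forall>t\<in>I. \<forall>c\<in>A. \<forall>p\<in>chart_dom c. \<forall>i j k.
         H t c p i j k = H0 c p i j k + ext_d2 (b t) c p i j k) \<and>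
      (\<forall>t\<in>I. \<forall>c\<in>A. \<forall>p\<in>chart_dom c. \<forall>i j.
         ((\<lambda>s. g s c p i j) has_real_derivative
            - 2 * Rc (g t) c p i j + (1/2) * Hsq (g t) (H t) c p i j) (at t within I) \<and>
         ((\<lambda>s. b s c p i j) has_real_derivative
            - codiff3 (g t) (H t) c p i j) (at t within I)))"

definition one_form_dilaton_flow ::
  "('m, 'n::finite) chart set \<Rightarrow> real set \<Rightarrow> (real \<Rightarrow> ('m, 'n) field2) \<Rightarrow>
    (real \<Rightarrow> ('m, 'n) field3) \<Rightarrow> (real \<Rightarrow> ('m, 'n) field1) \<Rightarrow> bool" where
  "one_form_dilaton_flow A I g H \<alpha> \<longleftrightarrow>
    one_form_family A I \<alpha> \<and>
    (\<forall>t\<in>I. \<forall>c\<in>A. \<forall>p\<in>chart_dom c. \<forall>i.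
       ((\<lambda>s. \<alpha> s c p i) has_real_derivative
          hodge_laplacian1 (g t) (\<alpha> t) c p i + (1/6) * ext_d0 (normsq3 (g t) (H t)) c p i)
         (at t within I))"

text \<open>\<open>\<box> u = \<partial>u/\<partial>t - \<Delta> u\<close>, with the Laplacian of \<open>g t\<close> at time \<open>t\<close>.\<close>

definition heat_operator ::
  "real set \<Rightarrow> (real \<Rightarrow> ('m, 'n::finite) field2) \<Rightarrow> (real \<Rightarrow> ('m, 'n) field0) \<Rightarrow>
    real \<Rightarrow> ('m, 'n) field0" where
  "heat_operator I g u t c p =
    vector_derivative (\<lambda>s. u s c p) (at t within I) - laplacian (g t) (u t) c p"

end

theory Submission
  imports Defs
begin

text \<open>Everything takes place in one chart: the coordinate formulas involve only the components of
  \<open>g\<close>, \<open>H\<close>, \<open>\<alpha>\<close> in that chart, so the transformation laws of tensors play no role.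

  With \<open>h = \<partial>g/\<partial>t = - 2 Rc + H\<^sup>2/2\<close>, \<open>\<beta> = d\<^sup>* H\<close> and \<open>P\<^sub>i = \<langle>H\<^sub>i, \<beta>\<rangle>\<close>, the identity is the sum of four
  evolution equations.
  \<^item> The variation \<open>\<partial>R/\<partial>t = div div h - \<Delta> tr h - \<langle>h, Rc\<rangle>\<close>, the contracted Bianchi identity and, because
    \<open>dH = 0\<close>, \<open>div H\<^sup>2 = d|H|\<^sup>2/6 - P\<close> give
    \<open>\<box> R = 2 |Rc|\<^sup>2 - \<langle>H\<^sup>2, Rc\<rangle>/2 - 5 \<Delta> |H|\<^sup>2/12 - div P/2\<close> (\<open>evolution_Scal\<close>).
  \<^item> Since \<open>\<partial>H/\<partial>t = - d \<beta>\<close>, one has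
    \<open>\<partial>|H|\<^sup>2/\<partial>t = - 6 (div P + |\<beta>|\<^sup>2) - 3 \<langle>h, H\<^sup>2\<rangle>\<close> (\<open>evolution_nH\<close>).
  \<^item> The codifferential squares to zero, so \<open>div \<Delta>\<^sub>d \<alpha> = \<Delta> div \<alpha>\<close>; together with the variation of the
    divergence this is \<open>evolution_dvg\<close>.
  \<^item> The Weitzenboeck formula \<open>\<Delta>\<^sub>d \<alpha> = \<Delta> \<alpha> - Rc(\<alpha>)\<close> turns the evolution of \<open>|\<alpha>|\<^sup>2\<close> into
    \<open>evolution_n\<alpha>\<close>.

  In the combination \<open>R - |H|\<^sup>2/12 + 2 div \<alpha> - |\<alpha>|\<^sup>2\<close> the terms in \<open>\<Delta> |H|\<^sup>2\<close>, \<open>div P\<close> and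
  \<open>\<langle>\<alpha>, d|H|\<^sup>2\<rangle>\<close> cancel, and the remaining quadratic terms complete to the three squares
  (\<open>inn_E\<close>, \<open>inn_d\<alpha>\<close>, \<open>inn_\<beta>_i\<alpha>H\<close>), \<open>\<nabla>\<alpha>\<close> being the sum of \<open>L\<^bsub>\<alpha>/2\<^esub> g\<close> and \<open>d\<alpha>/2\<close>.

  The tensor calculus is carried out without smoothness hypotheses, over an abstract commutative ring
  with commuting derivations (the locales \<open>covariant_calculus\<close> to \<open>flow_calculus\<close>). It applies to
  smooth functions because sending a function to the family of all its iterated partial derivatives at a
  fixed point of space-time (its Taylor jet) is a homomorphism into such a ring, that of formal jets,
  and it intertwines partial derivatives with the derivations there. Each equation that holds between
  smooth functions throughout the chart thus becomes an equation between jets, and the conclusion is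
  read off from the values of the jets. At an endpoint of the time interval the time derivatives are
  one-sided; the symmetry of second derivatives extends to it from the interior by continuity.\<close>

section \<open>Formal jets\<close>

text \<open>A function \<open>u\<close> is recorded at a point by the real numbers \<open>f w\<close>, the derivative of \<open>u\<close> along the
  word \<open>w\<close> of directions. By the Leibniz rule, products of functions then correspond to the shuffle product.\<close>

primrec shuffle_prod :: "'k list \<Rightarrow> ('k list \<Rightarrow> real) \<Rightarrow> ('k list \<Rightarrow> real) \<Rightarrow> real" where
  "shuffle_prod [] f h = f [] * h []"
| "shuffle_prod (k # w) f h =
     shuffle_prod w (\<lambda>v. f (k # v)) h + shuffle_prod w f (\<lambda>v. h (k # v))"

text \<open>Invariance under transposition of neighbouring letters: partial derivatives commute.\<close>

definition symmetric_words :: "('k list \<Rightarrow> real) \<Rightarrow> bool" where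
  "symmetric_words f \<longleftrightarrow> (\<forall>u a b v. f (u @ a # b # v) = f (u @ b # a # v))"

lemma shuffle_prod_add_left:
  "shuffle_prod w (\<lambda>v. f v + f' v) h = shuffle_prod w f h + shuffle_prod w f' h"
  by (induction w arbitrary: f f' h) (auto simp: algebra_simps)

lemma shuffle_prod_commute: "shuffle_prod w f h = shuffle_prod w h f"
  by (induction w arbitrary: f h) (auto simp: algebra_simps)

lemma shuffle_prod_add_right:
  "shuffle_prod w f (\<lambda>v. h v + h' v) = shuffle_prod w f h + shuffle_prod w f h'"
  by (simp add: shuffle_prod_commute[of w f] shuffle_prod_add_left)

lemma shuffle_prod_scale_left: "shuffle_prod w (\<lambda>v. c * f v) h = c * shuffle_prod w f h"
  by (induction w arbitrary: f h) (auto simp: algebra_simps)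

lemma shuffle_prod_scale_right: "shuffle_prod w f (\<lambda>v. c * h v) = c * shuffle_prod w f h"
  by (simp add: shuffle_prod_commute[of w f] shuffle_prod_scale_left)

lemma shuffle_prod_zero_left: "shuffle_prod w (\<lambda>v. 0) h = 0"
  by (induction w arbitrary: h) auto

lemma shuffle_prod_assoc:
  "shuffle_prod w (\<lambda>v. shuffle_prod v f f') h = shuffle_prod w f (\<lambda>v. shuffle_prod v f' h)"
  by (induction w arbitrary: f f' h)
    (auto simp: shuffle_prod_add_left shuffle_prod_add_right algebra_simps)

lemma shuffle_prod_one_left: "shuffle_prod w (\<lambda>v. if v = [] then 1 else 0) h = h w"
  by (induction w arbitrary: h) (auto simp: shuffle_prod_zero_left)

lemma symmetric_words_tail: "symmetric_words f \<Longrightarrow> symmetric_words (\<lambda>v. f (k # v))"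
  unfolding symmetric_words_def by (metis append_Cons)

lemma symmetric_words_shuffle_prod:
  assumes "symmetric_words f" "symmetric_words h"
  shows "symmetric_words (\<lambda>w. shuffle_prod w f h)"
proof -
  have "shuffle_prod (u @ a # b # v) f h = shuffle_prod (u @ b # a # v) f h" for u a b v
    using assms
  proof (induction u arbitrary: f h)
    case Nil
    have "f (a # b # w) = f (b # a # w)" "h (a # b # w) = h (b # a # w)" for w
      using Nil unfolding symmetric_words_def by (metis append_Nil)+
    then show ?case by simp
  next
    case (Cons k u)
    show ?case
      using Cons.IH[OF symmetric_words_tail Cons.prems(2)] Cons.IH[OF Cons.prems(1) symmetric_words_tail]
        Cons.prems by simp
  qed
  then show ?thesis unfolding symmetric_words_def by blast
qed

text \<open>Formal jets in the directions \<open>'k\<close>: a ring isomorphic to that of formal power series, in which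
  the partial derivatives are shifts.\<close>

typedef 'k jet = "{f :: 'k list \<Rightarrow> real. symmetric_words f}"
  by (rule exI[of _ "\<lambda>_. 0"]) (simp add: symmetric_words_def)

setup_lifting type_definition_jet

instantiation jet :: (type) "{comm_ring_1, real_algebra_1}"
begin

lift_definition zero_jet :: "'a jet" is "\<lambda>_. 0" by (simp add: symmetric_words_def)
lift_definition one_jet :: "'a jet" is "\<lambda>w. if w = [] then 1 else 0"
  by (simp add: symmetric_words_def)
lift_definition plus_jet :: "'a jet \<Rightarrow> 'a jet \<Rightarrow> 'a jet" is "\<lambda>f h w. f w + h w"
  by (simp add: symmetric_words_def)
lift_definition minus_jet :: "'a jet \<Rightarrow> 'a jet \<Rightarrow> 'a jet" is "\<lambda>f h w. f w - h w"
  by (simp add: symmetric_words_def)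
lift_definition uminus_jet :: "'a jet \<Rightarrow> 'a jet" is "\<lambda>f w. - f w"
  by (simp add: symmetric_words_def)
lift_definition times_jet :: "'a jet \<Rightarrow> 'a jet \<Rightarrow> 'a jet" is "\<lambda>f h w. shuffle_prod w f h"
  by (rule symmetric_words_shuffle_prod)
lift_definition scaleR_jet :: "real \<Rightarrow> 'a jet \<Rightarrow> 'a jet" is "\<lambda>c f w. c * f w"
  by (simp add: symmetric_words_def)

instance
proof
  fix a b c :: "'a jet" and x y :: real
  show "a + b + c = a + (b + c)" by transfer (simp add: algebra_simps)
  show "a + b = b + a" by transfer (simp add: algebra_simps)
  show "0 + a = a" by transfer simp
  show "- a + a = 0" by transfer simp
  show "a - b = a + - b" by transfer simp
  show "a * b * c = a * (b * c)" by transfer (simp add: shuffle_prod_assoc)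
  show "a * b = b * a" by transfer (rule ext, rule shuffle_prod_commute)
  show "1 * a = a" by transfer (simp add: shuffle_prod_one_left)
  show "(a + b) * c = a * c + b * c" by transfer (simp add: shuffle_prod_add_left)
  show "a * (b + c) = a * b + a * c" by transfer (simp add: shuffle_prod_add_right)
  show "a * 1 = a"
    by transfer (rule ext, subst shuffle_prod_commute, rule shuffle_prod_one_left)
  show "(0::'a jet) \<noteq> 1" by transfer (metis zero_neq_one)
  show "x *\<^sub>R (a + b) = x *\<^sub>R a + x *\<^sub>R b" by transfer (simp add: algebra_simps)
  show "(x + y) *\<^sub>R a = x *\<^sub>R a + y *\<^sub>R a" by transfer (simp add: algebra_simps)
  show "x *\<^sub>R y *\<^sub>R a = (x * y) *\<^sub>R a" by transfer (simp add: algebra_simps)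
  show "1 *\<^sub>R a = a" by transfer simp
  show "x *\<^sub>R a * b = x *\<^sub>R (a * b)" by transfer (simp add: shuffle_prod_scale_left)
  show "a * x *\<^sub>R b = x *\<^sub>R (a * b)"
    by transfer (simp add: shuffle_prod_scale_right)
qed

end

lift_definition jet_deriv :: "'k \<Rightarrow> 'k jet \<Rightarrow> 'k jet" is "\<lambda>k f w. f (k # w)"
  by (rule symmetric_words_tail)

lift_definition jet_value :: "'k jet \<Rightarrow> real" is "\<lambda>f. f []" .

lemma jet_deriv_add: "jet_deriv k (a + b) = jet_deriv k a + jet_deriv k b" by transfer simp
lemma jet_deriv_scaleR: "jet_deriv k (x *\<^sub>R b) = x *\<^sub>R jet_deriv k b" by transfer simp
lemma jet_deriv_mult: "jet_deriv k (a * b) = jet_deriv k a * b + a * jet_deriv k b"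
  by transfer simp
lemma jet_deriv_commute: "jet_deriv k (jet_deriv l a) = jet_deriv l (jet_deriv k a)"
  by transfer (metis append_Nil symmetric_words_def)

lemma jet_value_simps:
  "jet_value (a + b) = jet_value a + jet_value b"
  "jet_value (a - b) = jet_value a - jet_value b"
  "jet_value (- a) = - jet_value a"
  "jet_value (a * b) = jet_value a * jet_value b"
  "jet_value (x *\<^sub>R a) = x * jet_value a"
  "jet_value 0 = 0" "jet_value 1 = 1"
  by (transfer; simp)+

section \<open>Covariant calculus over a differential ring\<close>

text \<open>A real-linear derivation of a commutative algebra.\<close>

locale derivation =
  fixes d :: "'r::{comm_ring_1, real_algebra_1} \<Rightarrow> 'r"
  assumes add: "d (a + b) = d a + d b"
    and mult: "d (a * b) = d a * b + a * d b"
    and scaleR: "d (x *\<^sub>R a) = x *\<^sub>R d a"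
begin

lemma zero: "d 0 = 0" using add[of 0 0] by simp
lemma one: "d 1 = 0" using mult[of 1 1] by simp
lemma minus: "d (- a) = - d a" using scaleR[of "-1" a] by simp
lemma diff: "d (a - b) = d a - d b" using add[of a "- b"] by (simp add: minus)
lemma sum: "d (\<Sum>x\<in>X. f x) = (\<Sum>x\<in>X. d (f x))"
  by (induction X rule: infinite_finite_induct) (auto simp: zero add)
lemma numeral: "d (numeral n) = 0"
  using scaleR[of "numeral n" 1] by (simp add: one scaleR_conv_of_real)

end

lemma numeral_mult_eq_iff: "numeral n * a = numeral n * b \<longleftrightarrow> a = b"
  for a b :: "'a::real_algebra_1"
  using scaleR_cancel_left[of "numeral n" a b] by (simp add: scaleR_conv_of_real)

lemma eq_uminus_self_iff: "a = - a \<longleftrightarrow> a = 0" for a :: "'a::real_vector"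
  by (metis add.right_inverse eq_neg_iff_add_eq_0 scaleR_2 scaleR_eq_0_iff zero_neq_numeral)

lemma numeral_mult_eq_scaleR: "numeral n * a = numeral n *\<^sub>R a" for a :: "'a::real_algebra_1"
  by (simp add: scaleR_conv_of_real)

lemma sum_delta_mult:
  fixes f :: "'n::finite \<Rightarrow> 'r::comm_ring_1"
  shows "(\<Sum>k\<in>UNIV. (if i = k then 1 else 0) * f k) = f i"
    and "(\<Sum>k\<in>UNIV. (if k = i then 1 else 0) * f k) = f i"
    and "(\<Sum>k\<in>UNIV. f k * (if i = k then 1 else 0)) = f i"
    and "(\<Sum>k\<in>UNIV. f k * (if k = i then 1 else 0)) = f i"
  by (simp_all add: if_distrib[of "\<lambda>x. x * _"] if_distrib[of "\<lambda>x. _ * x"] cong: if_cong)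

lemma sum_rotate3:
  "(\<Sum>a\<in>A. \<Sum>b\<in>B. \<Sum>c\<in>C. f a b c) = (\<Sum>b\<in>B. \<Sum>c\<in>C. \<Sum>a\<in>A. f a b c)"
  by (rule trans[OF sum.swap]) (intro sum.cong refl sum.swap)

lemma sum_swap13:
  "(\<Sum>a\<in>A. \<Sum>b\<in>B. \<Sum>c\<in>C. f a b c) = (\<Sum>c\<in>C. \<Sum>b\<in>B. \<Sum>a\<in>A. f a b c)"
  by (rule trans[OF sum_rotate3]) (rule sum.swap)

text \<open>The algebraic situation of a metric in coordinates: \<open>D i\<close> plays the role of the coordinate derivative
  \<open>\<partial>/\<partial>x\<^sup>i\<close>, \<open>G\<close> is the inverse of \<open>g\<close>, and \<open>\<Gamma> m i j\<close> stands for \<open>\<Gamma>\<^sup>m\<^sub>i\<^sub>j\<close>, characterised by symmetry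
  and compatibility with \<open>g\<close>. Apart from \<open>G\<close>, \<open>\<Gamma>\<close>, the curvature \<open>Rm\<close> and the variation of \<open>\<Gamma>\<close>, all tensors
  have lower indices only.\<close>

locale covariant_calculus =
  fixes D :: "'n::finite \<Rightarrow> 'r::{comm_ring_1, real_algebra_1} \<Rightarrow> 'r"
    and g G :: "'n \<Rightarrow> 'n \<Rightarrow> 'r"
    and \<Gamma> :: "'n \<Rightarrow> 'n \<Rightarrow> 'n \<Rightarrow> 'r"
  assumes derivation_D: "derivation (D i)"
    and D_commute: "D i (D j a) = D j (D i a)"
    and g_sym: "g i j = g j i"
    and G_sym: "G i j = G j i"
    and G_g: "(\<Sum>k\<in>UNIV. G i k * g k j) = (if i = j then 1 else 0)"
    and \<Gamma>_sym: "\<Gamma> m i j = \<Gamma> m j i"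
    and D_g: "D k (g i j) = (\<Sum>m\<in>UNIV. \<Gamma> m k i * g m j) + (\<Sum>m\<in>UNIV. \<Gamma> m k j * g i m)"
begin

lemmas D_add = derivation.add[OF derivation_D]
  and D_mult = derivation.mult[OF derivation_D]
  and D_scaleR = derivation.scaleR[OF derivation_D]
  and D_zero = derivation.zero[OF derivation_D]
  and D_one = derivation.one[OF derivation_D]
  and D_minus = derivation.minus[OF derivation_D]
  and D_diff = derivation.diff[OF derivation_D]
  and D_sum = derivation.sum[OF derivation_D]
  and D_numeral = derivation.numeral[OF derivation_D]

lemmas D_simps = D_add D_mult D_scaleR D_zero D_one D_minus D_diff D_sum D_numeral

lemma g_G: "(\<Sum>k\<in>UNIV. g i k * G k j) = (if i = j then 1 else 0)"
  using G_g[of j i] by (simp add: mult.commute g_sym[of i] G_sym[of j] eq_commute)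

subsection \<open>Contraction\<close>

text \<open>Contraction of two lower indices.\<close>

definition ctr :: "('n \<Rightarrow> 'n \<Rightarrow> 'r) \<Rightarrow> 'r" where
  "ctr T = (\<Sum>a\<in>UNIV. \<Sum>b\<in>UNIV. G a b * T a b)"

lemma ctr_add: "ctr (\<lambda>a b. S a b + T a b) = ctr S + ctr T"
  and ctr_diff: "ctr (\<lambda>a b. S a b - T a b) = ctr S - ctr T"
  and ctr_minus: "ctr (\<lambda>a b. - T a b) = - ctr T"
  and ctr_zero: "ctr (\<lambda>a b. 0) = 0"
  and ctr_mult: "ctr (\<lambda>a b. s * T a b) = s * ctr T"
  and ctr_mult_right: "ctr (\<lambda>a b. T a b * s) = ctr T * s"
  and ctr_scaleR: "ctr (\<lambda>a b. x *\<^sub>R T a b) = x *\<^sub>R ctr T"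
  by (simp_all add: ctr_def sum.distrib sum_subtractf sum_negf sum_distrib_left
      sum_distrib_right scaleR_sum_right algebra_simps)

lemma ctr_sum: "ctr (\<lambda>a b. \<Sum>m\<in>X. T m a b) = (\<Sum>m\<in>X. ctr (T m))"
  by (induction X rule: infinite_finite_induct) (simp_all add: ctr_zero ctr_add)

lemmas ctr_simps = ctr_add ctr_diff ctr_minus ctr_zero ctr_mult ctr_mult_right ctr_scaleR ctr_sum

lemma ctr_transpose: "ctr (\<lambda>a b. T b a) = ctr T"
  unfolding ctr_def by (subst sum.swap) (simp add: G_sym)

lemma ctr_swap:
  "ctr (\<lambda>a b. ctr (\<lambda>c d. T a b c d)) = ctr (\<lambda>c d. ctr (\<lambda>a b. T a b c d))"
proof -
  have "ctr (\<lambda>a b. ctr (\<lambda>c d. T a b c d)) =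
      (\<Sum>a\<in>UNIV. \<Sum>b\<in>UNIV. \<Sum>c\<in>UNIV. \<Sum>d\<in>UNIV. G a b * (G c d * T a b c d))"
    by (simp add: ctr_def sum_distrib_left)
  also have "\<dots> = (\<Sum>a\<in>UNIV. \<Sum>c\<in>UNIV. \<Sum>d\<in>UNIV. \<Sum>b\<in>UNIV. G a b * (G c d * T a b c d))"
    by (intro sum.cong refl sum_rotate3)
  also have "\<dots> = (\<Sum>c\<in>UNIV. \<Sum>d\<in>UNIV. \<Sum>a\<in>UNIV. \<Sum>b\<in>UNIV. G a b * (G c d * T a b c d))"
    by (rule sum_rotate3)
  finally show ?thesis
    by (simp add: ctr_def sum_distrib_left mult.left_commute)
qed

lemma ctr_metric: "ctr (\<lambda>a b. g i a * T b) = T i"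
proof -
  have "ctr (\<lambda>a b. g i a * T b) = (\<Sum>b\<in>UNIV. (\<Sum>a\<in>UNIV. g i a * G a b) * T b)"
    unfolding ctr_def by (subst sum.swap) (simp add: sum_distrib_left sum_distrib_right algebra_simps)
  then show ?thesis by (simp add: g_G sum_delta_mult)
qed

text \<open>Contracting a lowered index is summation over an upper and a lower index.\<close>

lemma ctr_lower: "ctr (\<lambda>a b. \<Sum>l\<in>UNIV. g a l * X l b) = (\<Sum>l\<in>UNIV. X l l)"
  by (simp add: ctr_sum g_sym[of _ "l" for l] ctr_metric)

subsection \<open>Covariant derivatives\<close>

text \<open>Components of the covariant derivative of tensors with one to four lower indices; \<open>k\<close> is the index of
  the derivative.\<close>

definition cov1 :: "'n \<Rightarrow> ('n \<Rightarrow> 'r) \<Rightarrow> 'n \<Rightarrow> 'r" where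
  "cov1 k T a = D k (T a) - (\<Sum>m\<in>UNIV. \<Gamma> m k a * T m)"

definition cov2 :: "'n \<Rightarrow> ('n \<Rightarrow> 'n \<Rightarrow> 'r) \<Rightarrow> 'n \<Rightarrow> 'n \<Rightarrow> 'r" where
  "cov2 k T a b = D k (T a b) - (\<Sum>m\<in>UNIV. \<Gamma> m k a * T m b) - (\<Sum>m\<in>UNIV. \<Gamma> m k b * T a m)"

definition cov3 :: "'n \<Rightarrow> ('n \<Rightarrow> 'n \<Rightarrow> 'n \<Rightarrow> 'r) \<Rightarrow> 'n \<Rightarrow> 'n \<Rightarrow> 'n \<Rightarrow> 'r" where
  "cov3 k T a b c = D k (T a b c) - (\<Sum>m\<in>UNIV. \<Gamma> m k a * T m b c)
     - (\<Sum>m\<in>UNIV. \<Gamma> m k b * T a m c) - (\<Sum>m\<in>UNIV. \<Gamma> m k c * T a b m)"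

definition cov4 :: "'n \<Rightarrow> ('n \<Rightarrow> 'n \<Rightarrow> 'n \<Rightarrow> 'n \<Rightarrow> 'r) \<Rightarrow> 'n \<Rightarrow> 'n \<Rightarrow> 'n \<Rightarrow> 'n \<Rightarrow> 'r" where
  "cov4 k T a b c d = D k (T a b c d) - (\<Sum>m\<in>UNIV. \<Gamma> m k a * T m b c d)
     - (\<Sum>m\<in>UNIV. \<Gamma> m k b * T a m c d) - (\<Sum>m\<in>UNIV. \<Gamma> m k c * T a b m d)
     - (\<Sum>m\<in>UNIV. \<Gamma> m k d * T a b c m)"

lemma cov2_g: "cov2 k g a b = 0"
  by (simp add: cov2_def D_g)

lemma D_G: "D k (G i j) = - (\<Sum>m\<in>UNIV. \<Gamma> i k m * G m j) - (\<Sum>m\<in>UNIV. \<Gamma> j k m * G i m)"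
proof -
  \<comment> \<open>\<open>X\<close> is the covariant derivative of \<open>G\<close>; it vanishes because its contraction with \<open>g\<close> does.\<close>
  define X where "X j = D k (G i j) + (\<Sum>m\<in>UNIV. \<Gamma> i k m * G m j) + (\<Sum>m\<in>UNIV. \<Gamma> j k m * G i m)" for j
  have Xg: "(\<Sum>j\<in>UNIV. X j * g j l) = 0" for l
  proof -
    have "0 = D k (\<Sum>j\<in>UNIV. G i j * g j l)"
      by (simp add: G_g D_simps)
    also have "\<dots> = (\<Sum>j\<in>UNIV. D k (G i j) * g j l) + (\<Sum>j\<in>UNIV. G i j * D k (g j l))"
      by (simp add: D_simps sum.distrib)
    also have "(\<Sum>j\<in>UNIV. G i j * D k (g j l)) =
        (\<Sum>j\<in>UNIV. \<Sum>m\<in>UNIV. \<Gamma> m k j * G i j * g m l) + (\<Sum>j\<in>UNIV. \<Sum>m\<in>UNIV. G i j * g j m * \<Gamma> m k l)"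
      by (simp add: D_g sum_distrib_left sum.distrib algebra_simps)
    also have "(\<Sum>j\<in>UNIV. \<Sum>m\<in>UNIV. G i j * g j m * \<Gamma> m k l) = \<Gamma> i k l"
      by (subst sum.swap) (simp add: sum_distrib_right[symmetric] G_g sum_delta_mult)
    also have "(\<Sum>j\<in>UNIV. \<Sum>m\<in>UNIV. \<Gamma> m k j * G i j * g m l) =
        (\<Sum>j\<in>UNIV. (\<Sum>m\<in>UNIV. \<Gamma> j k m * G i m) * g j l)"
      by (subst sum.swap) (simp add: sum_distrib_right)
    also have "\<Gamma> i k l = (\<Sum>j\<in>UNIV. (\<Sum>m\<in>UNIV. \<Gamma> i k m * G m j) * g j l)"
    proof -
      have "(\<Sum>j\<in>UNIV. (\<Sum>m\<in>UNIV. \<Gamma> i k m * G m j) * g j l) =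
          (\<Sum>m\<in>UNIV. \<Gamma> i k m * (\<Sum>j\<in>UNIV. G m j * g j l))"
        by (simp add: sum_distrib_left sum_distrib_right mult.assoc) (rule sum.swap)
      then show ?thesis by (simp add: G_g sum_delta_mult)
    qed
    finally show ?thesis
      by (simp add: X_def distrib_right sum.distrib algebra_simps)
  qed
  have "X j = (\<Sum>m\<in>UNIV. X m * (\<Sum>l\<in>UNIV. g m l * G l j))"
    by (simp add: g_G sum_delta_mult)
  also have "\<dots> = (\<Sum>l\<in>UNIV. (\<Sum>m\<in>UNIV. X m * g m l) * G l j)"
    by (simp add: sum_distrib_left sum_distrib_right mult.assoc) (rule sum.swap)
  finally have "X j = 0" by (simp add: Xg)
  then show ?thesis by (simp add: X_def eq_diff_eq eq_neg_iff_add_eq_0 ac_simps)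
qed

text \<open>Covariant differentiation commutes with contraction; likewise, in the presence of further free indices,
  \<open>cov1_ctr\<close> and \<open>cov2_ctr\<close>.\<close>

lemma D_ctr: "D k (ctr T) = ctr (cov2 k T)"
proof -
  have "D k (ctr T) = (\<Sum>a\<in>UNIV. \<Sum>b\<in>UNIV. G a b * D k (T a b))
      - (\<Sum>a\<in>UNIV. \<Sum>b\<in>UNIV. \<Sum>m\<in>UNIV. \<Gamma> a k m * G m b * T a b)
      - (\<Sum>a\<in>UNIV. \<Sum>b\<in>UNIV. \<Sum>m\<in>UNIV. \<Gamma> b k m * G a m * T a b)"
    by (simp add: ctr_def D_simps D_G sum.distrib sum_subtractf sum_negf sum_distrib_left sum_distrib_right algebra_simps)
  also have "(\<Sum>a\<in>UNIV. \<Sum>b\<in>UNIV. \<Sum>m\<in>UNIV. \<Gamma> a k m * G m b * T a b)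
      = (\<Sum>a\<in>UNIV. \<Sum>b\<in>UNIV. \<Sum>m\<in>UNIV. \<Gamma> m k a * G a b * T m b)"
    by (rule sum_swap13)
  also have "(\<Sum>a\<in>UNIV. \<Sum>b\<in>UNIV. \<Sum>m\<in>UNIV. \<Gamma> b k m * G a m * T a b)
      = (\<Sum>a\<in>UNIV. \<Sum>b\<in>UNIV. \<Sum>m\<in>UNIV. \<Gamma> m k b * G a b * T a m)"
    by (intro sum.cong refl sum.swap)
  finally show ?thesis
    by (simp add: ctr_def cov2_def sum.distrib sum_subtractf sum_negf sum_distrib_left algebra_simps)
qed

lemma cov1_ctr: "cov1 k (\<lambda>j. ctr (\<lambda>a b. T a b j)) j = ctr (\<lambda>a b. cov3 k T a b j)"
proof -
  have "cov3 k T a b j = cov2 k (\<lambda>a b. T a b j) a b - (\<Sum>m\<in>UNIV. \<Gamma> m k j * T a b m)" for a b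
    by (simp add: cov2_def cov3_def)
  then show ?thesis by (simp add: cov1_def D_ctr ctr_simps)
qed

lemma cov2_ctr: "cov2 k (\<lambda>i j. ctr (\<lambda>a b. T a b i j)) i j = ctr (\<lambda>a b. cov4 k T a b i j)"
proof -
  have "cov4 k T a b i j = cov2 k (\<lambda>a b. T a b i j) a b
      - (\<Sum>m\<in>UNIV. \<Gamma> m k i * T a b m j) - (\<Sum>m\<in>UNIV. \<Gamma> m k j * T a b i m)" for a b
    by (simp add: cov2_def cov4_def)
  then show ?thesis by (simp add: cov2_def[of k "\<lambda>i j. ctr (\<lambda>a b. T a b i j)"] D_ctr ctr_simps)
qed

subsection \<open>Curvature\<close>

lemmas sum_simps = sum_distrib_left sum_distrib_right sum.distrib sum_subtractf sum_negf

text \<open>\<open>Rm l k i j\<close> is \<open>R\<^sup>l\<^sub>k\<^sub>i\<^sub>j\<close>, the \<open>l\<close>-th component of \<open>R(\<partial>\<^sub>i, \<partial>\<^sub>j)\<partial>\<^sub>k\<close>; the index \<open>l\<close> is lowered in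
  \<open>Rm_lower\<close> below.\<close>

definition Rm :: "'n \<Rightarrow> 'n \<Rightarrow> 'n \<Rightarrow> 'n \<Rightarrow> 'r" where
  "Rm l k i j = D i (\<Gamma> l j k) - D j (\<Gamma> l i k)
     + (\<Sum>m\<in>UNIV. \<Gamma> l i m * \<Gamma> m j k - \<Gamma> l j m * \<Gamma> m i k)"

definition Ric :: "'n \<Rightarrow> 'n \<Rightarrow> 'r" where
  "Ric j k = (\<Sum>i\<in>UNIV. Rm i k i j)"

definition Scal :: 'r where "Scal = ctr Ric"

definition Rm_lower :: "'n \<Rightarrow> 'n \<Rightarrow> 'n \<Rightarrow> 'n \<Rightarrow> 'r" where
  "Rm_lower l k i j = (\<Sum>m\<in>UNIV. g l m * Rm m k i j)"

lemma Rm_antisym: "Rm l k i j = - Rm l k j i"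
  by (simp add: Rm_def sum_subtractf)

lemma Rm_lower_antisym: "Rm_lower l k i j = - Rm_lower l k j i"
  unfolding Rm_lower_def by (subst Rm_antisym) (simp add: sum_negf)

lemma cov1_N1_expand:
  "cov2 i (\<lambda>j k. cov1 j \<alpha> k) j k =
     D i (D j (\<alpha> k)) - (\<Sum>m\<in>UNIV. D i (\<Gamma> m j k) * \<alpha> m)
     - (\<Sum>m\<in>UNIV. \<Gamma> m j k * D i (\<alpha> m)) - (\<Sum>m\<in>UNIV. \<Gamma> m i k * D j (\<alpha> m))
     - (\<Sum>m\<in>UNIV. \<Gamma> m i j * cov1 m \<alpha> k)
     + (\<Sum>l\<in>UNIV. (\<Sum>m\<in>UNIV. \<Gamma> l j m * \<Gamma> m i k) * \<alpha> l)"
proof -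
  have "(\<Sum>m\<in>UNIV. \<Gamma> m i k * (\<Sum>l\<in>UNIV. \<Gamma> l j m * \<alpha> l)) =
      (\<Sum>l\<in>UNIV. (\<Sum>m\<in>UNIV. \<Gamma> l j m * \<Gamma> m i k) * \<alpha> l)"
    by (simp add: sum_distrib_left sum_distrib_right, subst sum.swap, simp add: ac_simps)
  then show ?thesis
    unfolding cov2_def cov1_def[of j] by (simp add: D_simps sum.distrib sum_subtractf right_diff_distrib)
qed

text \<open>Ricci identities: the commutator of second covariant derivatives is curvature.\<close>

lemma ricci_identity1:
  "cov2 i (\<lambda>j k. cov1 j \<alpha> k) j k - cov2 j (\<lambda>j k. cov1 j \<alpha> k) i k = - (\<Sum>l\<in>UNIV. Rm l k i j * \<alpha> l)"
  unfolding cov1_N1_expand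
  by (simp add: Rm_def D_commute[of i j] \<Gamma>_sym[of _ j i] sum.distrib sum_subtractf
      left_diff_distrib distrib_right)

lemma cov2_N2_expand:
  "cov3 i (\<lambda>j k l. cov2 j T k l) j k l =
     D i (D j (T k l)) - (\<Sum>m\<in>UNIV. D i (\<Gamma> m j k) * T m l) - (\<Sum>m\<in>UNIV. D i (\<Gamma> m j l) * T k m)
     - (\<Sum>m\<in>UNIV. \<Gamma> m j k * D i (T m l)) - (\<Sum>m\<in>UNIV. \<Gamma> m j l * D i (T k m))
     - (\<Sum>m\<in>UNIV. \<Gamma> m i k * D j (T m l)) - (\<Sum>m\<in>UNIV. \<Gamma> m i l * D j (T k m))
     - (\<Sum>m\<in>UNIV. \<Gamma> m i j * cov2 m T k l)
     + (\<Sum>p\<in>UNIV. (\<Sum>m\<in>UNIV. \<Gamma> p j m * \<Gamma> m i k) * T p l)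
     + (\<Sum>p\<in>UNIV. (\<Sum>m\<in>UNIV. \<Gamma> p j m * \<Gamma> m i l) * T k p)
     + (\<Sum>m\<in>UNIV. \<Gamma> m i k * (\<Sum>p\<in>UNIV. \<Gamma> p j l * T m p))
     + (\<Sum>m\<in>UNIV. \<Gamma> m j k * (\<Sum>p\<in>UNIV. \<Gamma> p i l * T m p))"
proof -
  have "(\<Sum>m\<in>UNIV. \<Gamma> m i k * (\<Sum>p\<in>UNIV. \<Gamma> p j m * T p l)) =
      (\<Sum>p\<in>UNIV. (\<Sum>m\<in>UNIV. \<Gamma> p j m * \<Gamma> m i k) * T p l)"
    by (simp add: sum_distrib_left sum_distrib_right, subst sum.swap, simp add: ac_simps)
  moreover have "(\<Sum>m\<in>UNIV. \<Gamma> m i l * (\<Sum>p\<in>UNIV. \<Gamma> p j m * T k p)) =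
      (\<Sum>p\<in>UNIV. (\<Sum>m\<in>UNIV. \<Gamma> p j m * \<Gamma> m i l) * T k p)"
    by (simp add: sum_distrib_left sum_distrib_right, subst sum.swap, simp add: ac_simps)
  moreover have "(\<Sum>m\<in>UNIV. \<Gamma> m i l * (\<Sum>p\<in>UNIV. \<Gamma> p j k * T p m)) =
      (\<Sum>m\<in>UNIV. \<Gamma> m j k * (\<Sum>p\<in>UNIV. \<Gamma> p i l * T m p))"
    by (simp add: sum_distrib_left, subst sum.swap, simp add: mult.left_commute)
  ultimately show ?thesis
    unfolding cov3_def cov2_def[of j]
    by (simp add: D_simps sum.distrib sum_subtractf right_diff_distrib)
qed

lemma ricci_identity2:
  "cov3 i (\<lambda>j k l. cov2 j T k l) j k l - cov3 j (\<lambda>j k l. cov2 j T k l) i k l =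
     - (\<Sum>m\<in>UNIV. Rm m k i j * T m l) - (\<Sum>m\<in>UNIV. Rm m l i j * T k m)"
  unfolding cov2_N2_expand
  by (simp add: Rm_def D_commute[of i j] \<Gamma>_sym[of _ j i] sum.distrib sum_subtractf
      left_diff_distrib distrib_right)

text \<open>The Ricci identity for the parallel tensor \<open>g\<close>.\<close>

lemma Rm_lower_antisym_pair: "Rm_lower l k i j = - Rm_lower k l i j"
proof -
  have "(\<Sum>m\<in>UNIV. Rm m k i j * g m l) + (\<Sum>m\<in>UNIV. Rm m l i j * g k m) = 0"
    using ricci_identity2[of i g j k l]
    by (simp add: cov2_g cov3_def[of _ "\<lambda>j k l. 0"] D_zero add_eq_0_iff neg_eq_iff_add_eq_0)
  then show ?thesis
    by (simp add: Rm_lower_def g_sym[of _ l] mult.commute eq_neg_iff_add_eq_0)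
qed

lemma bianchi1: "Rm l k i j + Rm l i j k + Rm l j k i = 0"
  by (simp add: Rm_def \<Gamma>_sym[of _ k] \<Gamma>_sym[of _ j i] sum_subtractf)

lemma ctr_Rm_lower: "ctr (\<lambda>l i. Rm_lower l k i j) = Ric j k"
  unfolding Rm_lower_def Ric_def by (rule ctr_lower)

lemma ctr_Rm_lower': "ctr (\<lambda>k j. Rm_lower l k j m) = - Ric m l"
  by (subst Rm_lower_antisym_pair) (simp add: ctr_minus ctr_Rm_lower)

lemma Ric_sym: "Ric j k = Ric k j"
proof -
  have "ctr (\<lambda>a b. Rm_lower a b j k) = (\<Sum>l\<in>UNIV. Rm l l j k)"
    unfolding Rm_lower_def by (rule ctr_lower)
  moreover have "ctr (\<lambda>a b. Rm_lower a b j k) = - ctr (\<lambda>a b. Rm_lower a b j k)"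
    by (subst Rm_lower_antisym_pair) (simp add: ctr_minus ctr_transpose[of "\<lambda>a b. Rm_lower a b j k"])
  ultimately have *: "(\<Sum>l\<in>UNIV. Rm l l j k) = 0"
    by (simp add: eq_uminus_self_iff)
  have "0 = (\<Sum>l\<in>UNIV. Rm l k l j + Rm l l j k + Rm l j k l)"
    by (simp add: bianchi1)
  also have "\<dots> = Ric j k - Ric k j"
    by (simp add: sum.distrib * Ric_def Rm_antisym[of _ j k] sum_negf sum_subtractf)
  finally show ?thesis by simp
qed

text \<open>Lowering an index commutes with covariant differentiation.\<close>

lemma D_lower:
  "D m (\<Sum>q\<in>UNIV. g l q * X q) =
     (\<Sum>q\<in>UNIV. g l q * (D m (X q) + (\<Sum>p\<in>UNIV. \<Gamma> q m p * X p)))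
     + (\<Sum>p\<in>UNIV. \<Gamma> p m l * (\<Sum>q\<in>UNIV. g p q * X q))"
proof -
  have "(\<Sum>q\<in>UNIV. \<Sum>p\<in>UNIV. \<Gamma> p m q * g l p * X q) = (\<Sum>q\<in>UNIV. \<Sum>p\<in>UNIV. g l q * (\<Gamma> q m p * X p))"
    by (subst sum.swap) (simp add: ac_simps)
  moreover have "(\<Sum>q\<in>UNIV. \<Sum>p\<in>UNIV. \<Gamma> p m l * g p q * X q) = (\<Sum>p\<in>UNIV. \<Sum>q\<in>UNIV. \<Gamma> p m l * (g p q * X q))"
    by (subst sum.swap) (simp add: ac_simps)
  ultimately show ?thesis
    by (simp add: D_simps D_g sum.distrib distrib_left distrib_right sum_distrib_left sum_distrib_right)
qed

text \<open>The covariant derivative of \<open>Rm\<close> without the connection terms for the form indices \<open>i\<close>, \<open>j\<close>. Those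
  cancel in the cyclic sum of the second Bianchi identity.\<close>

definition Rm_nabla :: "'n \<Rightarrow> 'n \<Rightarrow> 'n \<Rightarrow> 'n \<Rightarrow> 'n \<Rightarrow> 'r" where
  "Rm_nabla m l k i j =
     D m (Rm l k i j) + (\<Sum>p\<in>UNIV. \<Gamma> l m p * Rm p k i j) - (\<Sum>p\<in>UNIV. \<Gamma> p m k * Rm l p i j)"

lemma Rm_nabla_expand:
  defines "P \<equiv> \<lambda>l k a b c. \<Sum>p\<in>UNIV. \<Sum>q\<in>UNIV. \<Gamma> l a p * (\<Gamma> p b q * \<Gamma> q c k)"
    and "Q \<equiv> \<lambda>l k a b c. \<Sum>p\<in>UNIV. D a (\<Gamma> l b p) * \<Gamma> p c k"
    and "Q' \<equiv> \<lambda>l k a b c. \<Sum>p\<in>UNIV. \<Gamma> l c p * D a (\<Gamma> p b k)"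
  shows "Rm_nabla m l k i j = D m (D i (\<Gamma> l j k)) - D m (D j (\<Gamma> l i k))
    + Q l k m i j + Q' l k m j i - Q l k m j i - Q' l k m i j
    + Q' l k i j m - Q' l k j i m + P l k m i j - P l k m j i
    - Q l k i j m + Q l k j i m - P l k i j m + P l k j i m"
proof -
  have "(\<Sum>p\<in>UNIV. \<Gamma> p m k * (\<Sum>q\<in>UNIV. \<Gamma> l a q * \<Gamma> q b p)) = P l k a b m" for a b
    unfolding P_def by (subst sum.swap) (simp add: sum_distrib_left ac_simps)
  moreover have "(\<Sum>p\<in>UNIV. \<Gamma> l m p * (\<Sum>q\<in>UNIV. \<Gamma> p a q * \<Gamma> q b k)) = P l k m a b" for a b
    unfolding P_def by (simp add: sum_distrib_left)
  ultimately show ?thesis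
    unfolding Rm_nabla_def Rm_def Q_def Q'_def
    by (simp add: D_simps sum.distrib sum_subtractf distrib_left right_diff_distrib mult.commute)
qed

lemma bianchi2_upper: "Rm_nabla m l k i j + Rm_nabla i l k j m + Rm_nabla j l k m i = 0"
  unfolding Rm_nabla_expand
  by (simp add: D_commute[of m i] D_commute[of m j] D_commute[of i j])

lemma cov4_Rm_lower:
  "cov4 m Rm_lower l k i j = (\<Sum>q\<in>UNIV. g l q * (Rm_nabla m q k i j
     - (\<Sum>p\<in>UNIV. \<Gamma> p m i * Rm q k p j) + (\<Sum>p\<in>UNIV. \<Gamma> p m j * Rm q k p i)))"
proof -
  have "cov4 m Rm_lower l k i j = (\<Sum>q\<in>UNIV. g l q * (Rm_nabla m q k i j
     - (\<Sum>p\<in>UNIV. \<Gamma> p m i * Rm q k p j) - (\<Sum>p\<in>UNIV. \<Gamma> p m j * Rm q k i p)))"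
  proof -
  have "(\<Sum>p\<in>UNIV. c p * (\<Sum>q\<in>UNIV. g l q * X q p)) = (\<Sum>q\<in>UNIV. g l q * (\<Sum>p\<in>UNIV. c p * X q p))"
    for c and X :: "'n \<Rightarrow> 'n \<Rightarrow> 'r"
    by (simp add: sum_distrib_left mult.left_commute) (rule sum.swap)
  then show ?thesis
    by (simp add: cov4_def Rm_lower_def D_lower Rm_nabla_def sum.distrib sum_subtractf distrib_left right_diff_distrib)
  qed
  then show ?thesis by (simp add: Rm_antisym[of _ _ i] sum_negf)
qed

lemma bianchi2: "cov4 m Rm_lower l k i j + cov4 i Rm_lower l k j m + cov4 j Rm_lower l k m i = 0"
proof -
  have "cov4 m Rm_lower l k i j + cov4 i Rm_lower l k j m + cov4 j Rm_lower l k m i =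
     (\<Sum>q\<in>UNIV. g l q * (Rm_nabla m q k i j + Rm_nabla i q k j m + Rm_nabla j q k m i))"
    by (simp add: cov4_Rm_lower sum.distrib[symmetric] distrib_left[symmetric] \<Gamma>_sym[of _ i m] \<Gamma>_sym[of _ j m] \<Gamma>_sym[of _ j i] add.assoc)
  then show ?thesis by (simp add: bianchi2_upper)
qed

lemma cov4_permute: 
  "cov4 m (\<lambda>l i j k. Rm_lower l k i j) l i j k = cov4 m Rm_lower l k i j"
  "cov4 i (\<lambda>k j m l. Rm_lower l k j m) k j m l = cov4 i Rm_lower l k j m"
  by (simp_all add: cov4_def algebra_simps)

lemma cov4_Rm_lower_antisym: "cov4 j Rm_lower l k m i = - cov4 j Rm_lower l k i m"
  by (simp add: cov4_def Rm_lower_antisym[of _ _ m] Rm_lower_antisym[of _ _ _ i] D_minus sum_negf)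

lemma cov2_Ric: "cov2 m Ric j k = ctr (\<lambda>l i. cov4 m Rm_lower l k i j)"
proof -
  have "Ric = (\<lambda>j k. ctr (\<lambda>l i. Rm_lower l k i j))" by (simp add: ctr_Rm_lower)
  then show ?thesis
    using cov2_ctr[of m "\<lambda>l i j k. Rm_lower l k i j" j k] by (simp add: cov4_permute)
qed

lemma cov2_Ric': "cov2 i Ric m l = - ctr (\<lambda>k j. cov4 i Rm_lower l k j m)"
proof -
  have "Ric = (\<lambda>m l. - ctr (\<lambda>k j. Rm_lower l k j m))" by (simp add: ctr_Rm_lower')
  then have "cov2 i Ric m l = - cov2 i (\<lambda>m l. ctr (\<lambda>k j. Rm_lower l k j m)) m l"
    by (simp add: cov2_def D_minus sum_negf)
  then show ?thesis
    using cov2_ctr[of i "\<lambda>k j m l. Rm_lower l k j m" m l] by (simp add: cov4_permute)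
qed

text \<open>Contracted second Bianchi identity.\<close>

lemma D_Scal: "D m Scal = 2 * ctr (\<lambda>j k. cov2 j Ric m k)"
proof -
  have 1: "cov2 m Ric j k - cov2 j Ric m k + ctr (\<lambda>l i. cov4 i Rm_lower l k j m) = 0" for j k
  proof -
    have "cov4 m Rm_lower l k i j + cov4 i Rm_lower l k j m - cov4 j Rm_lower l k i m = 0" for l i
      using bianchi2[of m l k i j] cov4_Rm_lower_antisym[of j l k m i] by simp
    then have "ctr (\<lambda>l i. cov4 m Rm_lower l k i j + cov4 i Rm_lower l k j m - cov4 j Rm_lower l k i m) = 0"
      by (simp add: ctr_zero)
    then show ?thesis
      by (simp add: ctr_simps cov2_Ric algebra_simps)
  qed
  have "ctr (\<lambda>k j. cov2 m Ric j k - cov2 j Ric m k + ctr (\<lambda>l i. cov4 i Rm_lower l k j m)) = 0"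
    by (simp add: 1 ctr_zero)
  moreover have "ctr (\<lambda>k j. cov2 m Ric j k) = D m Scal"
    by (simp add: Scal_def D_ctr ctr_transpose[of "cov2 m Ric"])
  moreover have "ctr (\<lambda>k j. cov2 j Ric m k) = ctr (\<lambda>j k. cov2 j Ric m k)"
    by (rule ctr_transpose)
  moreover have "ctr (\<lambda>k j. ctr (\<lambda>l i. cov4 i Rm_lower l k j m)) = - ctr (\<lambda>j k. cov2 j Ric m k)"
  proof -
    have "ctr (\<lambda>k j. ctr (\<lambda>l i. cov4 i Rm_lower l k j m)) = ctr (\<lambda>l i. ctr (\<lambda>k j. cov4 i Rm_lower l k j m))"
      by (rule ctr_swap)
    also have "\<dots> = ctr (\<lambda>l i. - cov2 i Ric m l)" by (simp add: cov2_Ric')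
    also have "\<dots> = - ctr (\<lambda>j k. cov2 j Ric m k)"
      by (simp add: ctr_minus ctr_transpose[of "\<lambda>i l. cov2 i Ric m l"])
    finally show ?thesis .
  qed
  ultimately show ?thesis by (simp add: ctr_simps algebra_simps)
qed

lemma cov1_add: "cov1 k (\<lambda>a. S a + T a) a = cov1 k S a + cov1 k T a"
  and cov1_diff: "cov1 k (\<lambda>a. S a - T a) a = cov1 k S a - cov1 k T a"
  and cov1_minus: "cov1 k (\<lambda>a. - T a) a = - cov1 k T a"
  and cov1_numeral: "cov1 k (\<lambda>a. numeral n * T a) a = numeral n * cov1 k T a"
  by (simp_all add: cov1_def D_simps sum_simps algebra_simps)

lemma cov2_diff: "cov2 k (\<lambda>a b. S a b - T a b) a b = cov2 k S a b - cov2 k T a b"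
  and cov2_minus: "cov2 k (\<lambda>a b. - T a b) a b = - cov2 k T a b"
  and cov2_numeral: "cov2 k (\<lambda>a b. numeral n * T a b) a b = numeral n * cov2 k T a b"
  by (simp_all add: cov2_def D_simps sum_simps algebra_simps)

lemma cov2_transpose: "cov2 k (\<lambda>a b. T b a) a b = cov2 k T b a"
  by (simp add: cov2_def algebra_simps)

lemma cov3_minus: "cov3 k (\<lambda>a b c. - T a b c) a b c = - cov3 k T a b c"
  by (simp add: cov3_def D_simps sum_simps algebra_simps)

lemma cov3_antisym23:
  assumes "\<And>a b c. T a b c = - T a c b"
  shows "cov3 k T a b c = - cov3 k T a c b"
proof -
  have "cov3 k (\<lambda>a b c. T a c b) a b c = cov3 k T a c b"
    by (simp add: cov3_def algebra_simps)
  moreover have "(\<lambda>a b c. T a c b) = (\<lambda>a b c. - T a b c)"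
    using assms by (intro ext)
  ultimately have "cov3 k T a c b = - cov3 k T a b c" by (simp add: cov3_minus)
  then show ?thesis by simp
qed

lemma cov2_antisym:
  assumes "\<And>a b. T a b = - T b a"
  shows "cov2 k T a b = - cov2 k T b a"
proof -
  have "cov2 k (\<lambda>a b. T b a) a b = cov2 k T b a"
    by (simp add: cov2_def algebra_simps)
  moreover have "(\<lambda>a b. T b a) = (\<lambda>a b. - T a b)"
    using assms by (intro ext)
  ultimately have "cov2 k T b a = - cov2 k T a b" by (simp add: cov2_minus)
  then show ?thesis by simp
qed

lemma cov2_mult: "cov2 k (\<lambda>a b. S a * T b) a b = cov1 k S a * T b + S a * cov1 k T b"
  by (simp add: cov1_def cov2_def D_simps sum_simps algebra_simps)

subsection \<open>Inner products\<close>

text \<open>Full contraction of two tensors of rank two.\<close>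

definition inn :: "('n \<Rightarrow> 'n \<Rightarrow> 'r) \<Rightarrow> ('n \<Rightarrow> 'n \<Rightarrow> 'r) \<Rightarrow> 'r" where
  "inn P Q = ctr (\<lambda>a b. ctr (\<lambda>c d. P a c * Q b d))"

text \<open>Laplacian of a scalar, divergence of a one-form, and divergence of a tensor of rank two on its second
  index.\<close>

definition lap :: "'r \<Rightarrow> 'r" where
  "lap f = ctr (\<lambda>i j. cov1 i (\<lambda>j. D j f) j)"

definition dvg :: "('n \<Rightarrow> 'r) \<Rightarrow> 'r" where
  "dvg T = ctr (\<lambda>i j. cov1 i T j)"

definition dvg2 :: "('n \<Rightarrow> 'n \<Rightarrow> 'r) \<Rightarrow> 'n \<Rightarrow> 'r" where
  "dvg2 T m = ctr (\<lambda>j k. cov2 j T m k)"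

lemma dvg_add: "dvg (\<lambda>a. S a + T a) = dvg S + dvg T"
  and dvg_diff: "dvg (\<lambda>a. S a - T a) = dvg S - dvg T"
  and dvg_minus: "dvg (\<lambda>a. - T a) = - dvg T"
  and dvg_numeral: "dvg (\<lambda>a. numeral n * T a) = numeral n * dvg T"
  by (simp_all add: dvg_def cov1_add cov1_diff cov1_minus cov1_numeral ctr_simps)

lemma lap_eq_dvg: "lap f = dvg (\<lambda>j. D j f)"
  by (simp add: lap_def dvg_def)

lemma lap_add: "lap (a + b) = lap a + lap b"
  and lap_diff: "lap (a - b) = lap a - lap b"
  and lap_numeral: "lap (numeral n * a) = numeral n * lap a"
  and lap_scaleR: "lap (x *\<^sub>R a) = x *\<^sub>R lap a"
  by (simp_all add: lap_def cov1_def ctr_simps D_simps sum_simps scaleR_diff_right algebra_simps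
      scaleR_sum_right)

lemma inn_add_left: "inn (\<lambda>a b. P a b + P' a b) Q = inn P Q + inn P' Q"
  and inn_diff_left: "inn (\<lambda>a b. P a b - P' a b) Q = inn P Q - inn P' Q"
  and inn_minus_left: "inn (\<lambda>a b. - P a b) Q = - inn P Q"
  and inn_mult_left: "inn (\<lambda>a b. s * P a b) Q = s * inn P Q"
  and inn_scaleR_left: "inn (\<lambda>a b. x *\<^sub>R P a b) Q = x *\<^sub>R inn P Q"
  and inn_sum_left: "inn (\<lambda>a b. \<Sum>m\<in>X. PP m a b) Q = (\<Sum>m\<in>X. inn (PP m) Q)"
  by (simp_all add: inn_def ctr_simps distrib_right left_diff_distrib mult.assoc sum_distrib_right)

lemma inn_commute: "inn P Q = inn Q P"
proof -
  have "inn P Q = ctr (\<lambda>a b. ctr (\<lambda>c d. P b d * Q a c))"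
    unfolding inn_def
    by (subst ctr_transpose[symmetric]) (subst (2) ctr_transpose[symmetric], rule refl)
  then show ?thesis by (simp add: inn_def mult.commute)
qed

lemma inn_add_right: "inn Q (\<lambda>a b. P a b + P' a b) = inn Q P + inn Q P'"
  and inn_diff_right: "inn Q (\<lambda>a b. P a b - P' a b) = inn Q P - inn Q P'"
  and inn_minus_right: "inn Q (\<lambda>a b. - P a b) = - inn Q P"
  and inn_mult_right: "inn Q (\<lambda>a b. s * P a b) = s * inn Q P"
  and inn_scaleR_right: "inn Q (\<lambda>a b. x *\<^sub>R P a b) = x *\<^sub>R inn Q P"
  and inn_sum_right: "inn Q (\<lambda>a b. \<Sum>m\<in>X. PP m a b) = (\<Sum>m\<in>X. inn Q (PP m))"
  by (simp_all add: inn_commute[of Q] inn_add_left inn_diff_left inn_minus_left inn_mult_left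
      inn_scaleR_left inn_sum_left)

lemmas inn_simps = inn_add_left inn_diff_left inn_minus_left inn_mult_left inn_scaleR_left
  inn_sum_left inn_add_right inn_diff_right inn_minus_right inn_mult_right inn_scaleR_right
  inn_sum_right

lemma inn_transpose: "inn (\<lambda>a b. P b a) (\<lambda>a b. Q b a) = inn P Q"
  unfolding inn_def by (rule ctr_swap)

lemma inn_sym_antisym:
  assumes "\<And>a b. S a b = S b a" "\<And>a b. T a b = - T b a"
  shows "inn S T = 0"
proof -
  have "inn S T = inn (\<lambda>a b. S b a) (\<lambda>a b. - T b a)"
    by (rule arg_cong2[where f = inn]) (intro ext assms)+
  also have "\<dots> = - inn S T" unfolding inn_minus_right inn_transpose[of S T] ..
  finally show ?thesis by (simp add: eq_uminus_self_iff)
qed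

text \<open>An inner product with a fixed tensor may be taken before or after a contraction over further indices.\<close>

lemma ctr_inn: "ctr (\<lambda>i j. inn h (X i j)) = inn h (\<lambda>a b. ctr (\<lambda>i j. X i j a b))"
proof -
  have "ctr (\<lambda>i j. inn h (X i j)) =
      ctr (\<lambda>a b. ctr (\<lambda>i j. ctr (\<lambda>c d. h a c * X i j b d)))"
    unfolding inn_def by (rule ctr_swap)
  also have "\<dots> = ctr (\<lambda>a b. ctr (\<lambda>c d. ctr (\<lambda>i j. h a c * X i j b d)))"
    by (subst ctr_swap) (rule refl)
  finally show ?thesis by (simp add: inn_def ctr_mult)
qed

lemma D_inn: "D k (inn P Q) = inn (cov2 k P) Q + inn P (cov2 k Q)"
proof -
  have "cov4 k (\<lambda>c d a b. P a c * Q b d) c d a b = cov2 k P a c * Q b d + P a c * cov2 k Q b d" for a b c d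
    by (simp add: cov4_def cov2_def D_simps sum_simps algebra_simps)
  then have "cov2 k (\<lambda>a b. ctr (\<lambda>c d. P a c * Q b d)) =
      (\<lambda>a b. ctr (\<lambda>c d. cov2 k P a c * Q b d + P a c * cov2 k Q b d))"
    using cov2_ctr[of k "\<lambda>c d a b. P a c * Q b d"] by (intro ext) simp
  then show ?thesis by (simp add: inn_def D_ctr ctr_add)
qed

lemma cov1_inn: "cov1 k (\<lambda>i. inn (P i) Q) i = inn (cov3 k P i) Q + inn (P i) (cov2 k Q)"
proof -
  have "cov3 k P i = (\<lambda>a b. cov2 k (P i) a b - (\<Sum>m\<in>UNIV. \<Gamma> m k i * P m a b))"
    by (simp add: fun_eq_iff cov3_def cov2_def)
  then show ?thesis
    by (simp add: cov1_def D_inn inn_diff_left inn_sum_left inn_mult_left)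
qed

lemma cov2_inn: "cov2 k (\<lambda>i j. inn (P i) (Q j)) i j = inn (cov3 k P i) (Q j) + inn (P i) (cov3 k Q j)"
proof -
  have "cov3 k P i = (\<lambda>a b. cov2 k (P i) a b - (\<Sum>m\<in>UNIV. \<Gamma> m k i * P m a b))" for P i
    by (simp add: fun_eq_iff cov3_def cov2_def)
  then show ?thesis
    by (simp add: cov2_def[of k "\<lambda>i j. inn (P i) (Q j)"] D_inn inn_diff_left inn_sum_left inn_mult_left
        inn_diff_right inn_sum_right inn_mult_right diff_diff_eq diff_add_eq add_diff_eq add_ac)
qed

subsection \<open>One-forms\<close>

lemma sum_Rm_eq_ctr: "(\<Sum>m\<in>UNIV. Rm m k i j * \<alpha> m) = ctr (\<lambda>l m. Rm_lower l k i j * \<alpha> m)"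
  using ctr_lower[of "\<lambda>l b. Rm l k i j * \<alpha> b"]
  by (simp add: Rm_lower_def sum_distrib_right mult.assoc)

text \<open>\<open>\<Delta>\<^sub>d \<alpha> = d div \<alpha> - d\<^sup>* d\<alpha>\<close>, the exterior derivative being expressed by covariant derivatives. The rough
  Laplacian is \<open>lap1\<close>.\<close>

definition hodge :: "('n \<Rightarrow> 'r) \<Rightarrow> 'n \<Rightarrow> 'r" where
  "hodge \<alpha> i = D i (dvg \<alpha>) + ctr (\<lambda>j k. cov2 j (\<lambda>k i. cov1 k \<alpha> i - cov1 i \<alpha> k) k i)"

definition lap1 :: "('n \<Rightarrow> 'r) \<Rightarrow> 'n \<Rightarrow> 'r" where
  "lap1 \<alpha> i = ctr (\<lambda>j k. cov2 j (\<lambda>k i. cov1 k \<alpha> i) k i)"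

lemma weitzenboeck: "hodge \<alpha> i = lap1 \<alpha> i - ctr (\<lambda>l m. Ric i l * \<alpha> m)"
proof -
  have *: "cov2 j (\<lambda>k i. cov1 k \<alpha> i - cov1 i \<alpha> k) k i =
      cov2 j (\<lambda>k i. cov1 k \<alpha> i) k i - cov2 i (\<lambda>j k. cov1 j \<alpha> k) j k + ctr (\<lambda>l m. Rm_lower l k j i * \<alpha> m)" for j k
    using ricci_identity1[of j \<alpha> i k, unfolded sum_Rm_eq_ctr]
    by (simp add: cov2_diff cov2_transpose[of j "\<lambda>i k. cov1 i \<alpha> k"] algebra_simps)
  have "hodge \<alpha> i = D i (dvg \<alpha>) + lap1 \<alpha> i - ctr (\<lambda>j k. cov2 i (\<lambda>j k. cov1 j \<alpha> k) j k)
     + ctr (\<lambda>j k. ctr (\<lambda>l m. Rm_lower l k j i * \<alpha> m))"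
    unfolding hodge_def lap1_def * by (simp add: ctr_add ctr_diff)
  moreover have "ctr (\<lambda>j k. ctr (\<lambda>l m. Rm_lower l k j i * \<alpha> m)) = - ctr (\<lambda>l m. Ric i l * \<alpha> m)"
  proof -
    have "ctr (\<lambda>j k. Rm_lower l k j i) = - Ric i l" for l
      using ctr_transpose[of "\<lambda>k j. Rm_lower l k j i"] by (simp add: ctr_Rm_lower')
    then show ?thesis
      by (subst ctr_swap) (simp add: ctr_mult_right ctr_minus)
  qed
  ultimately show ?thesis by (simp add: dvg_def D_ctr)
qed

text \<open>\<open>d\<^sup>* d\<^sup>* \<omega> = 0\<close> for a two-form: after antisymmetrising the two derivatives, only contractions of \<open>\<omega>\<close>
  with the symmetric Ricci tensor remain.\<close>

lemma dvg_dvg_antisym: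
  assumes "\<And>i j. \<omega> i j = - \<omega> j i"
  shows "dvg (\<lambda>i. ctr (\<lambda>j k. cov2 j \<omega> k i)) = 0"
proof -
  define Z where "Z a j k i = cov3 a (\<lambda>j k i. cov2 j \<omega> k i) j k i" for a j k i
  define K where "K = ctr (\<lambda>a i. ctr (\<lambda>j k. Z a j k i))"
  have anti: "cov2 j \<omega> k i = - cov2 j \<omega> i k" for i j k
    using assms by (rule cov2_antisym)
  have Z_anti: "Z a j k i = - Z a j i k" for a i j k
    unfolding Z_def by (rule cov3_antisym23, rule anti)
  have RLa: "ctr (\<lambda>j k. Rm_lower l k a j) = Ric a l" for l a
  proof -
    have "ctr (\<lambda>j k. Rm_lower l k a j) = ctr (\<lambda>k j. Rm_lower l k a j)" by (rule ctr_transpose)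
    also have "\<dots> = - ctr (\<lambda>k j. Rm_lower l k j a)" by (subst Rm_lower_antisym) (simp add: ctr_minus)
    finally show ?thesis by (simp add: ctr_Rm_lower')
  qed
  have RLb: "ctr (\<lambda>a i. Rm_lower l i a j) = - Ric j l" for l j
    using ctr_transpose[of "\<lambda>k j'. Rm_lower l k j' j"] by (simp add: ctr_Rm_lower')
  \<comment> \<open>Exchanging the two derivatives changes the sign of the trace \<open>K\<close>, so \<open>2 K\<close> is a trace of curvature terms.\<close>
  have "K = ctr (\<lambda>j k. ctr (\<lambda>a i. Z a j k i))"
    unfolding K_def by (rule ctr_swap)
  also have "\<dots> = ctr (\<lambda>j k. ctr (\<lambda>a i. - Z a j i k))"
    by (subst Z_anti) (rule refl)
  finally have K': "K = - ctr (\<lambda>a i. ctr (\<lambda>j k. Z j a k i))"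
    by (simp add: ctr_minus)
  have "K + K = ctr (\<lambda>a i. ctr (\<lambda>j k. Z a j k i - Z j a k i))"
    by (subst (2) K') (simp add: K_def ctr_diff)
  also have "\<dots> = ctr (\<lambda>a i. ctr (\<lambda>j k. - ctr (\<lambda>l m. Rm_lower l k a j * \<omega> m i) - ctr (\<lambda>l m. Rm_lower l i a j * \<omega> k m)))"
    unfolding Z_def ricci_identity2 sum_Rm_eq_ctr[symmetric] by simp
  also have "\<dots> = - ctr (\<lambda>a i. ctr (\<lambda>j k. ctr (\<lambda>l m. Rm_lower l k a j * \<omega> m i)))
      - ctr (\<lambda>a i. ctr (\<lambda>j k. ctr (\<lambda>l m. Rm_lower l i a j * \<omega> k m)))"
    by (simp add: ctr_diff ctr_minus)
  also have "ctr (\<lambda>a i. ctr (\<lambda>j k. ctr (\<lambda>l m. Rm_lower l k a j * \<omega> m i))) = 0"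
  proof -
    have "ctr (\<lambda>j k. ctr (\<lambda>l m. Rm_lower l k a j * \<omega> m i)) = ctr (\<lambda>l m. Ric a l * \<omega> m i)" for a i
      by (subst ctr_swap) (simp add: ctr_mult_right RLa)
    then have "ctr (\<lambda>a i. ctr (\<lambda>j k. ctr (\<lambda>l m. Rm_lower l k a j * \<omega> m i))) = inn Ric (\<lambda>i m. \<omega> m i)"
      by (simp add: inn_def)
    also have "\<dots> = 0" using assms by (intro inn_sym_antisym Ric_sym)
    finally show ?thesis .
  qed
  also have "ctr (\<lambda>a i. ctr (\<lambda>j k. ctr (\<lambda>l m. Rm_lower l i a j * \<omega> k m))) = 0"
  proof -
    have "ctr (\<lambda>a i. ctr (\<lambda>l m. Rm_lower l i a j * \<omega> k m)) = - ctr (\<lambda>l m. Ric j l * \<omega> k m)" for j k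
      by (subst ctr_swap) (simp add: ctr_mult_right RLb ctr_minus)
    then have "ctr (\<lambda>a i. ctr (\<lambda>j k. ctr (\<lambda>l m. Rm_lower l i a j * \<omega> k m))) = - inn Ric \<omega>"
      by (subst ctr_swap) (simp add: inn_def ctr_minus)
    also have "\<dots> = 0" using inn_sym_antisym[OF Ric_sym assms] by simp
    finally show ?thesis .
  qed
  finally have "K = - K" by (simp add: eq_neg_iff_add_eq_0)
  then have "K = 0" by (simp only: eq_uminus_self_iff)
  then show ?thesis
    by (simp add: dvg_def K_def Z_def cov1_ctr[of _ "\<lambda>j k i. cov2 j \<omega> k i"])
qed

lemma dvg_hodge: "dvg (hodge \<alpha>) = lap (dvg \<alpha>)"
proof -
  have "dvg (hodge \<alpha>) = lap (dvg \<alpha>) + dvg (\<lambda>i. ctr (\<lambda>j k. cov2 j (\<lambda>k i. cov1 k \<alpha> i - cov1 i \<alpha> k) k i))"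
    unfolding lap_eq_dvg dvg_add[symmetric] hodge_def[abs_def] by simp
  also have "dvg (\<lambda>i. ctr (\<lambda>j k. cov2 j (\<lambda>k i. cov1 k \<alpha> i - cov1 i \<alpha> k) k i)) = 0"
    by (rule dvg_dvg_antisym) simp
  finally show ?thesis by simp
qed

lemma D_numeral_mult: "D i (numeral n * f) = numeral n * D i f"
  by (simp add: D_simps)

lemma lap_norm1:
  "lap (ctr (\<lambda>i j. \<alpha> i * \<alpha> j)) =
     2 * ctr (\<lambda>i j. \<alpha> i * lap1 \<alpha> j) + 2 * inn (\<lambda>i j. cov1 i \<alpha> j) (\<lambda>i j. cov1 i \<alpha> j)"
proof -
  have D: "D l (ctr (\<lambda>i j. \<alpha> i * \<alpha> j)) = 2 * ctr (\<lambda>i j. \<alpha> i * cov1 l \<alpha> j)" for l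
  proof -
    have "cov2 l (\<lambda>i j. \<alpha> i * \<alpha> j) = (\<lambda>i j. cov1 l \<alpha> i * \<alpha> j + \<alpha> i * cov1 l \<alpha> j)"
      by (intro ext cov2_mult)
    then show ?thesis
      using ctr_transpose[of "\<lambda>i j. \<alpha> i * cov1 l \<alpha> j"]
      by (simp add: D_ctr ctr_add mult.commute)
  qed
  have N: "cov1 k (\<lambda>l. ctr (\<lambda>i j. \<alpha> i * cov1 l \<alpha> j)) l =
      ctr (\<lambda>i j. cov1 k \<alpha> i * cov1 l \<alpha> j) + ctr (\<lambda>i j. \<alpha> i * cov2 k (\<lambda>l j. cov1 l \<alpha> j) l j)" for k l
  proof -
    have "cov3 k (\<lambda>i j l. \<alpha> i * cov1 l \<alpha> j) i j l =
      cov1 k \<alpha> i * cov1 l \<alpha> j + \<alpha> i * cov2 k (\<lambda>l j. cov1 l \<alpha> j) l j" for i j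
      unfolding cov3_def cov1_def[of k \<alpha> i] cov2_def by (simp add: D_simps sum_simps algebra_simps)
    then show ?thesis
      using cov1_ctr[of k "\<lambda>i j l. \<alpha> i * cov1 l \<alpha> j" l] by (simp add: ctr_add)
  qed
  have "lap (ctr (\<lambda>i j. \<alpha> i * \<alpha> j)) =
     2 * ctr (\<lambda>k l. ctr (\<lambda>i j. cov1 k \<alpha> i * cov1 l \<alpha> j))
     + 2 * ctr (\<lambda>k l. ctr (\<lambda>i j. \<alpha> i * cov2 k (\<lambda>l j. cov1 l \<alpha> j) l j))"
    by (simp add: lap_def D cov1_numeral N ctr_simps distrib_left)
  also have "ctr (\<lambda>k l. ctr (\<lambda>i j. \<alpha> i * cov2 k (\<lambda>l j. cov1 l \<alpha> j) l j)) = ctr (\<lambda>i j. \<alpha> i * lap1 \<alpha> j)"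
    by (subst ctr_swap) (simp add: lap1_def ctr_mult)
  finally show ?thesis by (simp add: inn_def)
qed

text \<open>\<open>L\<^sub>X g\<close> for the vector field \<open>X\<close> dual to \<open>\<alpha>\<close>.\<close>

lemma lie_g:
  fixes \<alpha> :: "'n \<Rightarrow> 'r"
  defines "X \<equiv> \<lambda>k. \<Sum>l\<in>UNIV. G k l * \<alpha> l"
  shows "(\<Sum>k\<in>UNIV. X k * D k (g i j) + g k j * D i (X k) + g i k * D j (X k)) = cov1 i \<alpha> j + cov1 j \<alpha> i"
proof -
  have gX: "(\<Sum>k\<in>UNIV. g k m * X k) = \<alpha> m" for m
  proof -
    have "(\<Sum>k\<in>UNIV. g k m * X k) = (\<Sum>l\<in>UNIV. (\<Sum>k\<in>UNIV. g m k * G k l) * \<alpha> l)"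
      unfolding X_def
      by (simp add: sum_distrib_left sum_distrib_right, subst sum.swap, simp add: g_sym[of _ m] ac_simps)
    then show ?thesis by (simp add: g_G sum_delta_mult)
  qed
  have gDX: "(\<Sum>k\<in>UNIV. g k m * D n (X k)) = D n (\<alpha> m) - (\<Sum>k\<in>UNIV. D n (g k m) * X k)" for m n
    unfolding gX[of m, symmetric] by (simp add: D_simps sum.distrib)
  have XgG: "(\<Sum>k\<in>UNIV. X k * (\<Sum>m\<in>UNIV. \<Gamma> m i j * g m k)) = (\<Sum>m\<in>UNIV. \<Gamma> m i j * \<alpha> m)"
    unfolding gX[symmetric]
    by (simp add: sum_distrib_left, subst sum.swap, simp add: g_sym[of k m for k m] ac_simps)
  have lower: "(\<Sum>m\<in>UNIV. \<Gamma> m a b * g c m) = (\<Sum>m\<in>UNIV. \<Gamma> m a b * g m c)" for a b c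
    by (simp add: g_sym[of c])
  have "(\<Sum>k\<in>UNIV. X k * D k (g i j) + g k j * D i (X k) + g i k * D j (X k)) =
     (\<Sum>k\<in>UNIV. X k * D k (g i j)) + (\<Sum>k\<in>UNIV. g k j * D i (X k)) + (\<Sum>k\<in>UNIV. g k i * D j (X k))"
    by (simp add: sum.distrib g_sym[of i k for k])
  also have "\<dots> = D i (\<alpha> j) + D j (\<alpha> i)
      + (\<Sum>k\<in>UNIV. X k * (D k (g i j) - D i (g k j) - D j (g k i)))"
    by (simp add: gDX sum.distrib sum_subtractf algebra_simps)
  also have "(\<Sum>k\<in>UNIV. X k * (D k (g i j) - D i (g k j) - D j (g k i))) = - 2 * (\<Sum>m\<in>UNIV. \<Gamma> m i j * \<alpha> m)"
  proof -
    have "D k (g i j) - D i (g k j) - D j (g k i) = - 2 * (\<Sum>m\<in>UNIV. \<Gamma> m i j * g m k)" for k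
      unfolding D_g lower by (simp add: \<Gamma>_sym[of _ k i] \<Gamma>_sym[of _ k j] \<Gamma>_sym[of _ j i])
    then have "(\<Sum>k\<in>UNIV. X k * (D k (g i j) - D i (g k j) - D j (g k i))) =
        (\<Sum>k\<in>UNIV. - 2 * (X k * (\<Sum>m\<in>UNIV. \<Gamma> m i j * g m k)))"
      by (simp only: mult.left_commute[of "X _"])
    then show ?thesis by (simp only: sum_distrib_left[symmetric] XgG)
  qed
  finally show ?thesis by (simp add: cov1_def \<Gamma>_sym[of _ j i])
qed

subsection \<open>Tensors of rank three\<close>

text \<open>Full contraction of two tensors of rank three.\<close>

definition inn3 :: "('n \<Rightarrow> 'n \<Rightarrow> 'n \<Rightarrow> 'r) \<Rightarrow> ('n \<Rightarrow> 'n \<Rightarrow> 'n \<Rightarrow> 'r) \<Rightarrow> 'r" where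
  "inn3 P Q = ctr (\<lambda>i a. inn (P i) (Q a))"

lemma inn3_commute: "inn3 P Q = inn3 Q P"
  unfolding inn3_def by (subst ctr_transpose[symmetric]) (simp add: inn_commute[of "P _"])

lemma inn3_add_left: "inn3 (\<lambda>i j k. P i j k + P' i j k) Q = inn3 P Q + inn3 P' Q"
  and inn3_diff_left: "inn3 (\<lambda>i j k. P i j k - P' i j k) Q = inn3 P Q - inn3 P' Q"
  and inn3_minus_left: "inn3 (\<lambda>i j k. - P i j k) Q = - inn3 P Q"
  and inn3_minus_right: "inn3 Q (\<lambda>i j k. - P i j k) = - inn3 Q P"
  by (simp_all add: inn3_def inn_simps ctr_simps)

lemma inn3_swap12: "inn3 (\<lambda>i j k. P j i k) (\<lambda>i j k. Q j i k) = inn3 P Q"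
  unfolding inn3_def inn_def by (rule ctr_swap)

lemma inn3_swap23: "inn3 (\<lambda>i j k. P i k j) (\<lambda>i j k. Q i k j) = inn3 P Q"
  unfolding inn3_def by (intro arg_cong[where f = ctr] ext inn_transpose)

lemma inn_sum:
  "(\<Sum>i\<in>UNIV. \<Sum>j\<in>UNIV. \<Sum>a\<in>UNIV. \<Sum>b\<in>UNIV. G i a * G j b * S i j * T a b) = inn S T"
proof -
  have "inn S T = (\<Sum>i\<in>UNIV. \<Sum>a\<in>UNIV. \<Sum>j\<in>UNIV. \<Sum>b\<in>UNIV. G i a * G j b * S i j * T a b)"
    by (simp add: inn_def ctr_def sum_distrib_left mult.assoc)
  also have "\<dots> = (\<Sum>i\<in>UNIV. \<Sum>j\<in>UNIV. \<Sum>a\<in>UNIV. \<Sum>b\<in>UNIV. G i a * G j b * S i j * T a b)"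
    by (intro sum.cong refl sum.swap)
  finally show ?thesis ..
qed

lemma inn3_sum:
  "(\<Sum>i\<in>UNIV. \<Sum>j\<in>UNIV. \<Sum>k\<in>UNIV. \<Sum>a\<in>UNIV. \<Sum>b\<in>UNIV. \<Sum>d\<in>UNIV.
     G i a * G j b * G k d * S i j k * T a b d) = inn3 S T"
proof -
  have "inn3 S T = (\<Sum>i\<in>UNIV. \<Sum>a\<in>UNIV. \<Sum>j\<in>UNIV. \<Sum>k\<in>UNIV. \<Sum>b\<in>UNIV. \<Sum>d\<in>UNIV.
     G i a * G j b * G k d * S i j k * T a b d)"
    by (simp add: inn3_def inn_sum[symmetric] ctr_def sum_distrib_left mult.assoc)
  also have "\<dots> = (\<Sum>i\<in>UNIV. \<Sum>j\<in>UNIV. \<Sum>k\<in>UNIV. \<Sum>a\<in>UNIV. \<Sum>b\<in>UNIV. \<Sum>d\<in>UNIV.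
     G i a * G j b * G k d * S i j k * T a b d)"
    by (intro sum.cong refl sum_rotate3)
  finally show ?thesis ..
qed

end

section \<open>Variation formulas\<close>

text \<open>The derivation \<open>\<delta>\<close> plays the role of \<open>\<partial>/\<partial>t\<close>.\<close>

locale evolving_calculus = covariant_calculus D g G \<Gamma>
  for D :: "'n::finite \<Rightarrow> 'r::{comm_ring_1, real_algebra_1} \<Rightarrow> 'r" and g G \<Gamma> +
  fixes \<delta> :: "'r \<Rightarrow> 'r"
  assumes derivation_\<delta>: "derivation \<delta>"
    and \<delta>_D: "\<delta> (D i a) = D i (\<delta> a)"
begin

lemmas \<delta>_add = derivation.add[OF derivation_\<delta>]
  and \<delta>_mult = derivation.mult[OF derivation_\<delta>]
  and \<delta>_scaleR = derivation.scaleR[OF derivation_\<delta>]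
  and \<delta>_zero = derivation.zero[OF derivation_\<delta>]
  and \<delta>_one = derivation.one[OF derivation_\<delta>]
  and \<delta>_minus = derivation.minus[OF derivation_\<delta>]
  and \<delta>_diff = derivation.diff[OF derivation_\<delta>]
  and \<delta>_sum = derivation.sum[OF derivation_\<delta>]
  and \<delta>_numeral = derivation.numeral[OF derivation_\<delta>]

lemmas \<delta>_simps = \<delta>_add \<delta>_mult \<delta>_scaleR \<delta>_zero \<delta>_one \<delta>_minus \<delta>_diff \<delta>_sum \<delta>_numeral

definition h :: "'n \<Rightarrow> 'n \<Rightarrow> 'r" where "h i j = \<delta> (g i j)"

lemma \<delta>_G: "\<delta> (G i j) = - (\<Sum>a\<in>UNIV. \<Sum>b\<in>UNIV. G i a * h a b * G b j)"
proof -
  have Gg: "(\<Sum>k\<in>UNIV. \<delta> (G i k) * g k l) = - (\<Sum>k\<in>UNIV. G i k * h k l)" for l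
  proof -
    have "0 = \<delta> (\<Sum>k\<in>UNIV. G i k * g k l)"
      by (simp add: G_g \<delta>_simps)
    then show ?thesis
      by (simp add: \<delta>_sum \<delta>_mult sum.distrib h_def eq_neg_iff_add_eq_0)
  qed
  have "\<delta> (G i j) = (\<Sum>k\<in>UNIV. \<delta> (G i k) * (\<Sum>l\<in>UNIV. g k l * G l j))"
    by (simp add: g_G sum_delta_mult)
  also have "\<dots> = (\<Sum>l\<in>UNIV. (\<Sum>k\<in>UNIV. \<delta> (G i k) * g k l) * G l j)"
    by (simp add: sum_distrib_left sum_distrib_right mult.assoc) (rule sum.swap)
  also have "\<dots> = - (\<Sum>l\<in>UNIV. \<Sum>k\<in>UNIV. G i k * h k l * G l j)"
    by (simp add: Gg sum_distrib_right sum_negf)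
  finally show ?thesis by (subst sum.swap)
qed

lemma \<delta>_ctr: "\<delta> (ctr T) = ctr (\<lambda>a b. \<delta> (T a b)) - inn h T"
proof -
  have "\<delta> (ctr T) = ctr (\<lambda>a b. \<delta> (T a b)) + (\<Sum>i\<in>UNIV. \<Sum>j\<in>UNIV. \<delta> (G i j) * T i j)"
    by (simp add: ctr_def \<delta>_simps sum.distrib add.commute)
  also have "(\<Sum>i\<in>UNIV. \<Sum>j\<in>UNIV. \<delta> (G i j) * T i j) =
      - (\<Sum>i\<in>UNIV. \<Sum>j\<in>UNIV. \<Sum>a\<in>UNIV. \<Sum>b\<in>UNIV. G i a * (G b j * (h a b * T i j)))"
    by (simp add: \<delta>_G sum_distrib_left sum_distrib_right sum_negf ac_simps)
  also have "(\<Sum>i\<in>UNIV. \<Sum>j\<in>UNIV. \<Sum>a\<in>UNIV. \<Sum>b\<in>UNIV. G i a * (G b j * (h a b * T i j))) =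
      (\<Sum>i\<in>UNIV. \<Sum>a\<in>UNIV. \<Sum>j\<in>UNIV. \<Sum>b\<in>UNIV. G i a * (G b j * (h a b * T i j)))"
    by (intro sum.cong refl sum.swap)
  also have "\<dots> = (\<Sum>i\<in>UNIV. \<Sum>a\<in>UNIV. \<Sum>b\<in>UNIV. \<Sum>j\<in>UNIV. G i a * (G b j * (h a b * T i j)))"
    by (intro sum.cong refl sum.swap)
  also have "\<dots> = ctr (\<lambda>i a. ctr (\<lambda>b j. h a b * T i j))"
    by (simp add: ctr_def sum_distrib_left)
  also have "\<dots> = inn h T"
    unfolding inn_def by (rule ctr_transpose)
  finally show ?thesis by simp
qed

text \<open>The variation of the connection, a tensor \<open>A\<^sup>l\<^sub>j\<^sub>k\<close>; in \<open>AL\<close> the index \<open>l\<close> is lowered.\<close>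

definition A :: "'n \<Rightarrow> 'n \<Rightarrow> 'n \<Rightarrow> 'r" where "A l j k = \<delta> (\<Gamma> l j k)"

definition AL :: "'n \<Rightarrow> 'n \<Rightarrow> 'n \<Rightarrow> 'r" where "AL l j k = (\<Sum>m\<in>UNIV. g l m * A m j k)"

lemma A_sym: "A l j k = A l k j"
  by (simp add: A_def \<Gamma>_sym[of l j])

lemma AL_sym: "AL l j k = AL l k j"
  by (simp add: AL_def A_sym[of _ j])

lemma cov2_h: "cov2 k h i j = AL j k i + AL i k j"
proof -
  have "D k (h i j) = (\<Sum>m\<in>UNIV. A m k i * g m j + \<Gamma> m k i * h m j)
      + (\<Sum>m\<in>UNIV. A m k j * g i m + \<Gamma> m k j * h i m)"
    by (simp add: h_def \<delta>_D[symmetric] D_g \<delta>_simps A_def)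
  then show ?thesis
    by (simp add: cov2_def AL_def sum.distrib g_sym[of j] mult.commute)
qed

lemma two_AL: "2 * AL l j k = cov2 j h k l + cov2 k h j l - cov2 l h j k"
  by (simp add: cov2_h AL_sym[of j] AL_sym[of k] AL_sym[of l k])

lemma \<delta>_cov1: "\<delta> (cov1 i \<alpha> j) = cov1 i (\<lambda>j. \<delta> (\<alpha> j)) j - (\<Sum>m\<in>UNIV. A m i j * \<alpha> m)"
  by (simp add: cov1_def \<delta>_simps \<delta>_D A_def sum.distrib)

text \<open>The trace of the variation of the connection, which enters the variation of the divergence of a
  one-form.\<close>

definition V :: "'n \<Rightarrow> 'r" where "V a = ctr (\<lambda>j k. AL a j k)"

lemma two_V: "2 * V a = 2 * dvg2 h a - D a (ctr h)"
proof -
  have "2 * V a = ctr (\<lambda>j k. 2 * AL a j k)"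
    by (simp add: V_def ctr_mult)
  also have "\<dots> = ctr (\<lambda>j k. cov2 j h k a) + ctr (\<lambda>j k. cov2 k h j a) - ctr (\<lambda>j k. cov2 a h j k)"
    by (simp add: two_AL ctr_simps)
  also have "ctr (\<lambda>j k. cov2 k h j a) = ctr (\<lambda>j k. cov2 j h k a)"
    by (rule ctr_transpose)
  also have "ctr (\<lambda>j k. cov2 j h k a) = dvg2 h a"
    unfolding dvg2_def by (intro arg_cong[where f = ctr] ext) (simp add: cov2_h add.commute)
  finally show ?thesis by (simp add: D_ctr)
qed

lemma \<delta>_dvg:
  "\<delta> (dvg \<alpha>) = dvg (\<lambda>j. \<delta> (\<alpha> j)) - ctr (\<lambda>m n. \<alpha> m * V n) - inn h (\<lambda>i j. cov1 i \<alpha> j)"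
proof -
  have V: "V n = (\<Sum>p\<in>UNIV. g n p * ctr (A p))" for n
    by (simp add: V_def AL_def ctr_sum ctr_mult)
  have "ctr (\<lambda>i j. \<Sum>m\<in>UNIV. A m i j * \<alpha> m) = (\<Sum>m\<in>UNIV. ctr (A m) * \<alpha> m)"
    by (simp add: ctr_sum ctr_mult_right)
  also have "\<dots> = ctr (\<lambda>a b. \<Sum>l\<in>UNIV. g a l * (ctr (A l) * \<alpha> b))"
    by (rule ctr_lower[symmetric])
  also have "\<dots> = ctr (\<lambda>n m. \<alpha> m * V n)"
    by (simp add: V sum_distrib_left ac_simps)
  also have "\<dots> = ctr (\<lambda>m n. \<alpha> m * V n)" by (rule ctr_transpose)
  finally show ?thesis by (simp add: dvg_def \<delta>_ctr \<delta>_cov1 ctr_diff)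
qed

text \<open>The covariant derivative of \<open>A\<close>. By the Palatini identity \<open>\<delta>_Rm\<close> its antisymmetrisation is the
  variation of the curvature.\<close>

definition A_nabla :: "'n \<Rightarrow> 'n \<Rightarrow> 'n \<Rightarrow> 'n \<Rightarrow> 'r" where
  "A_nabla i l j k = D i (A l j k) + (\<Sum>p\<in>UNIV. \<Gamma> l i p * A p j k)
     - (\<Sum>p\<in>UNIV. \<Gamma> p i j * A l p k) - (\<Sum>p\<in>UNIV. \<Gamma> p i k * A l j p)"

lemma \<delta>_Rm: "\<delta> (Rm l k i j) = A_nabla i l j k - A_nabla j l i k"
proof -
  have "\<delta> (Rm l k i j) = D i (A l j k) - D j (A l i k)
     + (\<Sum>m\<in>UNIV. A l i m * \<Gamma> m j k) + (\<Sum>m\<in>UNIV. \<Gamma> l i m * A m j k)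
     - (\<Sum>m\<in>UNIV. A l j m * \<Gamma> m i k) - (\<Sum>m\<in>UNIV. \<Gamma> l j m * A m i k)"
    by (simp add: Rm_def \<delta>_simps \<delta>_D A_def sum.distrib sum_subtractf)
  then show ?thesis
    by (simp add: A_nabla_def \<Gamma>_sym[of _ j i] mult.commute)
qed

lemma cov3_AL: "cov3 i AL a j k = (\<Sum>l\<in>UNIV. g a l * A_nabla i l j k)"
proof -
  have "(\<Sum>p\<in>UNIV. c p * (\<Sum>q\<in>UNIV. g a q * X q p)) = (\<Sum>q\<in>UNIV. g a q * (\<Sum>p\<in>UNIV. c p * X q p))"
    for c and X :: "'n \<Rightarrow> 'n \<Rightarrow> 'r"
    by (simp add: sum_distrib_left mult.left_commute) (rule sum.swap)
  then show ?thesis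
    by (simp add: cov3_def AL_def D_lower A_nabla_def sum.distrib sum_subtractf distrib_left right_diff_distrib)
qed

lemma \<delta>_Ric: "\<delta> (Ric j k) = ctr (\<lambda>a i. cov3 i AL a j k) - ctr (\<lambda>a i. cov3 j AL a i k)"
  by (simp add: Ric_def \<delta>_sum \<delta>_Rm cov3_AL ctr_lower sum_subtractf)

lemma \<delta>_Scal: "\<delta> Scal = dvg (dvg2 h) - lap (ctr h) - inn h Ric"
proof -
  \<comment> \<open>The other trace of \<open>AL\<close>, which is half the differential of \<open>tr h\<close>.\<close>
  define W where "W k = ctr (\<lambda>a i. AL a i k)" for k
  have W: "2 * W k = D k (ctr h)" for k
  proof -
    have "2 * W k = ctr (\<lambda>a i. 2 * AL a i k)"
      by (simp add: W_def ctr_mult)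
    also have "\<dots> = ctr (\<lambda>a i. cov2 i h k a) + ctr (\<lambda>a i. cov2 k h i a) - ctr (\<lambda>a i. cov2 a h i k)"
      by (simp add: two_AL ctr_simps)
    also have "ctr (\<lambda>a i. cov2 a h i k) = ctr (\<lambda>a i. cov2 i h k a)"
      by (subst ctr_transpose[symmetric], intro arg_cong[where f = ctr] ext) (simp add: cov2_h add.commute)
    also have "ctr (\<lambda>a i. cov2 k h i a) = D k (ctr h)"
      by (simp add: D_ctr ctr_transpose[of "cov2 k h"])
    finally show ?thesis by simp
  qed
  have 1: "ctr (\<lambda>j k. ctr (\<lambda>a i. cov3 i AL a j k)) = dvg V"
  proof -
    have "cov1 i V a = ctr (\<lambda>j k. cov3 i AL a j k)" for i a
    proof -
      have "cov3 i (\<lambda>j k a. AL a j k) j k a = cov3 i AL a j k" for j k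
        by (simp add: cov3_def algebra_simps)
      then show ?thesis
        using cov1_ctr[of i "\<lambda>j k a. AL a j k" a] by (simp add: V_def[abs_def])
    qed
    then show ?thesis
      unfolding dvg_def by (subst ctr_transpose[symmetric]) (simp add: ctr_swap[of "\<lambda>j k a i. cov3 i AL a j k"])
  qed
  have 2: "ctr (\<lambda>j k. ctr (\<lambda>a i. cov3 j AL a i k)) = dvg W"
    by (simp add: dvg_def W_def[abs_def] cov1_ctr)
  have "\<delta> Scal = dvg V - dvg W - inn h Ric"
    by (simp add: Scal_def \<delta>_ctr \<delta>_Ric ctr_diff 1 2)
  then have "2 * \<delta> Scal = dvg (\<lambda>a. 2 * V a) - dvg (\<lambda>a. 2 * W a) - 2 * inn h Ric"
    by (simp add: dvg_numeral right_diff_distrib)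
  also have "\<dots> = 2 * (dvg (dvg2 h) - lap (ctr h) - inn h Ric)"
    by (simp add: two_V W dvg_diff dvg_numeral lap_eq_dvg right_diff_distrib)
  finally show ?thesis by (simp only: numeral_mult_eq_iff)
qed

lemma \<delta>_inn:
  "\<delta> (inn P Q) = inn (\<lambda>a b. \<delta> (P a b)) Q + inn P (\<lambda>a b. \<delta> (Q a b))
     - inn h (\<lambda>a b. ctr (\<lambda>c d. P a c * Q b d)) - inn h (\<lambda>c d. ctr (\<lambda>a b. P a c * Q b d))"
proof -
  have "\<delta> (inn P Q) = ctr (\<lambda>a b. ctr (\<lambda>c d. \<delta> (P a c) * Q b d) + ctr (\<lambda>c d. P a c * \<delta> (Q b d))
      - inn h (\<lambda>c d. P a c * Q b d)) - inn h (\<lambda>a b. ctr (\<lambda>c d. P a c * Q b d))"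
    unfolding inn_def[of P Q] by (simp add: \<delta>_ctr \<delta>_mult ctr_add)
  also have "\<dots> = inn (\<lambda>a b. \<delta> (P a b)) Q + inn P (\<lambda>a b. \<delta> (Q a b))
      - ctr (\<lambda>a b. inn h (\<lambda>c d. P a c * Q b d)) - inn h (\<lambda>a b. ctr (\<lambda>c d. P a c * Q b d))"
    by (simp add: ctr_add ctr_diff inn_def[of _ Q] inn_def[of P])
  finally show ?thesis by (simp add: ctr_inn algebra_simps)
qed

end

section \<open>Closed three-forms and the flow equations\<close>

text \<open>A closed three-form \<open>H\<close>: antisymmetry in neighbouring indices suffices.\<close>

locale three_form_calculus = covariant_calculus D g G \<Gamma>
  for D :: "'n::finite \<Rightarrow> 'r::{comm_ring_1, real_algebra_1} \<Rightarrow> 'r" and g G \<Gamma> +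
  fixes H :: "'n \<Rightarrow> 'n \<Rightarrow> 'n \<Rightarrow> 'r"
  assumes H12: "H i j k = - H j i k"
    and H23: "H i j k = - H i k j"
    and H_closed: "D i (H j k l) - D j (H i k l) + D k (H i j l) - D l (H i j k) = 0"
begin

text \<open>The tensor \<open>H\<^sup>2\<close>, its trace \<open>|H|\<^sup>2\<close>, the two-form \<open>\<beta> = d\<^sup>* H\<close> and the one-form
  \<open>P\<^sub>i = \<langle>H\<^sub>i, \<beta>\<rangle>\<close>.\<close>

definition Hs :: "'n \<Rightarrow> 'n \<Rightarrow> 'r" where "Hs i j = inn (H i) (H j)"

definition nH :: 'r where "nH = ctr Hs"

definition \<beta> :: "'n \<Rightarrow> 'n \<Rightarrow> 'r" where "\<beta> k l = - ctr (\<lambda>i j. cov3 i H j k l)"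

definition P :: "'n \<Rightarrow> 'r" where "P i = inn (H i) \<beta>"

lemma Hs_sym: "Hs i j = Hs j i"
  unfolding Hs_def by (rule inn_commute)

lemma \<beta>_antisym: "\<beta> k l = - \<beta> l k"
proof -
  have "ctr (\<lambda>i j. cov3 i H j k l) = ctr (\<lambda>i j. - cov3 i H j l k)"
    by (intro arg_cong[where f = ctr] ext cov3_antisym23 H23)
  then show ?thesis by (simp add: \<beta>_def ctr_minus)
qed

text \<open>\<open>dH = 0\<close> with covariant instead of coordinate derivatives.\<close>

lemma closed_nabla: "cov3 i H j k l = cov3 j H i k l - cov3 k H i j l + cov3 l H i j k"
proof -
  have a: "(\<Sum>m\<in>UNIV. \<Gamma> m a b * H c m d) = - (\<Sum>m\<in>UNIV. \<Gamma> m a b * H m c d)" for a b c d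
    by (subst H12) (simp add: sum_negf)
  have b: "(\<Sum>m\<in>UNIV. \<Gamma> m a b * H c d m) = (\<Sum>m\<in>UNIV. \<Gamma> m a b * H m c d)" for a b c d
    by (subst H23, subst H12) (simp add: sum_negf)
  have D: "D i (H j k l) = D j (H i k l) - D k (H i j l) + D l (H i j k)"
    using H_closed[of i j k l] by (simp add: algebra_simps eq_diff_eq add_eq_0_iff)
  show ?thesis
    unfolding cov3_def a b D
    by (simp add: \<Gamma>_sym[of _ j i] \<Gamma>_sym[of _ k i] \<Gamma>_sym[of _ l i] \<Gamma>_sym[of _ k j] \<Gamma>_sym[of _ l j] \<Gamma>_sym[of _ l k])
qed

text \<open>Against the antisymmetric \<open>H\<close>, the three terms of an exterior derivative contribute equally.\<close>

lemma inn3_cyclic_H: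
  "inn3 (\<lambda>j k l. F j k l - F k j l + F l j k) H = 3 * inn3 F H"
proof -
  have 1: "inn3 (\<lambda>j k l. Q k j l) H = - inn3 Q H" for Q
  proof -
    have "inn3 (\<lambda>j k l. Q k j l) H = inn3 Q (\<lambda>j k l. H k j l)"
      using inn3_swap12[of Q "\<lambda>j k l. H k j l"] by simp
    also have "\<dots> = inn3 Q (\<lambda>j k l. - H j k l)" by (intro arg_cong[where f = "inn3 Q"] ext H12)
    finally show ?thesis by (simp add: inn3_minus_right)
  qed
  have 2: "inn3 (\<lambda>j k l. Q j l k) H = - inn3 Q H" for Q
  proof -
    have "inn3 (\<lambda>j k l. Q j l k) H = inn3 Q (\<lambda>j k l. H j l k)"
      using inn3_swap23[of Q "\<lambda>j k l. H j l k"] by simp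
    also have "\<dots> = inn3 Q (\<lambda>j k l. - H j k l)" by (intro arg_cong[where f = "inn3 Q"] ext H23)
    finally show ?thesis by (simp add: inn3_minus_right)
  qed
  have "inn3 (\<lambda>j k l. F l j k) H = inn3 F H"
    using 2[of "\<lambda>j k l. F k j l"] 1[of F] by simp
  then show ?thesis by (simp add: inn3_add_left inn3_diff_left 1[of F])
qed

lemma D_nH: "D i nH = 6 * inn3 (\<lambda>j k l. cov3 j H i k l) H"
proof -
  have "cov2 i Hs = (\<lambda>j k. inn (cov3 i H j) (H k) + inn (H j) (cov3 i H k))"
    by (intro ext) (simp add: Hs_def[abs_def] cov2_inn)
  then have "D i nH = ctr (\<lambda>j k. inn (cov3 i H j) (H k)) + ctr (\<lambda>j k. inn (H j) (cov3 i H k))"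
    by (simp add: nH_def D_ctr ctr_add)
  also have "\<dots> = 2 * inn3 (cov3 i H) H"
    using inn3_commute[of H "cov3 i H"] by (simp add: inn3_def)
  also have "cov3 i H = (\<lambda>j k l. cov3 j H i k l - cov3 k H i j l + cov3 l H i j k)"
    by (intro ext closed_nabla)
  also have "inn3 \<dots> H = 3 * inn3 (\<lambda>j k l. cov3 j H i k l) H"
    by (rule inn3_cyclic_H)
  finally show ?thesis by simp
qed

lemma dvg2_Hs: "6 * dvg2 Hs i = D i nH - 6 * P i"
proof -
  have "cov2 j Hs i a = inn (cov3 j H i) (H a) + inn (H i) (cov3 j H a)" for j a
    by (simp add: Hs_def[abs_def] cov2_inn)
  then have "dvg2 Hs i = inn3 (\<lambda>j k l. cov3 j H i k l) H + ctr (\<lambda>j a. inn (H i) (cov3 j H a))"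
    by (simp add: dvg2_def ctr_add inn3_def)
  also have "ctr (\<lambda>j a. inn (H i) (cov3 j H a)) = - P i"
    by (simp add: ctr_inn P_def \<beta>_def[abs_def] inn_minus_right)
  finally show ?thesis by (simp add: D_nH)
qed

lemma dvg_P: "dvg P = inn3 (\<lambda>i k l. cov2 i \<beta> k l) H - inn \<beta> \<beta>"
proof -
  have "cov1 i P j = inn (cov3 i H j) \<beta> + inn (H j) (cov2 i \<beta>)" for i j
    by (simp add: P_def[abs_def] cov1_inn)
  then have "dvg P = ctr (\<lambda>i j. inn (cov3 i H j) \<beta>) + ctr (\<lambda>i j. inn (H j) (cov2 i \<beta>))"
    by (simp add: dvg_def ctr_add)
  also have "ctr (\<lambda>i j. inn (cov3 i H j) \<beta>) = - inn \<beta> \<beta>"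
  proof -
    have "(\<lambda>a b. ctr (\<lambda>i j. cov3 i H j a b)) = (\<lambda>a b. - \<beta> a b)"
      by (simp add: \<beta>_def)
    then show ?thesis
      by (simp add: inn_commute[of "cov3 _ _ _" \<beta>] ctr_inn inn_minus_right)
  qed
  also have "ctr (\<lambda>i j. inn (H j) (cov2 i \<beta>)) = inn3 (\<lambda>i k l. cov2 i \<beta> k l) H"
    by (simp add: inn3_def inn_commute[of "H _"])
  finally show ?thesis by simp
qed

end

text \<open>The equations of generalized Ricci flow and of the one-form dilaton flow, multiplied by integers
  where this clears denominators.\<close>

locale flow_calculus = evolving_calculus D g G \<Gamma> \<delta> + three_form_calculus D g G \<Gamma> H
  for D :: "'n::finite \<Rightarrow> 'r::{comm_ring_1, real_algebra_1} \<Rightarrow> 'r" and g G \<Gamma> \<delta> H +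
  fixes \<alpha> :: "'n \<Rightarrow> 'r"
  assumes flow_g: "2 * \<delta> (g i j) = Hs i j - 4 * Ric i j"
    and flow_H: "\<delta> (H i j k) = - (D i (\<beta> j k) - D j (\<beta> i k) + D k (\<beta> i j))"
    and flow_\<alpha>: "6 * \<delta> (\<alpha> i) = 6 * hodge \<alpha> i + D i nH"
begin

lemma two_h: "2 * h i j = Hs i j - 4 * Ric i j"
  by (simp add: h_def flow_g)

lemma inn_two_h: "2 * inn h T = inn Hs T - 4 * inn Ric T"
proof -
  have "2 * inn h T = inn (\<lambda>i j. 2 * h i j) T" by (simp add: inn_simps)
  then show ?thesis by (simp add: two_h inn_simps)
qed

lemma two_ctr_h: "2 * ctr h = nH - 4 * Scal"
proof -
  have "2 * ctr h = ctr (\<lambda>i j. 2 * h i j)" by (simp add: ctr_simps)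
  then show ?thesis by (simp add: two_h ctr_simps nH_def Scal_def)
qed

lemma dvg2_h: "12 * dvg2 h i = D i nH - 6 * P i - 12 * D i Scal"
proof -
  have "2 * dvg2 h i = ctr (\<lambda>j k. cov2 j (\<lambda>i k. 2 * h i k) i k)"
    by (simp add: dvg2_def cov2_numeral ctr_mult)
  also have "\<dots> = dvg2 Hs i - 2 * D i Scal"
    by (simp add: two_h cov2_diff cov2_numeral ctr_simps dvg2_def D_Scal)
  finally have "2 * dvg2 h i = dvg2 Hs i - 2 * D i Scal" .
  then have "6 * (2 * dvg2 h i) = 6 * dvg2 Hs i - 12 * D i Scal"
    by (simp add: right_diff_distrib)
  then show ?thesis by (simp add: dvg2_Hs)
qed

lemma evolution_Scal:
  "12 * (\<delta> Scal - lap Scal) = - 5 * lap nH - 6 * dvg P + 24 * inn Ric Ric - 6 * inn Hs Ric"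
proof -
  have 1: "12 * dvg (dvg2 h) = lap nH - 6 * dvg P - 12 * lap Scal"
    unfolding lap_eq_dvg dvg_numeral[symmetric] dvg_diff[symmetric] dvg2_h[symmetric] ..
  have 2: "2 * lap (ctr h) = lap nH - 4 * lap Scal"
    unfolding lap_numeral[symmetric] lap_diff[symmetric] two_ctr_h ..
  have "12 * \<delta> Scal = 12 * dvg (dvg2 h) - 6 * (2 * lap (ctr h)) - 6 * (2 * inn h Ric)"
    by (simp add: \<delta>_Scal right_diff_distrib)
  then show ?thesis unfolding 1 2 inn_two_h by (simp add: algebra_simps)
qed

lemma \<delta>_nH: "\<delta> nH = - 6 * (dvg P + inn \<beta> \<beta>) - 3 * inn h Hs"
proof -
  have 1: "(\<lambda>j k. \<delta> (H i j k)) = (\<lambda>j k. - (cov2 i \<beta> j k - cov2 j \<beta> i k + cov2 k \<beta> i j))" for i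
  proof (intro ext)
    fix j k
    have "(\<Sum>m\<in>UNIV. \<Gamma> m a b * \<beta> m c) = - (\<Sum>m\<in>UNIV. \<Gamma> m a b * \<beta> c m)" for a b c
      by (subst \<beta>_antisym) (simp add: sum_negf)
    then show "\<delta> (H i j k) = - (cov2 i \<beta> j k - cov2 j \<beta> i k + cov2 k \<beta> i j)"
      by (simp add: flow_H cov2_def \<Gamma>_sym[of _ j i] \<Gamma>_sym[of _ k i] \<Gamma>_sym[of _ k j])
  qed
  have dH: "inn3 (\<lambda>i j k. \<delta> (H i j k)) H = - 3 * (dvg P + inn \<beta> \<beta>)"
  proof -
    have "inn3 (\<lambda>i j k. \<delta> (H i j k)) H = - inn3 (\<lambda>i j k. cov2 i \<beta> j k - cov2 j \<beta> i k + cov2 k \<beta> i j) H"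
      unfolding 1 by (rule inn3_minus_left)
    then show ?thesis using inn3_cyclic_H[of "\<lambda>i j k. cov2 i \<beta> j k"] by (simp add: dvg_P)
  qed
  have s: "(\<lambda>a b. ctr (\<lambda>i j. ctr (\<lambda>c d. H i a c * H j b d))) = Hs"
  proof (intro ext)
    fix a b
    have "H i a c * H j b d = H a i c * H b j d" for i j c d
      using H12[of i a c] H12[of j b d] by simp
    then show "ctr (\<lambda>i j. ctr (\<lambda>c d. H i a c * H j b d)) = Hs a b"
      by (simp add: Hs_def inn_def)
  qed
  have s': "(\<lambda>c d. ctr (\<lambda>i j. ctr (\<lambda>a b. H i a c * H j b d))) = Hs"
  proof (intro ext)
    fix c d
    have "H i a c * H j b d = H c i a * H d j b" for i j a b
      using H12[of i c a] H12[of j d b] H23[of i a c] H23[of j b d] by simp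
    then show "ctr (\<lambda>i j. ctr (\<lambda>a b. H i a c * H j b d)) = Hs c d"
      by (simp add: Hs_def inn_def)
  qed
  have "\<delta> nH = ctr (\<lambda>i j. inn (\<lambda>a b. \<delta> (H i a b)) (H j) + inn (H i) (\<lambda>a b. \<delta> (H j a b))
     - inn h (\<lambda>a b. ctr (\<lambda>c d. H i a c * H j b d)) - inn h (\<lambda>c d. ctr (\<lambda>a b. H i a c * H j b d)))
     - inn h Hs"
    by (simp add: nH_def \<delta>_ctr Hs_def[abs_def] \<delta>_inn)
  also have "\<dots> = inn3 (\<lambda>i j k. \<delta> (H i j k)) H + inn3 H (\<lambda>i j k. \<delta> (H i j k)) - 3 * inn h Hs"
    by (simp add: ctr_add ctr_diff ctr_inn s s' inn3_def)
  finally show ?thesis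
    by (simp add: inn3_commute[of H] dH)
qed

lemma evolution_nH:
  "2 * \<delta> nH = - 12 * (dvg P + inn \<beta> \<beta>) + 12 * inn Hs Ric - 3 * inn Hs Hs"
proof -
  have "2 * \<delta> nH = - 12 * (dvg P + inn \<beta> \<beta>) - 3 * (2 * inn h Hs)"
    by (simp add: \<delta>_nH algebra_simps)
  then show ?thesis by (simp add: inn_two_h inn_commute[of Ric Hs] algebra_simps)
qed

lemma evolution_dvg:
  "6 * (\<delta> (dvg \<alpha>) - lap (dvg \<alpha>)) = lap nH + 12 * inn Ric (\<lambda>i j. cov1 i \<alpha> j) - 3 * inn Hs (\<lambda>i j. cov1 i \<alpha> j)
     + ctr (\<lambda>m n. \<alpha> m * D n nH) + 3 * ctr (\<lambda>m n. \<alpha> m * P n)"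
proof -
  have "12 * (2 * V n) = - 2 * (2 * D n nH + 6 * P n)" for n
  proof -
    have "12 * (2 * V n) = 2 * (12 * dvg2 h n) - 6 * (2 * D n (ctr h))"
      by (simp add: two_V right_diff_distrib)
    also have "2 * D n (ctr h) = D n nH - 4 * D n Scal"
      unfolding D_numeral_mult[symmetric] D_diff[symmetric] two_ctr_h ..
    finally show ?thesis by (simp add: dvg2_h algebra_simps)
  qed
  then have "4 * (6 * V n) = 4 * (- D n nH - 3 * P n)" for n
    by (simp add: algebra_simps)
  then have V: "6 * V n = - D n nH - 3 * P n" for n
    by (simp only: numeral_mult_eq_iff)
  have d: "6 * dvg (\<lambda>j. \<delta> (\<alpha> j)) = 6 * lap (dvg \<alpha>) + lap nH"
    unfolding dvg_hodge[symmetric] lap_eq_dvg[of nH] dvg_numeral[symmetric] dvg_add[symmetric] flow_\<alpha> ..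
  have "6 * ctr (\<lambda>m n. \<alpha> m * V n) = ctr (\<lambda>m n. \<alpha> m * (6 * V n))"
    by (simp add: ctr_mult[symmetric] mult.left_commute)
  also have "\<dots> = - ctr (\<lambda>m n. \<alpha> m * D n nH) - 3 * ctr (\<lambda>m n. \<alpha> m * P n)"
    by (simp add: V ctr_diff ctr_minus ctr_mult[symmetric] right_diff_distrib mult.left_commute)
  finally have v: "6 * ctr (\<lambda>m n. \<alpha> m * V n) = - ctr (\<lambda>m n. \<alpha> m * D n nH) - 3 * ctr (\<lambda>m n. \<alpha> m * P n)" .
  have "6 * \<delta> (dvg \<alpha>) = 6 * dvg (\<lambda>j. \<delta> (\<alpha> j)) - 6 * ctr (\<lambda>m n. \<alpha> m * V n)
      - 3 * (2 * inn h (\<lambda>i j. cov1 i \<alpha> j))"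
    by (simp add: \<delta>_dvg right_diff_distrib)
  then show ?thesis unfolding d v inn_two_h by (simp add: algebra_simps)
qed

text \<open>The squared norm of \<open>\<alpha>\<close>.\<close>

definition n\<alpha> :: 'r where "n\<alpha> = ctr (\<lambda>i j. \<alpha> i * \<alpha> j)"

lemma inn_\<alpha>_\<alpha>: "inn T (\<lambda>i j. \<alpha> i * \<alpha> j) = ctr (\<lambda>i a. ctr (\<lambda>j b. T i j * (\<alpha> a * \<alpha> b)))"
  by (simp add: inn_def)

lemma evolution_n\<alpha>:
  "6 * (\<delta> n\<alpha> - lap n\<alpha>) = 2 * ctr (\<lambda>m n. \<alpha> m * D n nH) - 3 * inn Hs (\<lambda>i j. \<alpha> i * \<alpha> j)
     - 12 * inn (\<lambda>i j. cov1 i \<alpha> j) (\<lambda>i j. cov1 i \<alpha> j)"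
proof -
  have "\<delta> n\<alpha> = 2 * ctr (\<lambda>i j. \<alpha> i * \<delta> (\<alpha> j)) - inn h (\<lambda>i j. \<alpha> i * \<alpha> j)"
    using ctr_transpose[of "\<lambda>i j. \<alpha> i * \<delta> (\<alpha> j)"]
    by (simp add: n\<alpha>_def \<delta>_ctr \<delta>_mult ctr_add mult.commute)
  then have 1: "6 * \<delta> n\<alpha> = 2 * (6 * ctr (\<lambda>i j. \<alpha> i * \<delta> (\<alpha> j))) - 3 * (2 * inn h (\<lambda>i j. \<alpha> i * \<alpha> j))"
    by (simp add: right_diff_distrib)
  have R: "ctr (\<lambda>i j. \<alpha> i * ctr (\<lambda>l m. Ric j l * \<alpha> m)) = inn Ric (\<lambda>i j. \<alpha> i * \<alpha> j)"
    unfolding inn_def by (subst ctr_transpose[symmetric]) (simp add: ctr_mult[symmetric] ac_simps)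
  have "6 * ctr (\<lambda>i j. \<alpha> i * \<delta> (\<alpha> j)) = ctr (\<lambda>i j. \<alpha> i * (6 * \<delta> (\<alpha> j)))"
    by (simp add: ctr_mult[symmetric] mult.left_commute)
  also have "\<dots> = 6 * ctr (\<lambda>i j. \<alpha> i * hodge \<alpha> j) + ctr (\<lambda>m n. \<alpha> m * D n nH)"
    by (simp add: flow_\<alpha> distrib_left ctr_add ctr_mult[symmetric] mult.left_commute)
  also have "ctr (\<lambda>i j. \<alpha> i * hodge \<alpha> j) = ctr (\<lambda>i j. \<alpha> i * lap1 \<alpha> j) - inn Ric (\<lambda>i j. \<alpha> i * \<alpha> j)"
    by (simp add: weitzenboeck right_diff_distrib ctr_diff R)
  finally have 2: "6 * ctr (\<lambda>i j. \<alpha> i * \<delta> (\<alpha> j)) = 6 * (ctr (\<lambda>i j. \<alpha> i * lap1 \<alpha> j) - inn Ric (\<lambda>i j. \<alpha> i * \<alpha> j))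
      + ctr (\<lambda>m n. \<alpha> m * D n nH)" .
  have L: "lap n\<alpha> = 2 * ctr (\<lambda>i j. \<alpha> i * lap1 \<alpha> j) + 2 * inn (\<lambda>i j. cov1 i \<alpha> j) (\<lambda>i j. cov1 i \<alpha> j)"
    unfolding n\<alpha>_def by (rule lap_norm1)
  show ?thesis
    unfolding right_diff_distrib[of 6] 1 2 inn_two_h L by (simp add: algebra_simps)
qed

subsection \<open>The right-hand side\<close>

text \<open>Four times the tensor \<open>Rc - H\<^sup>2/4 + L\<^bsub>\<alpha>/2\<^esub> g\<close>.\<close>

definition E :: "'n \<Rightarrow> 'n \<Rightarrow> 'r" where
  "E i j = 4 * Ric i j - Hs i j + 2 * (cov1 i \<alpha> j + cov1 j \<alpha> i)"

lemma inn_N1_transpose: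
  assumes "\<And>i j. S i j = S j i"
  shows "inn S (\<lambda>i j. cov1 j \<alpha> i) = inn S (\<lambda>i j. cov1 i \<alpha> j)"
proof -
  have "inn S (\<lambda>i j. cov1 j \<alpha> i) = inn (\<lambda>i j. S j i) (\<lambda>i j. cov1 j \<alpha> i)"
    using assms by (intro arg_cong2[where f = inn] ext) auto
  then show ?thesis using inn_transpose[of S "\<lambda>i j. cov1 i \<alpha> j"] by simp
qed

lemma inn_E:
  "inn E E = 16 * inn Ric Ric + inn Hs Hs - 8 * inn Hs Ric + 32 * inn Ric (\<lambda>i j. cov1 i \<alpha> j)
     - 8 * inn Hs (\<lambda>i j. cov1 i \<alpha> j) + 8 * inn (\<lambda>i j. cov1 i \<alpha> j) (\<lambda>i j. cov1 i \<alpha> j)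
     + 8 * inn (\<lambda>i j. cov1 i \<alpha> j) (\<lambda>i j. cov1 j \<alpha> i)"
proof -
  have 1: "inn (\<lambda>i j. cov1 j \<alpha> i) (\<lambda>i j. cov1 j \<alpha> i) = inn (\<lambda>i j. cov1 i \<alpha> j) (\<lambda>i j. cov1 i \<alpha> j)"
    by (rule inn_transpose)
  show ?thesis
    unfolding E_def[abs_def] inn_simps
    by (simp add: inn_commute[of Ric Hs] inn_commute[of "\<lambda>i j. cov1 i \<alpha> j" Ric]
        inn_commute[of "\<lambda>i j. cov1 i \<alpha> j" Hs] inn_commute[of "\<lambda>i j. cov1 j \<alpha> i" Ric]
        inn_commute[of "\<lambda>i j. cov1 j \<alpha> i" Hs] inn_N1_transpose[OF Ric_sym]
        inn_N1_transpose[OF Hs_sym] 1 inn_commute[of "\<lambda>i j. cov1 j \<alpha> i" "\<lambda>i j. cov1 i \<alpha> j"] algebra_simps)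
qed

lemma inn_d\<alpha>:
  "inn (\<lambda>i j. cov1 i \<alpha> j - cov1 j \<alpha> i) (\<lambda>i j. cov1 i \<alpha> j - cov1 j \<alpha> i) =
     2 * inn (\<lambda>i j. cov1 i \<alpha> j) (\<lambda>i j. cov1 i \<alpha> j) - 2 * inn (\<lambda>i j. cov1 i \<alpha> j) (\<lambda>i j. cov1 j \<alpha> i)"
proof -
  have 1: "inn (\<lambda>i j. cov1 j \<alpha> i) (\<lambda>i j. cov1 j \<alpha> i) = inn (\<lambda>i j. cov1 i \<alpha> j) (\<lambda>i j. cov1 i \<alpha> j)"
    by (rule inn_transpose)
  show ?thesis
    unfolding inn_simps 1
    by (simp add: inn_commute[of "\<lambda>i j. cov1 j \<alpha> i" "\<lambda>i j. cov1 i \<alpha> j"] algebra_simps)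
qed

lemma inn_\<beta>_i\<alpha>H:
  defines "F \<equiv> \<lambda>j k. \<beta> j k + ctr (\<lambda>i l. \<alpha> l * H i j k)"
  shows "inn F F = inn \<beta> \<beta> + 2 * ctr (\<lambda>m n. \<alpha> m * P n) + inn Hs (\<lambda>i j. \<alpha> i * \<alpha> j)"
proof -
  have i: "inn \<beta> (\<lambda>j k. ctr (\<lambda>i l. \<alpha> l * H i j k)) = ctr (\<lambda>m n. \<alpha> m * P n)"
    unfolding ctr_inn[symmetric] inn_mult_right
    by (subst ctr_transpose[symmetric]) (simp add: P_def inn_commute[of \<beta>])
  have ii: "inn (\<lambda>j k. ctr (\<lambda>i l. \<alpha> l * H i j k)) (\<lambda>j k. ctr (\<lambda>i l. \<alpha> l * H i j k)) =
      inn Hs (\<lambda>i j. \<alpha> i * \<alpha> j)"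
  proof -
    have "inn (\<lambda>j k. ctr (\<lambda>i l. \<alpha> l * H i j k)) (H a) = ctr (\<lambda>i l. \<alpha> l * Hs i a)" for a
      unfolding inn_commute[of _ "H a"] ctr_inn[symmetric] inn_mult_right
      by (simp add: Hs_def inn_commute[of "H a"])
    then show ?thesis
      unfolding inn_\<alpha>_\<alpha> ctr_inn[symmetric] inn_mult_right
      by (subst ctr_swap) (simp add: ctr_mult[symmetric] ac_simps)
  qed
  show ?thesis
    unfolding F_def inn_add_left inn_add_right i ii
    by (simp add: inn_commute[of "\<lambda>j k. ctr (\<lambda>i l. \<alpha> l * H i j k)" \<beta>] i)
qed

end

section \<open>Smooth functions\<close>

lemma Ck_on_cong:
  assumes "Ck_on k f S" "\<And>x. x \<in> S \<Longrightarrow> f x = h x"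
  shows "Ck_on k h S"
proof (cases k)
  case 0
  then show ?thesis using assms continuous_on_cong[of S S f h] by simp
next
  case (Suc k')
  then show ?thesis
    using assms has_derivative_transform[of _ S h f] by fastforce
qed

lemma Ck_on_continuous: "Ck_on k f S \<Longrightarrow> continuous_on S f"
  by (cases k) (auto simp: continuous_on_eq_continuous_within dest: has_derivative_continuous)

lemma Ck_on_Suc_D: "Ck_on (Suc k) f S \<Longrightarrow> Ck_on k f S"
proof (induction k arbitrary: f)
  case 0
  then have "continuous_on S f" by (rule Ck_on_continuous)
  then show ?case by simp
next
  case (Suc k)
  from Suc.prems obtain f' where f':
    "\<And>x. x \<in> S \<Longrightarrow> (f has_derivative (\<lambda>v. \<Sum>e\<in>Basis. (v \<bullet> e) * f' e x)) (at x within S)"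
    "\<And>e. e \<in> Basis \<Longrightarrow> Ck_on (Suc k) (f' e) S"
    unfolding Ck_on.simps(2)[of "Suc k"] by blast
  then show ?case
    unfolding Ck_on.simps(2)[of k] by (intro exI[of _ f'] conjI ballI f'(1) Suc.IH f'(2))
qed

lemma Ck_on_const: "Ck_on k (\<lambda>_. c) S"
proof (induction k arbitrary: c)
  case (Suc k)
  show ?case
    unfolding Ck_on.simps(2)
    by (rule exI[of _ "\<lambda>_ _. 0"]) (use Suc in auto)
qed simp

lemma Ck_on_add: "Ck_on k f S \<Longrightarrow> Ck_on k h S \<Longrightarrow> Ck_on k (\<lambda>x. f x + h x) S"
proof (induction k arbitrary: f h)
  case 0
  then show ?case by (simp add: continuous_on_add)
next
  case (Suc k)
  from Suc.prems(1) obtain f' where f':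
    "\<And>x. x \<in> S \<Longrightarrow> (f has_derivative (\<lambda>v. \<Sum>e\<in>Basis. (v \<bullet> e) * f' e x)) (at x within S)"
    "\<And>e. e \<in> Basis \<Longrightarrow> Ck_on k (f' e) S"
    unfolding Ck_on.simps(2) by blast
  from Suc.prems(2) obtain h' where h':
    "\<And>x. x \<in> S \<Longrightarrow> (h has_derivative (\<lambda>v. \<Sum>e\<in>Basis. (v \<bullet> e) * h' e x)) (at x within S)"
    "\<And>e. e \<in> Basis \<Longrightarrow> Ck_on k (h' e) S"
    unfolding Ck_on.simps(2) by blast
  show ?case
    unfolding Ck_on.simps(2)
  proof (intro exI[of _ "\<lambda>e x. f' e x + h' e x"] conjI ballI)
    fix x assume x: "x \<in> S"
    show "((\<lambda>x. f x + h x) has_derivative (\<lambda>v. \<Sum>e\<in>Basis. (v \<bullet> e) * (f' e x + h' e x))) (at x within S)"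
      using has_derivative_add[OF f'(1)[OF x] h'(1)[OF x]] by (simp add: distrib_left sum.distrib)
  next
    fix e :: 'a assume "e \<in> Basis"
    then show "Ck_on k (\<lambda>x. f' e x + h' e x) S"
      by (intro Suc.IH f'(2) h'(2))
  qed
qed

lemma Ck_on_mult: "Ck_on k f S \<Longrightarrow> Ck_on k h S \<Longrightarrow> Ck_on k (\<lambda>x. f x * h x) S"
proof (induction k arbitrary: f h)
  case 0
  then show ?case by (simp add: continuous_on_mult)
next
  case (Suc k)
  from Suc.prems(1) obtain f' where f':
    "\<And>x. x \<in> S \<Longrightarrow> (f has_derivative (\<lambda>v. \<Sum>e\<in>Basis. (v \<bullet> e) * f' e x)) (at x within S)"
    "\<And>e. e \<in> Basis \<Longrightarrow> Ck_on k (f' e) S"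
    unfolding Ck_on.simps(2) by blast
  from Suc.prems(2) obtain h' where h':
    "\<And>x. x \<in> S \<Longrightarrow> (h has_derivative (\<lambda>v. \<Sum>e\<in>Basis. (v \<bullet> e) * h' e x)) (at x within S)"
    "\<And>e. e \<in> Basis \<Longrightarrow> Ck_on k (h' e) S"
    unfolding Ck_on.simps(2) by blast
  show ?case
    unfolding Ck_on.simps(2)
  proof (intro exI[of _ "\<lambda>e x. f x * h' e x + f' e x * h x"] conjI ballI)
    fix x assume x: "x \<in> S"
    show "((\<lambda>x. f x * h x) has_derivative
        (\<lambda>v. \<Sum>e\<in>Basis. (v \<bullet> e) * (f x * h' e x + f' e x * h x))) (at x within S)"
      using has_derivative_mult[OF f'(1)[OF x] h'(1)[OF x]]
      by (simp add: distrib_left sum.distrib sum_distrib_left sum_distrib_right ac_simps)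
  next
    fix e :: 'a assume "e \<in> Basis"
    then show "Ck_on k (\<lambda>x. f x * h' e x + f' e x * h x) S"
      by (intro Ck_on_add Suc.IH f'(2) h'(2) Suc.prems[THEN Ck_on_Suc_D])
  qed
qed

lemma Ck_on_inverse:
  "Ck_on k f S \<Longrightarrow> (\<And>x. x \<in> S \<Longrightarrow> f x \<noteq> 0) \<Longrightarrow> Ck_on k (\<lambda>x. inverse (f x)) S"
proof (induction k arbitrary: f)
  case 0
  then show ?case by (simp add: continuous_on_inverse)
next
  case (Suc k)
  from Suc.prems(1) obtain f' where f':
    "\<And>x. x \<in> S \<Longrightarrow> (f has_derivative (\<lambda>v. \<Sum>e\<in>Basis. (v \<bullet> e) * f' e x)) (at x within S)"
    "\<And>e. e \<in> Basis \<Longrightarrow> Ck_on k (f' e) S"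
    unfolding Ck_on.simps(2) by blast
  have inv: "Ck_on k (\<lambda>x. inverse (f x)) S"
    using Suc.IH Suc.prems(2) Ck_on_Suc_D[OF Suc.prems(1)] by blast
  show ?case
    unfolding Ck_on.simps(2)
  proof (intro exI[of _ "\<lambda>e x. - 1 * (inverse (f x) * f' e x * inverse (f x))"] conjI ballI)
    fix x assume x: "x \<in> S"
    show "((\<lambda>x. inverse (f x)) has_derivative
        (\<lambda>v. \<Sum>e\<in>Basis. (v \<bullet> e) * (- 1 * (inverse (f x) * f' e x * inverse (f x))))) (at x within S)"
      using Deriv.has_derivative_inverse[OF Suc.prems(2)[OF x] f'(1)[OF x]]
      by (simp add: sum_distrib_left sum_distrib_right sum_negf ac_simps)
  next
    fix e :: 'a assume "e \<in> Basis"
    then show "Ck_on k (\<lambda>x. - 1 * (inverse (f x) * f' e x * inverse (f x))) S"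
      by (intro Ck_on_mult Ck_on_const inv f'(2))
  qed
qed

lemma smooth_on_cong: "smooth_on f S \<Longrightarrow> (\<And>x. x \<in> S \<Longrightarrow> f x = h x) \<Longrightarrow> smooth_on h S"
  unfolding smooth_on_def using Ck_on_cong by blast

lemma smooth_on_const: "smooth_on (\<lambda>_. c) S"
  and smooth_on_add: "smooth_on f S \<Longrightarrow> smooth_on h S \<Longrightarrow> smooth_on (\<lambda>x. f x + h x) S"
  and smooth_on_mult: "smooth_on f S \<Longrightarrow> smooth_on h S \<Longrightarrow> smooth_on (\<lambda>x. f x * h x) S"
  and smooth_on_inverse: "smooth_on f S \<Longrightarrow> (\<And>x. x \<in> S \<Longrightarrow> f x \<noteq> 0) \<Longrightarrow>
    smooth_on (\<lambda>x. inverse (f x)) S"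
  unfolding smooth_on_def by (auto intro: Ck_on_const Ck_on_add Ck_on_mult Ck_on_inverse)

lemma smooth_on_sum:
  "(\<And>i. i \<in> X \<Longrightarrow> smooth_on (f i) S) \<Longrightarrow> smooth_on (\<lambda>x. \<Sum>i\<in>X. f i x) S"
  by (induction X rule: infinite_finite_induct) (auto intro: smooth_on_const smooth_on_add)

lemma smooth_on_prod:
  "(\<And>i. i \<in> X \<Longrightarrow> smooth_on (f i) S) \<Longrightarrow> smooth_on (\<lambda>x. \<Prod>i\<in>X. f i x) S"
  by (induction X rule: infinite_finite_induct) (auto intro: smooth_on_const smooth_on_mult)

lemma smooth_on_det:
  fixes M :: "'a::euclidean_space \<Rightarrow> real ^ 'n ^ 'n"
  assumes "\<And>i j. smooth_on (\<lambda>x. M x $ i $ j) S"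
  shows "smooth_on (\<lambda>x. det (M x)) S"
  unfolding det_def by (intro smooth_on_sum smooth_on_mult smooth_on_const smooth_on_prod assms)

lemma matrix_inv_inverse:
  fixes M :: "'a::semiring_1 ^ 'n ^ 'm"
  assumes "invertible M"
  shows "M ** matrix_inv M = mat 1" "matrix_inv M ** M = mat 1"
  using someI_ex[OF assms[unfolded invertible_def]] unfolding matrix_inv_def by auto

text \<open>Cramer's rule; it makes the inverse of a smooth matrix smooth.\<close>

lemma matrix_inv_eq_det:
  fixes M :: "real ^ 'n ^ 'n"
  assumes "invertible M"
  shows "matrix_inv M $ i $ j = det (\<chi> k l. if l = i then axis j 1 $ k else M $ k $ l) * inverse (det M)"
proof -
  have "M *v (matrix_inv M *v axis j 1) = axis j 1"
    using assms by (simp add: matrix_vector_mul_assoc matrix_inv_inverse)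
  moreover have "det M \<noteq> 0" using assms by (simp add: invertible_det_nz)
  ultimately have "matrix_inv M *v axis j 1 =
      (\<chi> k. det (\<chi> i l. if l = k then axis j 1 $ i else M $ i $ l) / det M)"
    by (rule cramer[THEN iffD1, rotated])
  moreover have "(matrix_inv M *v axis j 1) $ i = matrix_inv M $ i $ j"
    by (simp add: matrix_vector_mult_basis column_def)
  ultimately show ?thesis by (simp add: divide_inverse)
qed

lemma smooth_on_matrix_inv:
  fixes M :: "'a::euclidean_space \<Rightarrow> real ^ 'n ^ 'n"
  assumes "\<And>i j. smooth_on (\<lambda>x. M x $ i $ j) S" "\<And>x. x \<in> S \<Longrightarrow> invertible (M x)"
  shows "smooth_on (\<lambda>x. matrix_inv (M x) $ i $ j) S"
proof (rule smooth_on_cong)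
  show "smooth_on (\<lambda>x. det (\<chi> k l. if l = i then axis j 1 $ k else M x $ k $ l) * inverse (det (M x))) S"
  proof (intro smooth_on_mult smooth_on_inverse smooth_on_det)
    fix k l
    show "smooth_on (\<lambda>x. (\<chi> k l. if l = i then axis j 1 $ k else M x $ k $ l) $ k $ l) S"
      by (cases "l = i") (simp_all add: smooth_on_const assms(1))
  qed (use assms in \<open>auto simp: invertible_det_nz\<close>)
qed (use assms(2) in \<open>simp add: matrix_inv_eq_det\<close>)

section \<open>Partial derivatives within a thick set\<close>

text \<open>The derivative of \<open>f\<close> in the direction \<open>e\<close>, taken within \<open>S\<close>; at boundary points it may be one-sided.\<close>

definition dird :: "'a::euclidean_space set \<Rightarrow> 'a \<Rightarrow> ('a \<Rightarrow> real) \<Rightarrow> 'a \<Rightarrow> real" where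
  "dird S e f x = frechet_derivative f (at x within S) e"

lemma dird_cong:
  assumes "\<And>x. x \<in> S \<Longrightarrow> f x = h x" "x \<in> S"
  shows "dird S e f x = dird S e h x"
proof -
  have "(\<lambda>L. (f has_derivative L) (at x within S)) = (\<lambda>L. (h has_derivative L) (at x within S))"
  proof (intro ext iffI)
    fix L
    show "(h has_derivative L) (at x within S)" if "(f has_derivative L) (at x within S)"
      using assms(2) _ that by (rule has_derivative_transform) (simp add: assms(1))
    show "(f has_derivative L) (at x within S)" if "(h has_derivative L) (at x within S)"
      using assms(2) _ that by (rule has_derivative_transform) (simp add: assms(1))
  qed
  then show ?thesis by (simp add: dird_def frechet_derivative_def)
qed

text \<open>Sets on which the derivative within the set is unique, contained in the closure of their interior.\<close>

locale thick_set =
  fixes S :: "'a::euclidean_space set"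
  assumes thick: "x \<in> S \<Longrightarrow> i \<in> Basis \<Longrightarrow> \<epsilon> > 0 \<Longrightarrow>
      \<exists>d. 0 < \<bar>d\<bar> \<and> \<bar>d\<bar> < \<epsilon> \<and> x + d *\<^sub>R i \<in> S"
    and dense_interior: "S \<subseteq> closure (interior S)"
begin

lemma dird_eq:
  assumes "(f has_derivative L) (at x within S)" "x \<in> S"
  shows "dird S e f x = L e"
proof -
  have "(f has_derivative frechet_derivative f (at x within S)) (at x within S)"
    using assms(1) by (metis differentiable_def frechet_derivative_works)
  then have "frechet_derivative f (at x within S) = L"
    using assms thick by (intro frechet_derivative_unique_within) auto
  then show ?thesis by (simp add: dird_def)
qed

lemma Ck_on_dird:
  assumes "Ck_on (Suc k) f S"
  shows "x \<in> S \<Longrightarrow> (f has_derivative (\<lambda>v. \<Sum>e\<in>Basis. (v \<bullet> e) * dird S e f x)) (at x within S)"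
    and "e \<in> Basis \<Longrightarrow> Ck_on k (dird S e f) S"
proof -
  from assms obtain f' where f':
    "\<And>x. x \<in> S \<Longrightarrow> (f has_derivative (\<lambda>v. \<Sum>e\<in>Basis. (v \<bullet> e) * f' e x)) (at x within S)"
    "\<And>e. e \<in> Basis \<Longrightarrow> Ck_on k (f' e) S"
    unfolding Ck_on.simps(2) by blast
  have eq: "dird S e f x = f' e x" if "x \<in> S" "e \<in> Basis" for x e
  proof -
    have "dird S e f x = (\<Sum>i\<in>Basis. (e \<bullet> i) * f' i x)" using dird_eq[OF f'(1)] that by simp
    also have "\<dots> = (\<Sum>i\<in>Basis. if i = e then f' e x else 0)"
      using that by (intro sum.cong) (auto simp: inner_Basis)
    finally show ?thesis using that by simp
  qed
  show "x \<in> S \<Longrightarrow> (f has_derivative (\<lambda>v. \<Sum>e\<in>Basis. (v \<bullet> e) * dird S e f x)) (at x within S)"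
    using f'(1)[of x] by (simp add: eq cong: sum.cong)
  show "e \<in> Basis \<Longrightarrow> Ck_on k (dird S e f) S"
    using f'(2)[of e] by (rule Ck_on_cong) (auto simp: eq)
qed

lemma smooth_on_dird: "smooth_on f S \<Longrightarrow> e \<in> Basis \<Longrightarrow> smooth_on (dird S e f) S"
  unfolding smooth_on_def using Ck_on_dird(2) by blast

lemma smooth_on_has_derivative:
  "smooth_on f S \<Longrightarrow> x \<in> S \<Longrightarrow>
     (f has_derivative (\<lambda>v. \<Sum>e\<in>Basis. (v \<bullet> e) * dird S e f x)) (at x within S)"
  unfolding smooth_on_def using Ck_on_dird(1) by blast

lemma dird_add:
  assumes "smooth_on f S" "smooth_on h S" "x \<in> S"
  shows "dird S e (\<lambda>x. f x + h x) x = dird S e f x + dird S e h x"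
  using dird_eq[OF has_derivative_add[OF smooth_on_has_derivative[OF assms(1,3)]
        smooth_on_has_derivative[OF assms(2,3)]] assms(3), of e]
    dird_eq[OF smooth_on_has_derivative[OF assms(1,3)] assms(3), of e]
    dird_eq[OF smooth_on_has_derivative[OF assms(2,3)] assms(3), of e] by simp

lemma dird_mult:
  assumes "smooth_on f S" "smooth_on h S" "x \<in> S"
  shows "dird S e (\<lambda>x. f x * h x) x = dird S e f x * h x + f x * dird S e h x"
  using dird_eq[OF has_derivative_mult[OF smooth_on_has_derivative[OF assms(1,3)]
        smooth_on_has_derivative[OF assms(2,3)]] assms(3), of e]
    dird_eq[OF smooth_on_has_derivative[OF assms(1,3)] assms(3), of e]
    dird_eq[OF smooth_on_has_derivative[OF assms(2,3)] assms(3), of e] by (simp add: algebra_simps)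

lemma dird_const: "x \<in> S \<Longrightarrow> dird S e (\<lambda>_. c) x = 0"
  using dird_eq[OF has_derivative_const] by simp

lemma smooth_on_line_derivative:
  assumes f: "smooth_on f S" and e: "e \<in> Basis" and y: "y + s *\<^sub>R e \<in> interior S"
  shows "((\<lambda>s. f (y + s *\<^sub>R e)) has_real_derivative dird S e f (y + s *\<^sub>R e)) (at s)"
proof -
  let ?z = "y + s *\<^sub>R e"
  have zS: "?z \<in> S" using y interior_subset by blast
  have line: "((\<lambda>s. y + s *\<^sub>R e) has_derivative (\<lambda>d. 0 + d *\<^sub>R e)) (at s)"
    by (intro has_derivative_add has_derivative_const has_derivative_scaleR_left has_derivative_ident)
  have "(f has_derivative (\<lambda>v. \<Sum>i\<in>Basis. (v \<bullet> i) * dird S i f ?z)) (at ?z)"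
    using smooth_on_has_derivative[OF f zS] by (simp only: at_within_interior[OF y])
  then have "((\<lambda>s. f (y + s *\<^sub>R e)) has_derivative
      (\<lambda>d. \<Sum>i\<in>Basis. ((0 + d *\<^sub>R e) \<bullet> i) * dird S i f ?z)) (at s)"
    by (rule has_derivative_compose[OF line])
  also have "(\<lambda>d. \<Sum>i\<in>Basis. ((0 + d *\<^sub>R e) \<bullet> i) * dird S i f ?z) = (*) (dird S e f ?z)"
  proof
    fix d
    have "(\<Sum>i\<in>Basis. ((0 + d *\<^sub>R e) \<bullet> i) * dird S i f ?z) =
        (\<Sum>i\<in>Basis. if i = e then dird S e f ?z * d else 0)"
      using e by (intro sum.cong) (auto simp: inner_Basis)
    then show "(\<Sum>i\<in>Basis. ((0 + d *\<^sub>R e) \<bullet> i) * dird S i f ?z) = dird S e f ?z * d"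
      using e by simp
  qed
  finally show ?thesis unfolding has_field_derivative_def .
qed

text \<open>Schwarz's argument: by the mean value theorem, applied twice, the second difference is
  a value of the mixed second derivative at a nearby point.\<close>

lemma second_difference:
  assumes f: "smooth_on f S" and e: "e \<in> Basis" "e' \<in> Basis" and r: "0 < r"
    and ball: "ball x (3 * r) \<subseteq> interior S"
  shows "\<exists>y. dist x y < 3 * r \<and>
     f (x + r *\<^sub>R e + r *\<^sub>R e') - f (x + r *\<^sub>R e) - f (x + r *\<^sub>R e') + f x
       = r * r * dird S e' (dird S e f) y"
proof -
  have inb: "x + a *\<^sub>R e + b *\<^sub>R e' \<in> interior S \<and> dist x (x + a *\<^sub>R e + b *\<^sub>R e') < 3 * r"
    if "0 \<le> a" "a \<le> r" "0 \<le> b" "b \<le> r" for a b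
  proof -
    have "x - (x + a *\<^sub>R e + b *\<^sub>R e') = - (a *\<^sub>R e + b *\<^sub>R e')" by simp
    then have "dist x (x + a *\<^sub>R e + b *\<^sub>R e') \<le> norm (a *\<^sub>R e) + norm (b *\<^sub>R e')"
      by (simp only: dist_norm norm_minus_cancel norm_triangle_ineq)
    also have "\<dots> < 3 * r" using that e r by simp
    finally show ?thesis using ball by auto
  qed
  define u where "u s = f (x + r *\<^sub>R e' + s *\<^sub>R e) - f (x + s *\<^sub>R e)" for s
  have "\<exists>\<xi>. 0 < \<xi> \<and> \<xi> < r \<and> u r - u 0 = (r - 0) *
      (dird S e f (x + r *\<^sub>R e' + \<xi> *\<^sub>R e) - dird S e f (x + \<xi> *\<^sub>R e))"
  proof (rule MVT2[OF r])
    fix s assume "0 \<le> s" "s \<le> r"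
    then show "(u has_real_derivative
        dird S e f (x + r *\<^sub>R e' + s *\<^sub>R e) - dird S e f (x + s *\<^sub>R e)) (at s)"
      unfolding u_def using inb[of s r] inb[of s 0] r
      by (intro DERIV_diff smooth_on_line_derivative f e) (auto simp: add_ac)
  qed
  then obtain \<xi> where \<xi>: "0 < \<xi>" "\<xi> < r"
    "u r - u 0 = r * (dird S e f (x + r *\<^sub>R e' + \<xi> *\<^sub>R e) - dird S e f (x + \<xi> *\<^sub>R e))" by auto
  have "\<exists>\<eta>. 0 < \<eta> \<and> \<eta> < r \<and> dird S e f (x + \<xi> *\<^sub>R e + r *\<^sub>R e') - dird S e f (x + \<xi> *\<^sub>R e + 0 *\<^sub>R e')
      = (r - 0) * dird S e' (dird S e f) (x + \<xi> *\<^sub>R e + \<eta> *\<^sub>R e')"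
  proof (rule MVT2[OF r])
    fix s assume "0 \<le> s" "s \<le> r"
    then show "((\<lambda>s. dird S e f (x + \<xi> *\<^sub>R e + s *\<^sub>R e')) has_real_derivative
        dird S e' (dird S e f) (x + \<xi> *\<^sub>R e + s *\<^sub>R e')) (at s)"
      using inb[of \<xi> s] \<xi> by (intro smooth_on_line_derivative smooth_on_dird f e) auto
  qed
  then obtain \<eta> where \<eta>: "0 < \<eta>" "\<eta> < r" "dird S e f (x + \<xi> *\<^sub>R e + r *\<^sub>R e') - dird S e f (x + \<xi> *\<^sub>R e)
      = r * dird S e' (dird S e f) (x + \<xi> *\<^sub>R e + \<eta> *\<^sub>R e')" by auto
  show ?thesis
  proof (intro exI conjI)
    show "dist x (x + \<xi> *\<^sub>R e + \<eta> *\<^sub>R e') < 3 * r" using inb \<xi> \<eta> by auto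
    show "f (x + r *\<^sub>R e + r *\<^sub>R e') - f (x + r *\<^sub>R e) - f (x + r *\<^sub>R e') + f x
       = r * r * dird S e' (dird S e f) (x + \<xi> *\<^sub>R e + \<eta> *\<^sub>R e')"
      using \<xi>(3) \<eta>(3) by (simp add: u_def add_ac mult.assoc)
  qed
qed

lemma dird_commute_interior:
  assumes f: "smooth_on f S" and e: "e \<in> Basis" "e' \<in> Basis" and x: "x \<in> interior S"
  shows "dird S e' (dird S e f) x = dird S e (dird S e' f) x"
proof (rule ccontr)
  let ?a = "dird S e' (dird S e f)" and ?b = "dird S e (dird S e' f)"
  assume neq: "?a x \<noteq> ?b x"
  define \<epsilon> where "\<epsilon> = \<bar>?a x - ?b x\<bar> / 2"
  have \<epsilon>: "\<epsilon> > 0" using neq by (simp add: \<epsilon>_def)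
  have xS: "x \<in> S" using x interior_subset by blast
  have "continuous_on S ?a" "continuous_on S ?b"
    using f e smooth_on_dird Ck_on_continuous unfolding smooth_on_def by blast+
  then obtain d1 d2 where d: "d1 > 0" "d2 > 0"
    and d1: "\<And>y. y \<in> S \<Longrightarrow> dist y x < d1 \<Longrightarrow> dist (?a y) (?a x) < \<epsilon>"
    and d2: "\<And>y. y \<in> S \<Longrightarrow> dist y x < d2 \<Longrightarrow> dist (?b y) (?b x) < \<epsilon>"
    using xS \<epsilon> unfolding continuous_on_iff by metis
  obtain d3 where d3: "d3 > 0" "ball x d3 \<subseteq> interior S"
    using x open_contains_ball[of "interior S"] by auto
  \<comment> \<open>Two steps of length \<open>r\<close> stay inside the ball of radius \<open>3 r\<close>.\<close>
  define r where "r = min d1 (min d2 d3) / 3"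
  have r: "r > 0" "3 * r \<le> d1" "3 * r \<le> d2" "3 * r \<le> d3"
    using d d3 by (auto simp: r_def)
  have ball: "ball x (3 * r) \<subseteq> interior S" using d3 r by force
  obtain y where y: "dist x y < 3 * r"
    "f (x + r *\<^sub>R e + r *\<^sub>R e') - f (x + r *\<^sub>R e) - f (x + r *\<^sub>R e') + f x = r * r * ?a y"
    using second_difference[OF f e r(1) ball] by blast
  obtain z where z: "dist x z < 3 * r"
    "f (x + r *\<^sub>R e' + r *\<^sub>R e) - f (x + r *\<^sub>R e') - f (x + r *\<^sub>R e) + f x = r * r * ?b z"
    using second_difference[OF f e(2,1) r(1) ball] by blast
  have "x + r *\<^sub>R e' + r *\<^sub>R e = x + r *\<^sub>R e + r *\<^sub>R e'" by (simp add: add_ac)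
  then have "r * r * ?a y = r * r * ?b z" using y(2) z(2) by (simp only:)
  then have "?a y = ?b z" using r(1) by simp
  have "y \<in> S" "z \<in> S" 
    using y(1) z(1) subset_trans[OF ball interior_subset] by (simp_all add: subset_iff)
  moreover have "dist y x < d1" "dist z x < d2"
    using y(1) z(1) r by (simp_all add: dist_commute)
  ultimately have "dist (?a y) (?a x) < \<epsilon>" "dist (?b z) (?b x) < \<epsilon>"
    using d1 d2 by blast+
  with \<open>?a y = ?b z\<close> show False unfolding \<epsilon>_def dist_real_def by (smt (verit) field_sum_of_halves)
qed

lemma dird_commute:
  assumes f: "smooth_on f S" and e: "e \<in> Basis" "e' \<in> Basis" and x: "x \<in> S"
  shows "dird S e' (dird S e f) x = dird S e (dird S e' f) x"
proof -
  let ?d = "\<lambda>x. dird S e' (dird S e f) x - dird S e (dird S e' f) x"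
  have "continuous_on S ?d"
    using f e smooth_on_dird Ck_on_continuous unfolding smooth_on_def
    by (intro continuous_on_diff) blast+
  moreover have "interior S \<subseteq> S" "x \<in> closure (interior S)" using interior_subset dense_interior x by auto
  then obtain X where X: "\<And>n. X n \<in> interior S" "X \<longlonglongrightarrow> x"
    unfolding closure_sequential by blast
  ultimately have "(\<lambda>n. ?d (X n)) \<longlonglongrightarrow> ?d x"
    using x \<open>interior S \<subseteq> S\<close>
    by (intro continuous_on_tendsto_compose[of S ?d] always_eventually) auto
  then have "(\<lambda>n. 0) \<longlonglongrightarrow> ?d x"
    using dird_commute_interior[OF f e X(1)] by simp
  then show ?thesis using LIMSEQ_unique tendsto_const by fastforce
qed

end

section \<open>Taylor jets\<close>

text \<open>The directions \<open>B k\<close> are those in which jets are taken.\<close>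

locale thick_set_directions = thick_set S for S :: "'a::euclidean_space set" +
  fixes B :: "'k \<Rightarrow> 'a"
  assumes B: "B k \<in> Basis"
begin

text \<open>The first letter of a word is the direction in which the function is differentiated first.\<close>

primrec word_deriv :: "'k list \<Rightarrow> ('a \<Rightarrow> real) \<Rightarrow> 'a \<Rightarrow> real" where
  "word_deriv [] f = f"
| "word_deriv (k # w) f = word_deriv w (dird S (B k) f)"

lemma word_deriv_cong:
  "(\<And>x. x \<in> S \<Longrightarrow> f x = h x) \<Longrightarrow> x \<in> S \<Longrightarrow> word_deriv w f x = word_deriv w h x"
proof (induction w arbitrary: f h)
  case (Cons k w)
  show ?case
    unfolding word_deriv.simps by (rule Cons.IH) (auto intro!: dird_cong Cons.prems)
qed simp

lemma word_deriv_append: "word_deriv (u @ v) f = word_deriv v (word_deriv u f)"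
  by (induction u arbitrary: f) auto

lemma smooth_on_word_deriv: "smooth_on f S \<Longrightarrow> smooth_on (word_deriv w f) S"
  by (induction w arbitrary: f) (auto intro: smooth_on_dird B)

lemma word_deriv_symmetric:
  assumes "smooth_on f S" "x \<in> S"
  shows "symmetric_words (\<lambda>w. word_deriv w f x)"
  unfolding symmetric_words_def word_deriv_append word_deriv.simps
  using assms by (auto intro!: word_deriv_cong dird_commute smooth_on_word_deriv B)

lemma word_deriv_add:
  "smooth_on f S \<Longrightarrow> smooth_on h S \<Longrightarrow> x \<in> S \<Longrightarrow>
     word_deriv w (\<lambda>x. f x + h x) x = word_deriv w f x + word_deriv w h x"
proof (induction w arbitrary: f h)
  case (Cons k w)
  have "word_deriv (k # w) (\<lambda>x. f x + h x) x =
      word_deriv w (\<lambda>x. dird S (B k) f x + dird S (B k) h x) x"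
    unfolding word_deriv.simps by (rule word_deriv_cong) (use Cons.prems dird_add in auto)
  then show ?case using Cons.IH Cons.prems smooth_on_dird B by simp
qed simp

lemma word_deriv_const: "x \<in> S \<Longrightarrow> word_deriv w (\<lambda>_. c) x = (if w = [] then c else 0)"
proof (induction w arbitrary: c)
  case (Cons k w)
  have "word_deriv (k # w) (\<lambda>_. c) x = word_deriv w (\<lambda>_. 0) x"
    unfolding word_deriv.simps by (rule word_deriv_cong) (use Cons.prems dird_const in auto)
  then show ?case using Cons by simp
qed simp

lemma word_deriv_mult:
  "smooth_on f S \<Longrightarrow> smooth_on h S \<Longrightarrow> x \<in> S \<Longrightarrow>
     word_deriv w (\<lambda>x. f x * h x) x =
     shuffle_prod w (\<lambda>v. word_deriv v f x) (\<lambda>v. word_deriv v h x)"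
proof (induction w arbitrary: f h)
  case (Cons k w)
  have "word_deriv (k # w) (\<lambda>x. f x * h x) x =
      word_deriv w (\<lambda>x. dird S (B k) f x * h x + f x * dird S (B k) h x) x"
    unfolding word_deriv.simps by (rule word_deriv_cong) (use Cons.prems dird_mult in auto)
  also have "\<dots> = word_deriv w (\<lambda>x. dird S (B k) f x * h x) x + word_deriv w (\<lambda>x. f x * dird S (B k) h x) x"
    using Cons.prems by (intro word_deriv_add smooth_on_mult smooth_on_dird B)
  finally show ?case using Cons.IH Cons.prems smooth_on_dird B by simp
qed simp

text \<open>The jet of \<open>f\<close> at \<open>x\<close>, meaningful for \<open>x \<in> S\<close> and \<open>f\<close> smooth on \<open>S\<close>. It depends only
  on the restriction of \<open>f\<close> to \<open>S\<close>.\<close>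

definition jet_at :: "'a \<Rightarrow> ('a \<Rightarrow> real) \<Rightarrow> 'k jet" where
  "jet_at x f = Abs_jet (\<lambda>w. word_deriv w f x)"

lemma Rep_jet_at: "smooth_on f S \<Longrightarrow> x \<in> S \<Longrightarrow> Rep_jet (jet_at x f) = (\<lambda>w. word_deriv w f x)"
  unfolding jet_at_def using word_deriv_symmetric by (intro Abs_jet_inverse) simp

lemma jet_at_cong: "(\<And>x. x \<in> S \<Longrightarrow> f x = h x) \<Longrightarrow> x \<in> S \<Longrightarrow> jet_at x f = jet_at x h"
  unfolding jet_at_def by (intro arg_cong[where f = Abs_jet] ext word_deriv_cong)

lemma jet_at_add:
  assumes "smooth_on f S" "smooth_on h S" "x \<in> S"
  shows "jet_at x (\<lambda>x. f x + h x) = jet_at x f + jet_at x h"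
  using assms by (intro Rep_jet_inject[THEN iffD1])
    (simp add: Rep_jet_at smooth_on_add plus_jet.rep_eq word_deriv_add)

lemma jet_at_mult:
  assumes "smooth_on f S" "smooth_on h S" "x \<in> S"
  shows "jet_at x (\<lambda>x. f x * h x) = jet_at x f * jet_at x h"
  using assms by (intro Rep_jet_inject[THEN iffD1])
    (simp add: Rep_jet_at smooth_on_mult times_jet.rep_eq word_deriv_mult)

lemma jet_at_const: "x \<in> S \<Longrightarrow> jet_at x (\<lambda>_. c) = c *\<^sub>R 1"
  by (intro Rep_jet_inject[THEN iffD1] ext)
    (simp add: Rep_jet_at smooth_on_const scaleR_jet.rep_eq one_jet.rep_eq word_deriv_const)

lemma jet_at_dird:
  assumes "smooth_on f S" "x \<in> S"
  shows "jet_at x (dird S (B k) f) = jet_deriv k (jet_at x f)"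
  using assms by (intro Rep_jet_inject[THEN iffD1])
    (simp add: Rep_jet_at smooth_on_dird B jet_deriv.rep_eq)

lemma jet_value_jet_at: "smooth_on f S \<Longrightarrow> x \<in> S \<Longrightarrow> jet_value (jet_at x f) = f x"
  by (simp add: jet_value.rep_eq Rep_jet_at)

end

section \<open>Families of functions in a chart\<close>

lemma sum_Basis_prod:
  fixes F :: "'a::euclidean_space \<times> 'b::euclidean_space \<Rightarrow> 'c::comm_monoid_add"
  shows "(\<Sum>e\<in>Basis. F e) = (\<Sum>i\<in>Basis. F (i, 0)) + (\<Sum>i\<in>Basis. F (0, i))"
  unfolding Basis_prod_def
  by (subst sum.union_disjoint) (auto simp: sum.reindex inj_on_def nonzero_Basis)

lemma Ck_on_snd:
  "Ck_on k f V \<Longrightarrow> Ck_on k (\<lambda>z :: real \<times> 'a::euclidean_space. f (snd z)) (I \<times> V)"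
proof (induction k arbitrary: f)
  case 0
  then have "continuous_on V f" by simp
  then have "continuous_on (I \<times> V) (\<lambda>z. f (snd z))"
    by (rule continuous_on_compose2[OF _ continuous_on_snd[OF continuous_on_id]]) auto
  then show ?case by simp
next
  case (Suc k)
  from Suc.prems obtain f' where f':
    "\<And>x. x \<in> V \<Longrightarrow> (f has_derivative (\<lambda>v. \<Sum>e\<in>Basis. (v \<bullet> e) * f' e x)) (at x within V)"
    "\<And>e. e \<in> Basis \<Longrightarrow> Ck_on k (f' e) V"
    unfolding Ck_on.simps(2) by blast
  show ?case
    unfolding Ck_on.simps(2)
  proof (intro exI[of _ "\<lambda>e z. if snd e \<in> Basis then f' (snd e) (snd z) else 0"] conjI ballI)
    fix z assume z: "z \<in> I \<times> V"
    have "(f has_derivative (\<lambda>v. \<Sum>e\<in>Basis. (v \<bullet> e) * f' e (snd z))) (at (snd z) within snd ` (I \<times> V))"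
      using z by (intro has_derivative_subset[OF f'(1)]) auto
    then have "((\<lambda>z. f (snd z)) has_derivative (\<lambda>v. \<Sum>e\<in>Basis. (snd v \<bullet> e) * f' e (snd z))) (at z within I \<times> V)"
      by (rule has_derivative_in_compose[OF has_derivative_snd[OF has_derivative_ident]])
    moreover have "(\<Sum>e\<in>Basis. (v \<bullet> e) * (if snd e \<in> Basis then f' (snd e) (snd z) else 0)) =
        (\<Sum>e\<in>Basis. (snd v \<bullet> e) * f' e (snd z))" for v :: "real \<times> 'a"
      unfolding sum_Basis_prod by (simp add: inner_prod_def cong: sum.cong)
    ultimately show "((\<lambda>z. f (snd z)) has_derivative (\<lambda>v. \<Sum>e\<in>Basis. (v \<bullet> e) *
        (if snd e \<in> Basis then f' (snd e) (snd z) else 0))) (at z within I \<times> V)"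
      by simp
  next
    fix e :: "real \<times> 'a" 
    show "Ck_on k (\<lambda>z. if snd e \<in> Basis then f' (snd e) (snd z) else 0) (I \<times> V)"
      using Suc.IH[OF f'(2)] Ck_on_const by (cases "snd e \<in> Basis") simp_all
  qed
qed

lemma smooth_on_snd: "smooth_on f V \<Longrightarrow> smooth_on (\<lambda>z :: real \<times> 'a::euclidean_space. f (snd z)) (I \<times> V)"
  unfolding smooth_on_def using Ck_on_snd by blast

lemma interval_islimpt:
  fixes I :: "real set"
  assumes "is_interval I" "interior I \<noteq> {}" "t \<in> I"
  shows "t islimpt I"
proof (rule connected_imp_perfect)
  show "connected I" using assms(1) by (rule is_interval_connected)
  show "\<And>a. I \<noteq> {a}" using assms(2) by auto
qed (rule assms(3))

lemma thick_set_interval_times_open: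
  fixes I :: "real set" and V :: "'a::euclidean_space set"
  assumes I: "is_interval I" "interior I \<noteq> {}" and V: "open V"
  shows "thick_set (I \<times> V)"
proof
  fix x i :: "real \<times> 'a" and \<epsilon> :: real
  assume x: "x \<in> I \<times> V" and i: "i \<in> Basis" and \<epsilon>: "\<epsilon> > 0"
  obtain t y where xy: "x = (t, y)" "t \<in> I" "y \<in> V" using x by auto
  consider "i = (1, 0)" | u where "i = (0, u)" "u \<in> Basis"
    using i by (auto simp: Basis_prod_def)
  then show "\<exists>d. 0 < \<bar>d\<bar> \<and> \<bar>d\<bar> < \<epsilon> \<and> x + d *\<^sub>R i \<in> I \<times> V"
  proof cases
    case 1
    obtain s where "s \<in> I" "s \<noteq> t" "dist s t < \<epsilon>"
      using interval_islimpt[OF I xy(2)] \<epsilon> unfolding islimpt_approachable by blast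
    then show ?thesis
      using 1 xy by (intro exI[of _ "s - t"]) (auto simp: dist_real_def)
  next
    case 2
    obtain r where r: "r > 0" "ball y r \<subseteq> V"
      using V xy(3) open_contains_ball by blast
    define d where "d = min \<epsilon> r / 2"
    have d: "0 < d" "d < \<epsilon>" "d < r" using \<epsilon> r by (auto simp: d_def min_def)
    then have "y + d *\<^sub>R u \<in> ball y r" using 2(2) by (simp add: dist_norm)
    then show ?thesis using 2 xy d r by (intro exI[of _ d]) auto
  qed
next
  have "convex I" using I(1) by (simp add: is_interval_convex_1)
  then have "closure (interior I) = closure I" using I(2) by (rule convex_closure_interior)
  then show "I \<times> V \<subseteq> closure (interior (I \<times> V))"
    using V closure_subset by (simp add: interior_Times closure_Times interior_open) (blast intro: closure_subset[THEN subsetD])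
qed

text \<open>\<open>None\<close> is the direction of time, \<open>Some i\<close> that of the coordinate \<open>x\<^sup>i\<close>.\<close>

fun spacetime_dir :: "'n option \<Rightarrow> real \<times> (real ^ 'n)" where
  "spacetime_dir None = (1, 0)"
| "spacetime_dir (Some i) = (0, axis i 1)"

lemma spacetime_dir_Basis: "spacetime_dir k \<in> Basis"
  by (cases k) (auto simp: Basis_prod_def axis_in_Basis_iff)

text \<open>A chart, a time interval, and the point of space-time at which jets are taken.\<close>

locale chart_spacetime =
  fixes c :: "('m::topological_space, 'n::finite) chart" and I :: "real set" and t\<^sub>0 :: real and p\<^sub>0 :: 'm
  assumes I: "is_interval I" "interior I \<noteq> {}"
    and open_image: "open (chart_map c ` chart_dom c)"
    and inj: "inj_on (chart_map c) (chart_dom c)"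
    and t\<^sub>0: "t\<^sub>0 \<in> I" and p\<^sub>0: "p\<^sub>0 \<in> chart_dom c"
begin

abbreviation V :: "(real ^ 'n) set" where "V \<equiv> chart_map c ` chart_dom c"

abbreviation z\<^sub>0 :: "real \<times> (real ^ 'n)" where "z\<^sub>0 \<equiv> (t\<^sub>0, chart_map c p\<^sub>0)"

sublocale thick_set_directions "I \<times> V" spacetime_dir
  by (intro thick_set_directions.intro thick_set_interval_times_open I open_image
      thick_set_directions_axioms.intro spacetime_dir_Basis)

lemma z\<^sub>0: "z\<^sub>0 \<in> I \<times> V" using t\<^sub>0 p\<^sub>0 by simp

text \<open>A time-dependent function on the manifold, written in coordinates.\<close>

definition coord :: "(real \<Rightarrow> 'm \<Rightarrow> real) \<Rightarrow> real \<times> (real ^ 'n) \<Rightarrow> real" where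
  "coord u = (\<lambda>(t, x). u t (chart_inv c x))"

lemma family_smooth_coord: "family_smooth I c u \<longleftrightarrow> smooth_on (coord u) (I \<times> V)"
  by (simp add: family_smooth_def coord_def)

lemma chart_inv_map: "p \<in> chart_dom c \<Longrightarrow> chart_inv c (chart_map c p) = p"
  by (simp add: inj inv_into_f_f)

lemma coord_apply: "p \<in> chart_dom c \<Longrightarrow> coord u (t, chart_map c p) = u t p"
  by (simp add: coord_def chart_inv_map)

text \<open>The family \<open>u\<close> is smooth in the chart and \<open>r\<close> is its jet. The rules below follow the syntax of the
  coordinate formulas, so that they compute the jets of all tensors derived from \<open>g\<close>, \<open>H\<close>, \<open>\<alpha>\<close>.\<close>

definition rep :: "(real \<Rightarrow> 'm \<Rightarrow> real) \<Rightarrow> 'n option jet \<Rightarrow> bool" where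
  "rep u r \<longleftrightarrow> family_smooth I c u \<and> jet_at z\<^sub>0 (coord u) = r"

lemma rep_smooth: "rep u r \<Longrightarrow> smooth_on (coord u) (I \<times> V)"
  by (simp add: rep_def family_smooth_coord)

lemma repI:
  assumes "smooth_on f (I \<times> V)" "jet_at z\<^sub>0 f = r"
    "\<And>t p. t \<in> I \<Longrightarrow> p \<in> chart_dom c \<Longrightarrow> u t p = f (t, chart_map c p)"
  shows "rep u r"
proof -
  have "f z = coord u z" if "z \<in> I \<times> V" for z
    using that assms(3) by (auto simp: coord_apply)
  then show ?thesis
    using smooth_on_cong[OF assms(1)] jet_at_cong[of f "coord u" z\<^sub>0] assms(2) z\<^sub>0
    by (auto simp: rep_def family_smooth_coord)
qed

lemma rep_jet: "family_smooth I c u \<Longrightarrow> rep u (jet_at z\<^sub>0 (coord u))"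
  by (simp add: rep_def)

lemma rep_unique:
  assumes "rep u r" "rep v s" "\<And>t p. t \<in> I \<Longrightarrow> p \<in> chart_dom c \<Longrightarrow> u t p = v t p"
  shows "r = s"
proof -
  have "coord u z = coord v z" if "z \<in> I \<times> V" for z
    using that assms(3) by (auto simp: coord_apply)
  then show ?thesis using assms(1,2) z\<^sub>0 jet_at_cong unfolding rep_def by metis
qed

lemma rep_value: "rep u r \<Longrightarrow> u t\<^sub>0 p\<^sub>0 = jet_value r"
  using jet_value_jet_at[OF rep_smooth z\<^sub>0] p\<^sub>0 by (auto simp: rep_def coord_apply)

lemma rep_const: "rep (\<lambda>t p. x) (x *\<^sub>R 1)"
  by (rule repI[OF smooth_on_const jet_at_const[OF z\<^sub>0]]) simp

lemma rep_add: "rep u r \<Longrightarrow> rep v s \<Longrightarrow> rep (\<lambda>t p. u t p + v t p) (r + s)"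
  by (rule repI[OF smooth_on_add[OF rep_smooth rep_smooth]])
    (auto simp: jet_at_add[OF rep_smooth rep_smooth z\<^sub>0] coord_apply, auto simp: rep_def)

lemma rep_mult: "rep u r \<Longrightarrow> rep v s \<Longrightarrow> rep (\<lambda>t p. u t p * v t p) (r * s)"
  by (rule repI[OF smooth_on_mult[OF rep_smooth rep_smooth]])
    (auto simp: jet_at_mult[OF rep_smooth rep_smooth z\<^sub>0] coord_apply, auto simp: rep_def)

lemma rep_scaleR: "rep u r \<Longrightarrow> rep (\<lambda>t p. x * u t p) (x *\<^sub>R r)"
  using rep_mult[OF rep_const, of u r x] by simp

lemma rep_minus: "rep u r \<Longrightarrow> rep (\<lambda>t p. - u t p) (- r)"
  using rep_scaleR[of u r "-1"] by simp

lemma rep_diff: "rep u r \<Longrightarrow> rep v s \<Longrightarrow> rep (\<lambda>t p. u t p - v t p) (r - s)"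
  using rep_add[OF _ rep_minus, of u r v s] by simp

lemma rep_sum: "(\<And>i. rep (u i) (r i)) \<Longrightarrow> rep (\<lambda>t p. \<Sum>i\<in>X. u i t p) (\<Sum>i\<in>X. r i)"
proof (induction X rule: infinite_finite_induct)
  case (insert i X)
  then show ?case using rep_add[of "u i" "r i"] by simp
qed (use rep_const[of 0] in auto)

text \<open>At interior times and at the endpoints alike, the spatial derivative of a time slice is the
  partial derivative within space-time.\<close>

lemma pd_eq_dird:
  assumes u: "family_smooth I c u" and t: "t \<in> I" and p: "p \<in> chart_dom c"
  shows "pd c i (u t) p = dird (I \<times> V) (spacetime_dir (Some i)) (coord u) (t, chart_map c p)"
proof -
  let ?x = "chart_map c p"
  let ?L = "\<lambda>v. \<Sum>e\<in>Basis. (v \<bullet> e) * dird (I \<times> V) e (coord u) (t, ?x)"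
  have "(coord u has_derivative ?L) (at (t, ?x) within I \<times> V)"
    using u t p by (intro smooth_on_has_derivative) (auto simp: family_smooth_coord)
  then have "(coord u has_derivative ?L) (at (t, ?x) within (\<lambda>x. (t, x)) ` V)"
    using t by (auto intro: has_derivative_subset)
  moreover have "((\<lambda>x. (t, x)) has_derivative (\<lambda>v. (0, v))) (at ?x within V)"
    by (intro has_derivative_Pair has_derivative_const has_derivative_ident)
  ultimately have "((\<lambda>x. coord u (t, x)) has_derivative (\<lambda>v. ?L (0, v))) (at ?x within V)"
    by (rule has_derivative_in_compose[rotated])
  then have "((\<lambda>x. u t (chart_inv c x)) has_derivative (\<lambda>v. ?L (0, v))) (at ?x)"
    using p at_within_open[OF _ open_image, of ?x] by (simp add: coord_def)
  then have "frechet_derivative (\<lambda>x. u t (chart_inv c x)) (at ?x) = (\<lambda>v. ?L (0, v))"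
    by (rule frechet_derivative_at[symmetric])
  moreover have "?L (spacetime_dir (Some i)) = dird (I \<times> V) (spacetime_dir (Some i)) (coord u) (t, ?x)"
    using u t p by (intro dird_eq[symmetric] smooth_on_has_derivative) (auto simp: family_smooth_coord)
  ultimately show ?thesis by (simp add: pd_def)
qed

lemma rep_pd:
  assumes "rep u r"
  shows "rep (\<lambda>t p. pd c i (u t) p) (jet_deriv (Some i) r)"
proof (rule repI)
  show "smooth_on (dird (I \<times> V) (spacetime_dir (Some i)) (coord u)) (I \<times> V)"
    using assms by (intro smooth_on_dird rep_smooth spacetime_dir_Basis)
  show "jet_at z\<^sub>0 (dird (I \<times> V) (spacetime_dir (Some i)) (coord u)) = jet_deriv (Some i) r"
    using jet_at_dird[OF rep_smooth[OF assms] z\<^sub>0] assms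
    by (simp add: rep_def del: spacetime_dir.simps)
qed (use assms pd_eq_dird in \<open>simp add: rep_def\<close>)

lemma time_deriv_eq_dird:
  assumes u: "family_smooth I c u" and t: "t \<in> I" and p: "p \<in> chart_dom c"
  shows "((\<lambda>s. u s p) has_real_derivative
     dird (I \<times> V) (spacetime_dir None) (coord u) (t, chart_map c p)) (at t within I)"
proof -
  let ?x = "chart_map c p"
  let ?L = "\<lambda>v. \<Sum>e\<in>Basis. (v \<bullet> e) * dird (I \<times> V) e (coord u) (t, ?x)"
  have L: "(coord u has_derivative ?L) (at (t, ?x) within I \<times> V)"
    using u t p by (intro smooth_on_has_derivative) (auto simp: family_smooth_coord)
  then have "(coord u has_derivative ?L) (at (t, ?x) within (\<lambda>s. (s, ?x)) ` I)"
    using p by (auto intro: has_derivative_subset)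
  moreover have "((\<lambda>s. (s, ?x)) has_derivative (\<lambda>v. (v, 0))) (at t within I)"
    by (intro has_derivative_Pair has_derivative_const has_derivative_ident)
  ultimately have "((\<lambda>s. coord u (s, ?x)) has_derivative (\<lambda>v. ?L (v, 0))) (at t within I)"
    by (rule has_derivative_in_compose[rotated])
  moreover have "(\<lambda>v. ?L (v, 0)) = (*) (dird (I \<times> V) (spacetime_dir None) (coord u) (t, ?x))"
  proof
    fix v :: real
    have "linear ?L" using L has_derivative_linear by blast
    then have "?L (v *\<^sub>R (1, 0)) = v * ?L (1, 0)" by (subst linear_scale) simp_all
    moreover have "?L (1, 0) = dird (I \<times> V) (spacetime_dir None) (coord u) (t, ?x)"
      using dird_eq[OF L, of "spacetime_dir None"] t p by simp
    ultimately show "?L (v, 0) = dird (I \<times> V) (spacetime_dir None) (coord u) (t, ?x) * v"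
      by (simp add: mult.commute)
  qed
  ultimately show ?thesis
    using p by (simp add: has_field_derivative_def coord_apply)
qed

lemma at_within_I: "t \<in> I \<Longrightarrow> at t within I \<noteq> bot"
  using interval_islimpt[OF I] trivial_limit_within by blast

lemma rep_time_deriv:
  assumes u: "rep u r" and v: "\<And>t p. t \<in> I \<Longrightarrow> p \<in> chart_dom c \<Longrightarrow>
      ((\<lambda>s. u s p) has_real_derivative v t p) (at t within I)"
  shows "rep v (jet_deriv None r)"
proof (rule repI)
  show "smooth_on (dird (I \<times> V) (spacetime_dir None) (coord u)) (I \<times> V)"
    using assms by (intro smooth_on_dird rep_smooth spacetime_dir_Basis)
  show "jet_at z\<^sub>0 (dird (I \<times> V) (spacetime_dir None) (coord u)) = jet_deriv None r"
    using jet_at_dird[OF rep_smooth[OF u] z\<^sub>0] u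
    by (simp add: rep_def del: spacetime_dir.simps)
  show "v t p = dird (I \<times> V) (spacetime_dir None) (coord u) (t, chart_map c p)"
    if "t \<in> I" "p \<in> chart_dom c" for t p
    using v[OF that] time_deriv_eq_dird[OF _ that, of u] u at_within_I[OF that(1)]
    unfolding rep_def has_real_derivative_iff_has_vector_derivative
    by (blast intro: vector_derivative_unique_within)
qed

lemma rep_vector_derivative:
  assumes "rep u r"
  shows "vector_derivative (\<lambda>s. u s p\<^sub>0) (at t\<^sub>0 within I) = jet_value (jet_deriv None r)"
proof -
  have s: "family_smooth I c u" using assms by (simp add: rep_def)
  have "vector_derivative (\<lambda>s. u s p\<^sub>0) (at t\<^sub>0 within I) =
      dird (I \<times> V) (spacetime_dir None) (coord u) z\<^sub>0"
    using time_deriv_eq_dird[OF s t\<^sub>0 p\<^sub>0] at_within_I[OF t\<^sub>0]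
    unfolding has_real_derivative_iff_has_vector_derivative
    by (intro vector_derivative_within)
  also have "\<dots> = jet_value (jet_at z\<^sub>0 (dird (I \<times> V) (spacetime_dir None) (coord u)))"
    using assms by (intro jet_value_jet_at[symmetric] smooth_on_dird rep_smooth spacetime_dir_Basis z\<^sub>0)
  also have "\<dots> = jet_value (jet_deriv None r)"
    using jet_at_dird[OF rep_smooth[OF assms] z\<^sub>0] assms
    by (simp add: rep_def del: spacetime_dir.simps)
  finally show ?thesis .
qed

lemma family_smooth_static:
  "chart_smooth c f \<Longrightarrow> family_smooth I c (\<lambda>t. f)"
  using smooth_on_snd[of "\<lambda>x. f (chart_inv c x)" V I]
  by (simp add: chart_smooth_def family_smooth_def case_prod_unfold)

end

section \<open>The flow in a chart\<close>

lemma jet_value_numeral: "jet_value (numeral n) = numeral n"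
proof -
  have "(numeral n :: 'a jet) = numeral n *\<^sub>R 1"
    by (simp add: scaleR_conv_of_real)
  then show ?thesis by (simp only: jet_value_simps mult_1_right)
qed

text \<open>The hypotheses of the evolution equation in a single chart, with a primitive \<open>b\<close> of \<open>H - H\<^sub>0\<close>.\<close>

locale chart_flow = chart_spacetime c I t\<^sub>0 p\<^sub>0
  for c :: "('m::topological_space, 'n::finite) chart" and I t\<^sub>0 p\<^sub>0 +
  fixes g :: "real \<Rightarrow> ('m, 'n) field2" and H :: "real \<Rightarrow> ('m, 'n) field3" and \<alpha> :: "real \<Rightarrow> ('m, 'n) field1"
    and H\<^sub>0 :: "('m, 'n) field3" and b :: "real \<Rightarrow> ('m, 'n) field2"
  assumes g_smooth: "family_smooth I c (\<lambda>t p. g t c p i j)"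
    and g_sym: "t \<in> I \<Longrightarrow> p \<in> chart_dom c \<Longrightarrow> g t c p i j = g t c p j i"
    and g_pos: "t \<in> I \<Longrightarrow> p \<in> chart_dom c \<Longrightarrow> v \<noteq> (\<lambda>i. 0) \<Longrightarrow>
      (\<Sum>i\<in>UNIV. \<Sum>j\<in>UNIV. g t c p i j * v i * v j) > 0"
    and H_antisym: "t \<in> I \<Longrightarrow> p \<in> chart_dom c \<Longrightarrow> H t c p i j k = - H t c p j i k"
      "t \<in> I \<Longrightarrow> p \<in> chart_dom c \<Longrightarrow> H t c p i j k = - H t c p i k j"
    and H_closed: "t \<in> I \<Longrightarrow> p \<in> chart_dom c \<Longrightarrow> ext_d3 (H t) c p i j k l = 0"
    and H\<^sub>0_smooth: "chart_smooth c (\<lambda>p. H\<^sub>0 c p i j k)"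
    and b_smooth: "family_smooth I c (\<lambda>t p. b t c p i j)"
    and \<alpha>_smooth: "family_smooth I c (\<lambda>t p. \<alpha> t c p i)"
    and H_eq: "t \<in> I \<Longrightarrow> p \<in> chart_dom c \<Longrightarrow> H t c p i j k = H\<^sub>0 c p i j k + ext_d2 (b t) c p i j k"
    and flow_g: "t \<in> I \<Longrightarrow> p \<in> chart_dom c \<Longrightarrow> ((\<lambda>s. g s c p i j) has_real_derivative
      - 2 * Rc (g t) c p i j + (1/2) * Hsq (g t) (H t) c p i j) (at t within I)"
    and flow_b: "t \<in> I \<Longrightarrow> p \<in> chart_dom c \<Longrightarrow> ((\<lambda>s. b s c p i j) has_real_derivative
      - codiff3 (g t) (H t) c p i j) (at t within I)"
    and flow_\<alpha>: "t \<in> I \<Longrightarrow> p \<in> chart_dom c \<Longrightarrow> ((\<lambda>s. \<alpha> s c p i) has_real_derivative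
      hodge_laplacian1 (g t) (\<alpha> t) c p i + (1/6) * ext_d0 (normsq3 (g t) (H t)) c p i) (at t within I)"
begin

abbreviation jet :: "(real \<Rightarrow> 'm \<Rightarrow> real) \<Rightarrow> 'n option jet" where
  "jet u \<equiv> jet_at z\<^sub>0 (coord u)"

abbreviation D :: "'n \<Rightarrow> 'n option jet \<Rightarrow> 'n option jet" where
  "D i \<equiv> jet_deriv (Some i)"

abbreviation D\<^sub>t :: "'n option jet \<Rightarrow> 'n option jet" where
  "D\<^sub>t \<equiv> jet_deriv None"

text \<open>The jets of the components. Those of \<open>\<Gamma>\<close> and \<open>H\<close> are defined by the formulas for the
  Christoffel symbols and for \<open>H\<^sub>0 + db\<close>.\<close>

definition gJ :: "'n \<Rightarrow> 'n \<Rightarrow> 'n option jet" where "gJ i j = jet (\<lambda>t p. g t c p i j)"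
definition GJ :: "'n \<Rightarrow> 'n \<Rightarrow> 'n option jet" where "GJ i j = jet (\<lambda>t p. ginv (g t) c p i j)"
definition \<Gamma>J :: "'n \<Rightarrow> 'n \<Rightarrow> 'n \<Rightarrow> 'n option jet" where
  "\<Gamma>J k i j = (1/2) *\<^sub>R (\<Sum>l\<in>UNIV. GJ k l * (D i (gJ j l) + D j (gJ i l) - D l (gJ i j)))"
definition bJ :: "'n \<Rightarrow> 'n \<Rightarrow> 'n option jet" where "bJ i j = jet (\<lambda>t p. b t c p i j)"
definition H\<^sub>0J :: "'n \<Rightarrow> 'n \<Rightarrow> 'n \<Rightarrow> 'n option jet" where "H\<^sub>0J i j k = jet (\<lambda>t p. H\<^sub>0 c p i j k)"
definition HJ :: "'n \<Rightarrow> 'n \<Rightarrow> 'n \<Rightarrow> 'n option jet" where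
  "HJ i j k = H\<^sub>0J i j k + (D i (bJ j k) - D j (bJ i k) + D k (bJ i j))"
definition \<alpha>J :: "'n \<Rightarrow> 'n option jet" where "\<alpha>J i = jet (\<lambda>t p. \<alpha> t c p i)"

lemma invertible_g:
  assumes "t \<in> I" "p \<in> chart_dom c"
  shows "invertible ((\<chi> k l. g t c p k l) :: real ^ 'n ^ 'n)"
proof -
  let ?M = "(\<chi> k l. g t c p k l) :: real ^ 'n ^ 'n"
  have "x = 0" if x: "?M *v x = 0" for x
  proof (rule ccontr)
    assume "x \<noteq> 0"
    then have "(\<lambda>i. x $ i) \<noteq> (\<lambda>i. 0)" by (auto simp: vec_eq_iff fun_eq_iff)
    from g_pos[OF assms this] have "(\<Sum>i\<in>UNIV. x $ i * (?M *v x) $ i) > 0"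
      by (simp add: matrix_vector_mult_def sum_distrib_left ac_simps)
    then show False by (simp add: x)
  qed
  then show ?thesis
    by (simp add: invertible_left_inverse matrix_left_invertible_ker)
qed

lemma rep_g: "rep (\<lambda>t p. g t c p i j) (gJ i j)"
  unfolding gJ_def by (rule rep_jet[OF g_smooth])

lemma rep_b: "rep (\<lambda>t p. b t c p i j) (bJ i j)"
  unfolding bJ_def by (rule rep_jet[OF b_smooth])

lemma rep_\<alpha>: "rep (\<lambda>t p. \<alpha> t c p i) (\<alpha>J i)"
  unfolding \<alpha>J_def by (rule rep_jet[OF \<alpha>_smooth])

lemma rep_H\<^sub>0: "rep (\<lambda>t p. H\<^sub>0 c p i j k) (H\<^sub>0J i j k)"
  unfolding H\<^sub>0J_def by (rule rep_jet[OF family_smooth_static[OF H\<^sub>0_smooth]])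

lemma rep_ginv: "rep (\<lambda>t p. ginv (g t) c p i j) (GJ i j)"
  unfolding GJ_def
proof (rule rep_jet)
  let ?M = "\<lambda>z. (\<chi> k l. coord (\<lambda>t p. g t c p k l) z) :: real ^ 'n ^ 'n"
  have "smooth_on (\<lambda>z. matrix_inv (?M z) $ i $ j) (I \<times> V)"
  proof (rule smooth_on_matrix_inv)
    show "smooth_on (\<lambda>z. ?M z $ k $ l) (I \<times> V)" for k l
      using g_smooth[of k l] by (simp add: family_smooth_coord)
    show "invertible (?M z)" if "z \<in> I \<times> V" for z
      using that invertible_g by (auto simp: coord_apply)
  qed
  then show "family_smooth I c (\<lambda>t p. ginv (g t) c p i j)"
    by (simp add: family_smooth_def ginv_def coord_def case_prod_unfold)
qed

lemmas rep_rules = rep_pd rep_add rep_diff rep_minus rep_sum rep_mult rep_scaleR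

lemma rep_time_deriv_unique:
  assumes "rep u r" "rep v s" "\<And>t p. t \<in> I \<Longrightarrow> p \<in> chart_dom c \<Longrightarrow>
      ((\<lambda>s. u s p) has_real_derivative v t p) (at t within I)"
  shows "D\<^sub>t r = s"
  using rep_unique[OF rep_time_deriv[OF assms(1,3)] assms(2)] by simp

lemma rep_christoffel: "rep (\<lambda>t p. christoffel (g t) c p k i j) (\<Gamma>J k i j)"
  unfolding christoffel_def \<Gamma>J_def by (intro rep_rules rep_g rep_ginv)

lemma rep_cong: "rep u r \<Longrightarrow> (\<And>t p. t \<in> I \<Longrightarrow> p \<in> chart_dom c \<Longrightarrow> v t p = u t p) \<Longrightarrow> rep v r"
  by (rule repI[of "coord u"]) (auto simp: rep_def family_smooth_coord coord_apply)

text \<open>In particular \<open>H\<close> is jointly smooth in space and time, as \<open>H\<^sub>0\<close> and \<open>b\<close> are.\<close>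

lemma rep_H: "rep (\<lambda>t p. H t c p i j k) (HJ i j k)"
proof (rule rep_cong)
  show "rep (\<lambda>t p. H\<^sub>0 c p i j k + ext_d2 (b t) c p i j k) (HJ i j k)"
    unfolding HJ_def ext_d2_def by (intro rep_rules rep_H\<^sub>0 rep_b)
qed (rule H_eq)

lemma gJ_sym: "gJ i j = gJ j i"
  using rep_unique[OF rep_g rep_g] g_sym by blast

lemma GJ_gJ: "(\<Sum>k\<in>UNIV. GJ i k * gJ k j) = (if i = j then 1 else 0)"
proof -
  have "(\<Sum>k\<in>UNIV. GJ i k * gJ k j) = (if i = j then 1 else 0) *\<^sub>R 1"
  proof (rule rep_unique)
    show "rep (\<lambda>t p. \<Sum>k\<in>UNIV. ginv (g t) c p i k * g t c p k j) (\<Sum>k\<in>UNIV. GJ i k * gJ k j)"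
      by (intro rep_rules rep_g rep_ginv)
    show "rep (\<lambda>t p. if i = j then 1 else 0) ((if i = j then 1 else 0) *\<^sub>R 1)"
      by (rule rep_const)
    show "(\<Sum>k\<in>UNIV. ginv (g t) c p i k * g t c p k j) = (if i = j then 1 else 0)"
      if "t \<in> I" "p \<in> chart_dom c" for t p
      using arg_cong[where f = "\<lambda>M. M $ i $ j", OF matrix_inv_inverse(2)[OF invertible_g[OF that]]]
      by (simp add: matrix_matrix_mult_def ginv_def mat_def)
  qed
  then show ?thesis by simp
qed

lemma GJ_sym: "GJ i j = GJ j i"
proof -
  have gG: "(\<Sum>k\<in>UNIV. gJ l k * GJ j k) = (if l = j then 1 else 0)" for l
    using GJ_gJ[of j l] by (simp add: gJ_sym[of l] mult.commute eq_commute)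
  have "GJ j i = (\<Sum>k\<in>UNIV. (\<Sum>l\<in>UNIV. GJ i l * gJ l k) * GJ j k)"
    by (simp add: GJ_gJ sum_delta_mult)
  also have "\<dots> = (\<Sum>l\<in>UNIV. GJ i l * (\<Sum>k\<in>UNIV. gJ l k * GJ j k))"
    by (simp add: sum_distrib_left sum_distrib_right mult.assoc) (rule sum.swap)
  also have "\<dots> = GJ i j" by (simp add: gG sum_delta_mult)
  finally show ?thesis ..
qed

lemma \<Gamma>J_sym: "\<Gamma>J m i j = \<Gamma>J m j i"
  by (simp add: \<Gamma>J_def gJ_sym[of i j] add.commute)

lemma \<Gamma>J_lower:
  "(\<Sum>m\<in>UNIV. \<Gamma>J m k i * gJ m j) = (1/2) *\<^sub>R (D k (gJ i j) + D i (gJ k j) - D j (gJ k i))"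
proof -
  define X where "X l = D k (gJ i l) + D i (gJ k l) - D l (gJ k i)" for l
  have gG: "(\<Sum>m\<in>UNIV. GJ m l * gJ m j) = (if l = j then 1 else 0)" for l
    using GJ_gJ[of l j] by (simp add: GJ_sym[of l])
  have "(\<Sum>m\<in>UNIV. \<Gamma>J m k i * gJ m j) = (1/2) *\<^sub>R (\<Sum>m\<in>UNIV. \<Sum>l\<in>UNIV. GJ m l * X l * gJ m j)"
    by (simp add: \<Gamma>J_def X_def scaleR_sum_right sum_distrib_right)
  also have "(\<Sum>m\<in>UNIV. \<Sum>l\<in>UNIV. GJ m l * X l * gJ m j) = (\<Sum>l\<in>UNIV. (\<Sum>m\<in>UNIV. GJ m l * gJ m j) * X l)"
    by (subst sum.swap) (simp add: sum_distrib_left sum_distrib_right ac_simps)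
  also have "\<dots> = X j" by (simp add: gG sum_delta_mult)
  finally show ?thesis by (simp add: X_def)
qed

lemma D_gJ: "D k (gJ i j) = (\<Sum>m\<in>UNIV. \<Gamma>J m k i * gJ m j) + (\<Sum>m\<in>UNIV. \<Gamma>J m k j * gJ i m)"
proof -
  have "(\<Sum>m\<in>UNIV. \<Gamma>J m k j * gJ i m) = (\<Sum>m\<in>UNIV. \<Gamma>J m k j * gJ m i)"
    by (simp add: gJ_sym[of i])
  then show ?thesis
    by (simp add: \<Gamma>J_lower gJ_sym[of j i] scaleR_add_right[symmetric] scaleR_2[symmetric] del: scaleR_add_right)
qed

sublocale J: evolving_calculus "\<lambda>i. jet_deriv (Some i)" gJ GJ \<Gamma>J "jet_deriv None"
  by unfold_locales
    (rule jet_deriv_add jet_deriv_mult jet_deriv_scaleR jet_deriv_commute gJ_sym GJ_sym GJ_gJ \<Gamma>J_sym D_gJ)+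

lemma rep_nabla1:
  assumes "\<And>j. rep (\<lambda>t p. a t c p j) (aJ j)"
  shows "rep (\<lambda>t p. nabla1 (g t) (a t) c p i j) (J.cov1 i aJ j)"
  unfolding nabla1_def J.cov1_def by (intro rep_rules rep_christoffel assms)

lemma rep_nabla2:
  assumes "\<And>j k. rep (\<lambda>t p. a t c p j k) (aJ j k)"
  shows "rep (\<lambda>t p. nabla2 (g t) (a t) c p i j k) (J.cov2 i aJ j k)"
  unfolding nabla2_def J.cov2_def by (intro rep_rules rep_christoffel assms)

lemma rep_nabla3:
  assumes "\<And>j k l. rep (\<lambda>t p. a t c p j k l) (aJ j k l)"
  shows "rep (\<lambda>t p. nabla3 (g t) (a t) c p i j k l) (J.cov3 i aJ j k l)"
  unfolding nabla3_def J.cov3_def by (intro rep_rules rep_christoffel assms)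

lemma rep_Rc: "rep (\<lambda>t p. Rc (g t) c p i j) (J.Ric i j)"
  unfolding Rc_def riem_def J.Ric_def J.Rm_def by (intro rep_rules rep_christoffel)

lemma rep_scal: "rep (\<lambda>t p. scal (g t) c p) J.Scal"
  unfolding scal_def J.Scal_def J.ctr_def by (intro rep_rules rep_ginv rep_Rc)

lemma rep_inner2:
  assumes "\<And>i j. rep (\<lambda>t p. S t c p i j) (SJ i j)" "\<And>i j. rep (\<lambda>t p. T t c p i j) (TJ i j)"
  shows "rep (\<lambda>t p. inner2 (g t) (S t) (T t) c p) (J.inn SJ TJ)"
  unfolding inner2_def J.inn_sum[symmetric] by (intro rep_rules rep_ginv assms)

lemma rep_ext_d0:
  assumes "rep (\<lambda>t p. f t c p) r"
  shows "rep (\<lambda>t p. ext_d0 (f t) c p i) (D i r)"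
  unfolding ext_d0_def by (intro rep_rules assms)

lemma rep_laplacian:
  assumes "rep (\<lambda>t p. f t c p) r"
  shows "rep (\<lambda>t p. laplacian (g t) (f t) c p) (J.lap r)"
  unfolding laplacian_def hessian_def J.lap_def J.ctr_def
  by (intro rep_rules rep_ginv rep_nabla1 rep_ext_d0 assms)

lemma rep_divergence: "rep (\<lambda>t p. divergence (g t) (\<alpha> t) c p) (J.dvg \<alpha>J)"
  unfolding divergence_def J.dvg_def J.ctr_def
  by (intro rep_rules rep_ginv rep_nabla1 rep_\<alpha>)

lemma HJ_antisym: "HJ i j k = - HJ j i k" "HJ i j k = - HJ i k j"
  using rep_unique[OF rep_H rep_minus[OF rep_H]] H_antisym by blast+

lemma HJ_closed: "D i (HJ j k l) - D j (HJ i k l) + D k (HJ i j l) - D l (HJ i j k) = 0"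
proof -
  have "D i (HJ j k l) - D j (HJ i k l) + D k (HJ i j l) - D l (HJ i j k) = 0 *\<^sub>R 1"
  proof (rule rep_unique)
    show "rep (\<lambda>t p. ext_d3 (H t) c p i j k l)
        (D i (HJ j k l) - D j (HJ i k l) + D k (HJ i j l) - D l (HJ i j k))"
      unfolding ext_d3_def by (intro rep_rules rep_H)
  qed (rule rep_const, rule H_closed)
  then show ?thesis by simp
qed

sublocale J: three_form_calculus "\<lambda>i. jet_deriv (Some i)" gJ GJ \<Gamma>J HJ
  by unfold_locales (rule HJ_antisym HJ_closed)+

lemma rep_Hsq: "rep (\<lambda>t p. Hsq (g t) (H t) c p i j) (J.Hs i j)"
  unfolding Hsq_def J.Hs_def by (intro rep_inner2 rep_H)

lemma rep_normsq3_H: "rep (\<lambda>t p. normsq3 (g t) (H t) c p) J.nH"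
proof -
  have "J.nH = J.inn3 HJ HJ" by (simp add: J.nH_def J.Hs_def[abs_def] J.inn3_def)
  then show ?thesis
    unfolding inner3_def by (simp only: J.inn3_sum[symmetric]) (intro rep_rules rep_ginv rep_H)
qed

lemma rep_codiff3: "rep (\<lambda>t p. codiff3 (g t) (H t) c p k l) (J.\<beta> k l)"
  unfolding codiff3_def J.\<beta>_def J.ctr_def by (intro rep_rules rep_ginv rep_nabla3 rep_H)

lemma rep_ext_d1: "rep (\<lambda>t p. ext_d1 (\<alpha> t) c p i j) (J.cov1 i \<alpha>J j - J.cov1 j \<alpha>J i)"
proof -
  have "J.cov1 i \<alpha>J j - J.cov1 j \<alpha>J i = D i (\<alpha>J j) - D j (\<alpha>J i)"
    by (simp add: J.cov1_def \<Gamma>J_sym[of _ j i])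
  then show ?thesis
    unfolding ext_d1_def by (simp only:) (intro rep_rules rep_\<alpha>)
qed

lemma rep_hodge: "rep (\<lambda>t p. hodge_laplacian1 (g t) (\<alpha> t) c p i) (J.hodge \<alpha>J i)"
proof -
  have "rep (\<lambda>t p. codiff1 (g t) (\<alpha> t) c p) (- J.dvg \<alpha>J)"
    unfolding codiff1_def J.dvg_def J.ctr_def by (intro rep_rules rep_ginv rep_nabla1 rep_\<alpha>)
  moreover have "rep (\<lambda>t p. codiff2 (g t) (ext_d1 (\<alpha> t)) c p i)
      (- J.ctr (\<lambda>j k. J.cov2 j (\<lambda>k i. J.cov1 k \<alpha>J i - J.cov1 i \<alpha>J k) k i))"
    unfolding codiff2_def J.ctr_def by (intro rep_rules rep_ginv rep_nabla2 rep_ext_d1)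
  ultimately have "rep (\<lambda>t p. hodge_laplacian1 (g t) (\<alpha> t) c p i) (- (D i (- J.dvg \<alpha>J)
      + - J.ctr (\<lambda>j k. J.cov2 j (\<lambda>k i. J.cov1 k \<alpha>J i - J.cov1 i \<alpha>J k) k i)))"
    unfolding hodge_laplacian1_def by (intro rep_minus rep_add rep_ext_d0)
  then show ?thesis by (simp add: J.hodge_def J.D_minus add.commute)
qed

lemma flow_gJ: "2 * D\<^sub>t (gJ i j) = J.Hs i j - 4 * J.Ric i j"
proof -
  have "D\<^sub>t (gJ i j) = (- 2) *\<^sub>R J.Ric i j + (1/2) *\<^sub>R J.Hs i j"
    by (rule rep_time_deriv_unique[OF rep_g _ flow_g]) (intro rep_rules rep_Rc rep_Hsq)
  then show ?thesis
    by (simp only: numeral_mult_eq_scaleR scaleR_add_right scaleR_scaleR) simp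
qed

lemma flow_bJ: "D\<^sub>t (bJ i j) = - J.\<beta> i j"
  by (rule rep_time_deriv_unique[OF rep_b rep_minus[OF rep_codiff3] flow_b])

lemma flow_HJ: "D\<^sub>t (HJ i j k) = - (D i (J.\<beta> j k) - D j (J.\<beta> i k) + D k (J.\<beta> i j))"
proof -
  have "D\<^sub>t (H\<^sub>0J i j k) = 0 *\<^sub>R 1"
    by (rule rep_time_deriv_unique[OF rep_H\<^sub>0 rep_const]) simp
  then show ?thesis
    by (simp add: HJ_def J.\<delta>_simps J.\<delta>_D flow_bJ J.D_minus)
qed

lemma flow_\<alpha>J: "6 * D\<^sub>t (\<alpha>J i) = 6 * J.hodge \<alpha>J i + D i J.nH"
proof -
  have "D\<^sub>t (\<alpha>J i) = J.hodge \<alpha>J i + (1/6) *\<^sub>R D i J.nH"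
    by (rule rep_time_deriv_unique[OF rep_\<alpha> _ flow_\<alpha>])
      (intro rep_add rep_scaleR rep_hodge rep_ext_d0 rep_normsq3_H)
  then show ?thesis
    by (simp only: numeral_mult_eq_scaleR scaleR_add_right scaleR_scaleR) simp
qed

sublocale J: flow_calculus "\<lambda>i. jet_deriv (Some i)" gJ GJ \<Gamma>J "jet_deriv None" HJ \<alpha>J
  by unfold_locales (rule flow_gJ flow_HJ flow_\<alpha>J)+

lemma rep_gen_scal:
  "rep (\<lambda>t p. gen_scal (g t) (H t) (\<alpha> t) c p)
     (J.Scal - (1/12) *\<^sub>R J.nH + 2 *\<^sub>R J.dvg \<alpha>J - J.n\<alpha>)"
proof -
  have "rep (\<lambda>t p. normsq1 (g t) (\<alpha> t) c p) J.n\<alpha>"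
    unfolding inner1_def J.n\<alpha>_def J.ctr_def mult.assoc by (intro rep_rules rep_ginv rep_\<alpha>)
  then show ?thesis
    unfolding gen_scal_def by (intro rep_add rep_diff rep_scaleR rep_scal rep_normsq3_H rep_divergence)
qed

lemma rep_interior3:
  "rep (\<lambda>t p. interior3 (sharp (g t) (\<alpha> t)) (H t) c p j k) (J.ctr (\<lambda>i l. \<alpha>J l * HJ i j k))"
proof -
  have "J.ctr (\<lambda>i l. \<alpha>J l * HJ i j k) = (\<Sum>i\<in>UNIV. (\<Sum>l\<in>UNIV. GJ i l * \<alpha>J l) * HJ i j k)"
    by (simp add: J.ctr_def sum_distrib_right mult.assoc)
  then show ?thesis
    unfolding interior3_def sharp_def by (simp only:) (intro rep_rules rep_ginv rep_\<alpha> rep_H)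
qed

lemma rep_lie2:
  "rep (\<lambda>t p. lie2 (\<lambda>c p i. (1/2) * sharp (g t) (\<alpha> t) c p i) (g t) c p i j)
     ((1/2) *\<^sub>R (J.cov1 i \<alpha>J j + J.cov1 j \<alpha>J i))"
proof -
  define X where "X k = (\<Sum>l\<in>UNIV. GJ k l * \<alpha>J l)" for k
  have "rep (\<lambda>t p. lie2 (\<lambda>c p i. (1/2) * sharp (g t) (\<alpha> t) c p i) (g t) c p i j)
     (\<Sum>k\<in>UNIV. (1/2) *\<^sub>R X k * D k (gJ i j) + gJ k j * D i ((1/2) *\<^sub>R X k) + gJ i k * D j ((1/2) *\<^sub>R X k))"
    unfolding lie2_def sharp_def X_def by (intro rep_rules rep_g rep_ginv rep_\<alpha>)
  also have "(\<Sum>k\<in>UNIV. (1/2) *\<^sub>R X k * D k (gJ i j) + gJ k j * D i ((1/2) *\<^sub>R X k) + gJ i k * D j ((1/2) *\<^sub>R X k))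
     = (1/2) *\<^sub>R (\<Sum>k\<in>UNIV. X k * D k (gJ i j) + gJ k j * D i (X k) + gJ i k * D j (X k))"
    by (simp add: scaleR_sum_right scaleR_add_right J.D_scaleR)
  also have "(\<Sum>k\<in>UNIV. X k * D k (gJ i j) + gJ k j * D i (X k) + gJ i k * D j (X k)) =
      J.cov1 i \<alpha>J j + J.cov1 j \<alpha>J i"
    unfolding X_def by (rule J.lie_g)
  finally show ?thesis .
qed

theorem heat_operator_gen_scal:
  "heat_operator I g (\<lambda>s. gen_scal (g s) (H s) (\<alpha> s)) t\<^sub>0 c p\<^sub>0 =
      2 * normsq2 (g t\<^sub>0) (\<lambda>c p i j. Rc (g t\<^sub>0) c p i j - (1/4) * Hsq (g t\<^sub>0) (H t\<^sub>0) c p i j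
            + lie2 (\<lambda>c p i. (1/2) * sharp (g t\<^sub>0) (\<alpha> t\<^sub>0) c p i) (g t\<^sub>0) c p i j) c p\<^sub>0
      + (1/2) * normsq2 (g t\<^sub>0) (ext_d1 (\<alpha> t\<^sub>0)) c p\<^sub>0
      + (1/2) * normsq2 (g t\<^sub>0) (\<lambda>c p i j. codiff3 (g t\<^sub>0) (H t\<^sub>0) c p i j
            + interior3 (sharp (g t\<^sub>0) (\<alpha> t\<^sub>0)) (H t\<^sub>0) c p i j) c p\<^sub>0"
proof -
  note u = rep_gen_scal
  note lap_u = rep_laplacian[where f = "\<lambda>t. gen_scal (g t) (H t) (\<alpha> t)", OF u]
  have E: "rep (\<lambda>t p. normsq2 (g t) (\<lambda>c p i j. Rc (g t) c p i j - (1/4) * Hsq (g t) (H t) c p i j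
            + lie2 (\<lambda>c p i. (1/2) * sharp (g t) (\<alpha> t) c p i) (g t) c p i j) c p)
      ((1/16) *\<^sub>R J.inn J.E J.E)"
  proof -
    have e: "J.Ric i j - (1/4) *\<^sub>R J.Hs i j + (1/2) *\<^sub>R (J.cov1 i \<alpha>J j + J.cov1 j \<alpha>J i) = (1/4) *\<^sub>R J.E i j" for i j
      by (simp add: J.E_def numeral_mult_eq_scaleR scaleR_add_right scaleR_diff_right)
    have "rep (\<lambda>t p. normsq2 (g t) (\<lambda>c p i j. Rc (g t) c p i j - (1/4) * Hsq (g t) (H t) c p i j
            + lie2 (\<lambda>c p i. (1/2) * sharp (g t) (\<alpha> t) c p i) (g t) c p i j) c p)
        (J.inn (\<lambda>i j. (1/4) *\<^sub>R J.E i j) (\<lambda>i j. (1/4) *\<^sub>R J.E i j))"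
      unfolding e[symmetric]
      by (intro rep_inner2 rep_add rep_diff rep_scaleR rep_Rc rep_Hsq rep_lie2)
    then show ?thesis by (simp add: J.inn_simps)
  qed
  have d: "rep (\<lambda>t p. normsq2 (g t) (ext_d1 (\<alpha> t)) c p)
      (J.inn (\<lambda>i j. J.cov1 i \<alpha>J j - J.cov1 j \<alpha>J i) (\<lambda>i j. J.cov1 i \<alpha>J j - J.cov1 j \<alpha>J i))"
    by (intro rep_inner2 rep_ext_d1)
  have F: "rep (\<lambda>t p. normsq2 (g t) (\<lambda>c p i j. codiff3 (g t) (H t) c p i j
            + interior3 (sharp (g t) (\<alpha> t)) (H t) c p i j) c p)
      (J.inn (\<lambda>j k. J.\<beta> j k + J.ctr (\<lambda>i l. \<alpha>J l * HJ i j k)) (\<lambda>j k. J.\<beta> j k + J.ctr (\<lambda>i l. \<alpha>J l * HJ i j k)))"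
    by (intro rep_inner2 rep_add rep_codiff3 rep_interior3)
  note evolution = J.evolution_Scal J.evolution_nH J.evolution_dvg J.evolution_n\<alpha>
  note evolution' = evolution[THEN arg_cong[where f = jet_value],
      unfolded jet_value_simps jet_value_numeral]
  show ?thesis
    unfolding heat_operator_def rep_vector_derivative[OF u] rep_value[OF lap_u]
      rep_value[OF E] rep_value[OF d] rep_value[OF F] J.inn_E J.inn_d\<alpha> J.inn_\<beta>_i\<alpha>H
      J.\<delta>_simps J.lap_add J.lap_diff J.lap_scaleR jet_value_simps jet_value_numeral
    using evolution' by (simp add: field_simps)
qed

end

section \<open>The evolution equation\<close>

theorem proposition2p9:
  fixes A :: "('m::{t2_space, second_countable_topology}, 'n::finite) chart set"
    and I :: "real set"
    and g :: "real \<Rightarrow> ('m, 'n) field2"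
    and H :: "real \<Rightarrow> ('m, 'n) field3"
    and \<alpha> :: "real \<Rightarrow> ('m, 'n) field1"
  assumes "smooth_atlas A"
    and "time_interval I"
    and "generalized_Ricci_flow A I g H"
    and "one_form_dilaton_flow A I g H \<alpha>"
  shows "\<forall>t\<in>I. \<forall>c\<in>A. \<forall>p\<in>chart_dom c.
    heat_operator I g (\<lambda>s. gen_scal (g s) (H s) (\<alpha> s)) t c p =
      2 * normsq2 (g t) (\<lambda>c p i j. Rc (g t) c p i j - (1/4) * Hsq (g t) (H t) c p i j
            + lie2 (\<lambda>c p i. (1/2) * sharp (g t) (\<alpha> t) c p i) (g t) c p i j) c p
      + (1/2) * normsq2 (g t) (ext_d1 (\<alpha> t)) c p
      + (1/2) * normsq2 (g t) (\<lambda>c p i j. codiff3 (g t) (H t) c p i j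
            + interior3 (sharp (g t) (\<alpha> t)) (H t) c p i j) c p"
proof (intro ballI)
  fix t c p
  assume t: "t \<in> I" and c: "c \<in> A" and p: "p \<in> chart_dom c"
  have atlas: "open (chart_map c ` chart_dom c)"
    and homeo: "homeomorphism (chart_dom c) (chart_map c ` chart_dom c) (chart_map c) (chart_inv c)"
    using assms(1) c by (simp_all add: smooth_atlas_def)
  have inj: "inj_on (chart_map c) (chart_dom c)"
    by (rule inj_on_inverseI[of _ "chart_inv c"]) (rule homeomorphism_apply1[OF homeo])
  obtain H\<^sub>0 b where H\<^sub>0: "three_form A H\<^sub>0" and b: "two_form_family A I b"
    and eq: "\<forall>t\<in>I. \<forall>c\<in>A. \<forall>p\<in>chart_dom c. \<forall>i j k.
      H t c p i j k = H\<^sub>0 c p i j k + ext_d2 (b t) c p i j k"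
    and flow: "\<forall>t\<in>I. \<forall>c\<in>A. \<forall>p\<in>chart_dom c. \<forall>i j.
      ((\<lambda>s. g s c p i j) has_real_derivative
        - 2 * Rc (g t) c p i j + (1/2) * Hsq (g t) (H t) c p i j) (at t within I) \<and>
      ((\<lambda>s. b s c p i j) has_real_derivative - codiff3 (g t) (H t) c p i j) (at t within I)"
    using assms(3) unfolding generalized_Ricci_flow_def by (elim conjE exE) rule
  have metric: "metric_family A I g" and H: "\<And>t. t \<in> I \<Longrightarrow> three_form A (H t)" "\<And>t. t \<in> I \<Longrightarrow> closed3 A (H t)"
    using assms(3) unfolding generalized_Ricci_flow_def by auto
  have "chart_flow c I t p g H \<alpha> H\<^sub>0 b"
  proof unfold_locales
    show "is_interval I" "interior I \<noteq> {}" using assms(2) by (auto simp: time_interval_def)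
    show "open (chart_map c ` chart_dom c)" "inj_on (chart_map c) (chart_dom c)" by fact+
    show "t \<in> I" "p \<in> chart_dom c" by fact+
    fix i j k l
    show "family_smooth I c (\<lambda>t p. g t c p i j)"
      using metric c by (simp add: metric_family_def)
    show "family_smooth I c (\<lambda>t p. b t c p i j)"
      using b c by (simp add: two_form_family_def)
    show "chart_smooth c (\<lambda>p. H\<^sub>0 c p i j k)"
      using H\<^sub>0 c by (simp add: three_form_def tensor3_def)
    show "family_smooth I c (\<lambda>t p. \<alpha> t c p i)"
      using assms(4) c by (simp add: one_form_dilaton_flow_def one_form_family_def)
    fix t p
    assume tp: "t \<in> I" "p \<in> chart_dom c"
    show "g t c p i j = g t c p j i"
      using metric c tp unfolding metric_family_def riemannian_metric_def by blast
    show "H t c p i j k = - H t c p j i k" "H t c p i j k = - H t c p i k j"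
      using H(1)[OF tp(1)] c tp(2) unfolding three_form_def by blast+
    show "ext_d3 (H t) c p i j k l = 0"
      using H(2)[OF tp(1)] c tp(2) unfolding closed3_def by blast
    show "H t c p i j k = H\<^sub>0 c p i j k + ext_d2 (b t) c p i j k"
      using eq tp c by simp
    show "((\<lambda>s. g s c p i j) has_real_derivative
        - 2 * Rc (g t) c p i j + 1 / 2 * Hsq (g t) (H t) c p i j) (at t within I)"
      using flow tp c by simp
    show "((\<lambda>s. b s c p i j) has_real_derivative - codiff3 (g t) (H t) c p i j) (at t within I)"
      using flow tp c by simp
    show "((\<lambda>s. \<alpha> s c p i) has_real_derivative
        hodge_laplacian1 (g t) (\<alpha> t) c p i + 1 / 6 * ext_d0 (normsq3 (g t) (H t)) c p i) (at t within I)"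
      using assms(4) tp c by (simp add: one_form_dilaton_flow_def)
    fix v :: "'n \<Rightarrow> real"
    assume "v \<noteq> (\<lambda>i. 0)"
    then show "(\<Sum>i\<in>UNIV. \<Sum>j\<in>UNIV. g t c p i j * v i * v j) > 0"
      using metric c tp unfolding metric_family_def riemannian_metric_def by blast
  qed
  then show "heat_operator I g (\<lambda>s. gen_scal (g s) (H s) (\<alpha> s)) t c p =
      2 * normsq2 (g t) (\<lambda>c p i j. Rc (g t) c p i j - (1/4) * Hsq (g t) (H t) c p i j
            + lie2 (\<lambda>c p i. (1/2) * sharp (g t) (\<alpha> t) c p i) (g t) c p i j) c p
      + (1/2) * normsq2 (g t) (ext_d1 (\<alpha> t)) c p
      + (1/2) * normsq2 (g t) (\<lambda>c p i j. codiff3 (g t) (H t) c p i j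
            + interior3 (sharp (g t) (\<alpha> t)) (H t) c p i j) c p"
    by (rule chart_flow.heat_operator_gen_scal)
qed

end
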